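(* Let $\mathcal{A}$ be one of the inverse-closed matrix algebras $\mathcal{A}_s$, $\mathcal{A}_v$, $\mathcal{A}^1_v$, $\mathcal{C}_v$ on $\mathbb{Z}^d$, where in each case the weight satisfies the following conditions: for $\mathcal{A}_s$, $s>d$; for $\mathcal{A}_v$, $v$ is an admissible weight satisfying the GRS-condition with $v^{-1}\in\ell^1(\mathbb{Z}^d)$ and $v^{-1}\ast v^{-1}\le C_0v^{-1}$ for some constant $C_0$; for $\mathcal{A}^1_v$, $v$ is an admissible weight satisfying the GRS-condition and $v(k)\ge C_0(1+|k|)^\delta$ for all $k$ and some $C_0,\delta>0$; for $\mathcal{C}_v$, $v$ is an admissible weight satisfying the GRS-condition. Let $1\le p,q\le\infty$ and let $m,w$ be weights on $\mathbb{Z}^d$ such that $\ell^p_m(\mathbb{Z}^d)\subseteq\ell^q_w(\mathbb{Z}^d)$, and assume that $\mathcal{A}$ acts boundedly on both $\ell^p_m$ and $\ell^q_w$. Set $r^{-1}=\max\{q^{-1}-p^{-1},0\}$ and $$\varphi(n)=\Big(\sum_{k\notin C_n}\frac{w(k)^r}{m(k)^r}\Big)^{1/r},$$ interpreted as $\sup_{k\notin C_n}w(k)/m(k)$ when $r=\infty$. Let $A\in\mathcal{A}$ be positive and invertible on $\ell^2(\mathbb{Z}^d)$, let $b\in\ell^p_m$ (the "smaller" space), let $x=A^{-1}b$ be the solution of $Ax=b$, and let $x_n$ be the solution of the finite section $A_nx_n=b_n$. Then the finite section method converges in $\ell^q_w$ (the "larger" space), i.e. $x_n\to x$ in $\ell^q_w$,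 with the error estimate $$\|x-x_n\|_{\ell^q_w}\le C\,\|b\|_{\ell^p_m}\,\varphi(n),$$ where $$C=\|A^{-1}\|_{\ell^q_w}\Big(1+\|A\|_{\ell^p_m}\,\|\widetilde{A_n}^{-1}\|_{\mathcal{A}}\Big).$$
   Context: Matrices are $A=(a_{kl})_{k,l\in\mathbb{Z}^d}$ with complex entries, acting by $(Ac)_k=\sum_la_{kl}c_l$. $|\cdot|$ is a norm on $\mathbb{R}^d$. An admissible weight is a non-negative function $v$ on $\mathbb{Z}^d$ that is even, satisfies $v(0)=1$, and is submultiplicative: $v(k+l)\le v(k)v(l)$. It satisfies the GRS-condition if $\lim_{n\to\infty}v(nk)^{1/n}=1$ for all $k\in\mathbb{Z}^d$. Convolution is on $\mathbb{Z}^d$. The matrix algebras are the spaces of matrices with finite norm: $\|A\|_{\mathcal{A}_s}=\sup_{k,l}|a_{kl}|(1+|k-l|)^s$; $\|A\|_{\mathcal{A}_v}=\sup_{k,l}|a_{kl}|v(k-l)$; $\|A\|_{\mathcal{A}^1_v}=\max\{\sup_k\sum_l|a_{kl}|v(k-l),\ \sup_l\sum_k|a_{kl}|v(k-l)\}$; $\|A\|_{\mathcal{C}_v}=\sum_{l}\sup_k|a_{k,k-l}|v(l)$. Inverse-closed means that every $A\in\mathcal{A}$ that is invertible on $\ell^2(\mathbb{Z}^d)$ satisfies $A^{-1}\in\mathcal{A}$; the stated weight conditions are those guaranteeing this. For a weight $m:\mathbb{Z}^d\to(0,\infty)$, $\ell^p_m(\mathbb{Z}^d)$ has norm $\|c\|_{\ell^p_m}=\|cm\|_{\ell^p}$.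 "$\mathcal{A}$ acts boundedly on $\ell^p_m$" means every matrix in $\mathcal{A}$ defines a bounded operator on $\ell^p_m(\mathbb{Z}^d)$. For a matrix $B$, $\|B\|_{\ell^p_m}$ denotes the operator norm of $B$ on $\ell^p_m$, and $\|B\|_{\ell^q_w}$ the operator norm of $B$ on $\ell^q_w$. Finite section method: $C_n=\{-n,\dots,n\}^d\subset\mathbb{Z}^d$, $(P_ny)(k)=\chi_{C_n}(k)y(k)$, $A_n=P_nAP_n$, $b_n=P_nb$; $A_n$ is regarded as a $(2n+1)^d\times(2n+1)^d$ matrix on $\mathbb{C}^{(2n+1)^d}\simeq P_n\ell^2(\mathbb{Z}^d)$, and the solution $x_n$ of $A_nx_n=b_n$ is extended by zero to $\mathbb{Z}^d$. With $\lambda_+=\max\sigma(A)$ (spectrum on $\ell^2(\mathbb{Z}^d)$), $\widetilde{A_n}=A_n+\lambda_+(I-P_n)$. $A^{-1}$ is the inverse of $A$ on $\ell^2(\mathbb{Z}^d)$, regarded as a matrix.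
   Formalization: In C, the term with ‖A‖ carries a factor K, for any K with ‖B‖_{ℓ^p_m} ≤ K‖B‖_𝒜 on 𝒜 (such K exists; K=1 gives the stated C); convergence x_n→x is not claimed when p=q=∞ and φ(n) does not tend to 0; inverse-closedness is assumed as a hypothesis. *)

theory Defs
  imports "HOL-Analysis.Analysis"
begin

text \<open>The index group of dimension \<open>d = CARD('d)\<close> is \<open>int ^ 'd\<close>.\<close>

type_synonym 'd mat = "int ^ 'd \<Rightarrow> int ^ 'd \<Rightarrow> complex"
type_synonym 'd sqn = "int ^ 'd \<Rightarrow> complex"

definition of_idx :: "int ^ 'd \<Rightarrow> real ^ 'd" where
  "of_idx k = (\<chi> i. real_of_int (k $ i))"

definition is_norm :: "('v::real_vector \<Rightarrow> real) \<Rightarrow> bool" where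
  "is_norm f \<longleftrightarrow>
     (\<forall>x. 0 \<le> f x) \<and> (\<forall>x. f x = 0 \<longleftrightarrow> x = 0) \<and>
     (\<forall>a x. f (a *\<^sub>R x) = \<bar>a\<bar> * f x) \<and> (\<forall>x y. f (x + y) \<le> f x + f y)"


section \<open>Weights\<close>

definition admissible :: "(int ^ 'd \<Rightarrow> real) \<Rightarrow> bool" where
  "admissible v \<longleftrightarrow>
     (\<forall>k. 0 \<le> v k) \<and> (\<forall>k. v (- k) = v k) \<and> v 0 = 1 \<and> (\<forall>k l. v (k + l) \<le> v k * v l)"

definition GRS :: "(int ^ 'd \<Rightarrow> real) \<Rightarrow> bool" where
  "GRS v \<longleftrightarrow> (\<forall>k. (\<lambda>n. root n (v (int n *s k))) \<longlonglongrightarrow> 1)"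

definition inv_summable :: "(int ^ 'd \<Rightarrow> real) \<Rightarrow> bool" where
  "inv_summable v \<longleftrightarrow> (\<lambda>k. inverse (v k)) summable_on UNIV"

definition inv_subconvolutive :: "(int ^ 'd \<Rightarrow> real) \<Rightarrow> bool" where
  "inv_subconvolutive v \<longleftrightarrow>
     (\<exists>C\<^sub>0. \<forall>k. (\<Sum>\<^sub>\<infinity>l. inverse (v l) * inverse (v (k - l))) \<le> C\<^sub>0 * inverse (v k))"


section \<open>Matrix algebras\<close>

text \<open>
  The norms take values in \<^typ>\<open>ennreal\<close>, so that each algebra is the set of matrices with finite
  norm.  \<open>N\<close> ranges over norm functions and \<open>f\<close> over norms on \<open>real ^ 'd\<close>.
\<close>

definition norm_As :: "(real ^ 'd \<Rightarrow> real) \<Rightarrow> real \<Rightarrow> 'd mat \<Rightarrow> ennreal" where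
  "norm_As f s A = (SUP (k, l)\<in>UNIV. ennreal (cmod (A k l) * (1 + f (of_idx (k - l))) powr s))"

definition norm_Av :: "(int ^ 'd \<Rightarrow> real) \<Rightarrow> 'd mat \<Rightarrow> ennreal" where
  "norm_Av v A = (SUP (k, l)\<in>UNIV. ennreal (cmod (A k l) * v (k - l)))"

definition norm_A1v :: "(int ^ 'd \<Rightarrow> real) \<Rightarrow> 'd mat \<Rightarrow> ennreal" where
  "norm_A1v v A =
     max (SUP k. \<Sum>\<^sub>\<infinity>l. ennreal (cmod (A k l) * v (k - l)))
         (SUP l. \<Sum>\<^sub>\<infinity>k. ennreal (cmod (A k l) * v (k - l)))"

definition norm_Cv :: "(int ^ 'd \<Rightarrow> real) \<Rightarrow> 'd mat \<Rightarrow> ennreal" where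
  "norm_Cv v A = (\<Sum>\<^sub>\<infinity>l. (SUP k. ennreal (cmod (A k (k - l)))) * ennreal (v l))"

definition carrier_alg :: "(('d::finite) mat \<Rightarrow> ennreal) \<Rightarrow> 'd mat set" where
  "carrier_alg N = {A. N A < \<infinity>}"

definition weighted_algebra_norm :: "(real ^ 'd \<Rightarrow> real) \<Rightarrow> ('d mat \<Rightarrow> ennreal) \<Rightarrow> bool" where
  "weighted_algebra_norm f N \<longleftrightarrow>
     (\<exists>s. real CARD('d) < s \<and> N = norm_As f s) \<or>
     (\<exists>v. admissible v \<and> GRS v \<and> inv_summable v \<and> inv_subconvolutive v \<and> N = norm_Av v) \<or>
     (\<exists>v. admissible v \<and> GRS v \<and>
          (\<exists>C\<^sub>0>0. \<exists>\<delta>>0. \<forall>k. C\<^sub>0 * (1 + f (of_idx k)) powr \<delta> \<le> v k) \<and> N = norm_A1v v) \<or>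
     (\<exists>v. admissible v \<and> GRS v \<and> N = norm_Cv v)"


section \<open>Weighted sequence spaces and matrices acting on them\<close>

text \<open>
  \<open>lp_norm p m c\<close> is the norm only for \<open>c \<in> lp p m\<close> and \<open>op_norm p m B\<close> the operator norm only for
  \<open>B\<close> bounded on \<open>lp p m\<close>; elsewhere the totalised sums and suprema carry no meaning.
\<close>

definition lp :: "ereal \<Rightarrow> (int ^ 'd \<Rightarrow> real) \<Rightarrow> 'd sqn set" where
  "lp p m = {c. if p = \<infinity> then bdd_above (range (\<lambda>k. cmod (c k) * m k))
                else (\<lambda>k. (cmod (c k) * m k) powr real_of_ereal p) summable_on UNIV}"

definition lp_norm :: "ereal \<Rightarrow> (int ^ 'd \<Rightarrow> real) \<Rightarrow> 'd sqn \<Rightarrow> real" where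
  "lp_norm p m c =
     (if p = \<infinity> then (SUP k. cmod (c k) * m k)
      else (\<Sum>\<^sub>\<infinity>k. (cmod (c k) * m k) powr real_of_ereal p) powr (1 / real_of_ereal p))"

definition mat_app :: "('d::finite) mat \<Rightarrow> 'd sqn \<Rightarrow> 'd sqn" where
  "mat_app A c = (\<lambda>k. \<Sum>\<^sub>\<infinity>l. A k l * c l)"

definition bounded_on_lp :: "ereal \<Rightarrow> (int ^ 'd \<Rightarrow> real) \<Rightarrow> 'd mat \<Rightarrow> bool" where
  "bounded_on_lp p m A \<longleftrightarrow>
     (\<forall>c\<in>lp p m. \<forall>k. (\<lambda>l. A k l * c l) summable_on UNIV) \<and>
     (\<exists>K. \<forall>c\<in>lp p m. mat_app A c \<in> lp p m \<and> lp_norm p m (mat_app A c) \<le> K * lp_norm p m c)"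

definition op_norm :: "ereal \<Rightarrow> (int ^ 'd \<Rightarrow> real) \<Rightarrow> 'd mat \<Rightarrow> real" where
  "op_norm p m A = (SUP c\<in>{c \<in> lp p m. lp_norm p m c \<le> 1}. lp_norm p m (mat_app A c))"

abbreviation l2 :: "('d::finite) sqn set" where
  "l2 \<equiv> lp 2 (\<lambda>_. 1)"

abbreviation bounded_on_l2 :: "('d::finite) mat \<Rightarrow> bool" where
  "bounded_on_l2 \<equiv> bounded_on_lp 2 (\<lambda>_. 1)"

text \<open>Every bounded operator on \<open>l2\<close> is given by a matrix, so inverses may be sought among matrices.\<close>

definition l2_inverse_of :: "('d::finite) mat \<Rightarrow> 'd mat \<Rightarrow> bool" where
  "l2_inverse_of A B \<longleftrightarrow>
     bounded_on_l2 A \<and> bounded_on_l2 B \<and>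
     (\<forall>c\<in>l2. mat_app A (mat_app B c) = c \<and> mat_app B (mat_app A c) = c)"

definition l2_invertible :: "('d::finite) mat \<Rightarrow> bool" where
  "l2_invertible A \<longleftrightarrow> (\<exists>B. l2_inverse_of A B)"

definition l2_inv :: "('d::finite) mat \<Rightarrow> 'd mat" where
  "l2_inv A = (THE B. l2_inverse_of A B)"

definition l2_positive :: "('d::finite) mat \<Rightarrow> bool" where
  "l2_positive A \<longleftrightarrow>
     bounded_on_l2 A \<and> (\<forall>c\<in>l2. (\<Sum>\<^sub>\<infinity>k. mat_app A c k * cnj (c k)) \<in> \<real>\<^sub>\<ge>\<^sub>0)"

definition l2_spectrum :: "('d::finite) mat \<Rightarrow> complex set" where
  "l2_spectrum A = {z. \<not> l2_invertible (\<lambda>k l. A k l - (if k = l then z else 0))}"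

definition inverse_closed :: "('d::finite) mat set \<Rightarrow> bool" where
  "inverse_closed \<A> \<longleftrightarrow> (\<forall>A\<in>\<A>. l2_invertible A \<longrightarrow> l2_inv A \<in> \<A>)"


section \<open>Finite sections\<close>

definition Cn :: "nat \<Rightarrow> (int ^ 'd) set" where
  "Cn n = {k. \<forall>i. - int n \<le> k $ i \<and> k $ i \<le> int n}"

definition Pn :: "nat \<Rightarrow> ('d::finite) sqn \<Rightarrow> 'd sqn" where
  "Pn n y = (\<lambda>k. if k \<in> Cn n then y k else 0)"

definition section_mat :: "('d::finite) mat \<Rightarrow> nat \<Rightarrow> 'd mat" where
  "section_mat A n = (\<lambda>k l. if k \<in> Cn n \<and> l \<in> Cn n then A k l else 0)"

definition lambda_plus :: "('d::finite) mat \<Rightarrow> real" where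
  "lambda_plus A = (GREATEST t. complex_of_real t \<in> l2_spectrum A)"

definition section_tilde :: "('d::finite) mat \<Rightarrow> nat \<Rightarrow> 'd mat" where
  "section_tilde A n =
     (\<lambda>k l. section_mat A n k l + (if k = l \<and> k \<notin> Cn n then complex_of_real (lambda_plus A) else 0))"

definition section_solution :: "('d::finite) mat \<Rightarrow> 'd sqn \<Rightarrow> nat \<Rightarrow> 'd sqn \<Rightarrow> bool" where
  "section_solution A b n y \<longleftrightarrow>
     (\<forall>k. k \<notin> Cn n \<longrightarrow> y k = 0) \<and> mat_app (section_mat A n) y = Pn n b"

definition xn :: "('d::finite) mat \<Rightarrow> 'd sqn \<Rightarrow> nat \<Rightarrow> 'd sqn" where
  "xn A b n = (THE y. section_solution A b n y)"

text \<open>In \<^typ>\<open>ereal\<close>, \<open>inverse \<infinity> = 0\<close> and \<open>inverse 0 = \<infinity>\<close>, so \<open>r = \<infinity>\<close> exactly if \<open>p \<le> q\<close>.\<close>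

definition r_exp :: "ereal \<Rightarrow> ereal \<Rightarrow> ereal" where
  "r_exp p q = inverse (max (inverse q - inverse p) 0)"

definition phi :: "ereal \<Rightarrow> (int ^ 'd \<Rightarrow> real) \<Rightarrow> ereal \<Rightarrow> (int ^ 'd \<Rightarrow> real) \<Rightarrow> nat \<Rightarrow> real" where
  "phi p m q w n =
     (let r = r_exp p q in
      if r = \<infinity> then (SUP k\<in>- Cn n. w k / m k)
      else (\<Sum>\<^sub>\<infinity>k\<in>- Cn n. w k powr real_of_ereal r / m k powr real_of_ereal r)
             powr (1 / real_of_ereal r))"

text \<open>
  \<open>K\<close> is a bound for the inclusion of the algebra into the bounded operators on \<open>lp p m\<close>.
  Without a normalisation of the algebra norm \<open>K = 1\<close> need not be such a bound.
\<close>

definition embedding_bound :: "('d mat \<Rightarrow> ennreal) \<Rightarrow> ereal \<Rightarrow> (int ^ 'd \<Rightarrow> real) \<Rightarrow> real \<Rightarrow> bool" where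
  "embedding_bound N p m K \<longleftrightarrow> (\<forall>B\<in>carrier_alg N. op_norm p m B \<le> K * enn2real (N B))"

definition error_const ::
  "('d mat \<Rightarrow> ennreal) \<Rightarrow> ereal \<Rightarrow> (int ^ 'd \<Rightarrow> real) \<Rightarrow> ereal \<Rightarrow> (int ^ 'd \<Rightarrow> real) \<Rightarrow>
   real \<Rightarrow> 'd mat \<Rightarrow> nat \<Rightarrow> real" where
  "error_const N p m q w K A n =
     op_norm q w (l2_inv A) *
       (1 + K * op_norm p m A * enn2real (N (l2_inv (section_tilde A n))))"

end

theory Submission
  imports Defs
begin

text \<open>
  The error \<open>x - x\<^sub>n\<close> equals \<open>A\<^sup>-\<^sup>1\<close> applied to the residual \<open>b - A x\<^sub>n\<close>, which vanishes on \<open>Cn n\<close>;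
  Hoelder's inequality off \<open>Cn n\<close> passes from the \<open>(p, m)\<close>-norm of the residual to its
  \<open>(q, w)\<close>-norm at the cost of \<open>phi n\<close>.

  Convergence needs the inverses of the finite sections to be uniformly bounded in the algebra. All
  finite sections are translated to pairwise disjoint cubes and become the diagonal blocks of one matrix.
  It lies in the algebra because the norms are translation invariant, it is coercive because \<open>A\<close>
  is, so by inverse-closedness its inverse lies in the algebra, and the blocks of that
  inverse are the inverses of the finite sections.

  The only properties of the norms in use are solidity (monotonicity in the absolute values of the
  entries), countable subadditivity and translation invariance. Solidity also replaces the closed
  graph theorem in the two boundedness statements, for the inclusion of the sequence spaces and for the
  action of the algebra.
\<close>

section \<open>Weighted sequence spaces\<close>

text \<open>The error estimate alone does not give convergence. If \<open>p \<le> q\<close>, then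
  \<open>r_exp p q\<close> is infinite and \<open>phi\<close> is a supremum that need not tend to 0;
  for \<open>w = m\<close> it is constantly 1. If \<open>q < p\<close>, then \<open>phi n\<close> is
  a root of the tail of a convergent series. For \<open>p < \<infinity>\<close> convergence comes
  from stability and truncation of the solution. The case \<open>p = q = \<infinity>\<close> escapes
  both arguments: for the identity matrix the error is the part of \<open>b\<close> off
  \<open>Cn n\<close>, which need not be small in a weighted supremum norm. Inverse-closedness says
  that an inverse lies in the algebra but bounds no norm. Uniform bounds for infinitely many
  inverses must therefore come from a single inverse, hence the one block matrix. Off the cubes it
  carries \<open>lambda_plus A\<close> on the diagonal. The positivity of this number, by definition
  a greatest real spectral point, has to be derived: it is identified with the supremum of the
  quadratic form, by means of a Neumann series. The inverse is taken on \<open>l2\<close> but used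
  on \<open>lp p m\<close>, which need not be comparable with \<open>l2\<close>; identities between
  entries carry it over.\<close>

lemma powr_convex_nonneg:
  fixes P u v x y :: real
  assumes "1 \<le> P" "0 < u" "0 < v" "u + v = 1" "0 \<le> x" "0 \<le> y"
  shows "(u * x + v * y) powr P \<le> u * x powr P + v * y powr P"
proof -
  \<comment> \<open>This settles the case where \<open>x\<close> or \<open>y\<close> is 0; otherwise
    the claim is convexity on the positive reals.\<close>
  have shrink: "(t * z) powr P \<le> t * z powr P" if "0 < t" "t \<le> 1" "0 \<le> z" for t z :: real
  proof -
    have "t powr P \<le> t powr 1"
      using that assms(1) by (intro powr_mono') auto
    then show ?thesis
      using that by (simp add: powr_mult mult_right_mono)
  qed
  show ?thesis
  proof (cases "x = 0 \<or> y = 0")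
    case True
    then show ?thesis using shrink[of u x] shrink[of v y] assms by auto
  next
    case False
    have u: "u = 1 - v" using assms by simp
    show ?thesis
      using False convex_onD[OF powr_convex[OF assms(1)], of v x y] assms(2-) u by simp
  qed
qed

lemma powr_le_cancel_base:
  fixes P x y :: real
  assumes "0 < P" "0 \<le> x" "0 \<le> y" "x powr P \<le> y powr P"
  shows "x \<le> y"
  using assms powr_less_mono2[of P y x] by force

text \<open>Membership and norm bound in one predicate, phrased with finite partial sums so that no
  summability has to be known beforehand. Under the assumptions of \<open>weighted_lp\<close> and
  for \<open>0 \<le> T\<close>, it amounts to \<open>c \<in> lp p m\<close> with norm at most
  \<open>T\<close>, by \<open>lp_leI\<close> and \<open>lp_le_lp_norm\<close>.\<close>

definition lp_le :: "ereal \<Rightarrow> (int ^ 'd \<Rightarrow> real) \<Rightarrow> 'd sqn \<Rightarrow> real \<Rightarrow> bool" where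
  "lp_le p m c T \<longleftrightarrow> 
     (if p = \<infinity> then \<forall>k. cmod (c k) * m k \<le> T
      else \<forall>F. finite F \<longrightarrow> (\<Sum>k\<in>F. (cmod (c k) * m k) powr real_of_ereal p) \<le> T powr real_of_ereal p)"

locale weighted_lp =
  fixes p :: ereal and m :: "int ^ 'd \<Rightarrow> real"
  assumes one_le_p: "1 \<le> p" and m_pos: "\<And>k. 0 < m k"
begin

abbreviation "P \<equiv> real_of_ereal p"

lemma P_ge_1: "p \<noteq> \<infinity> \<Longrightarrow> 1 \<le> P"
  using one_le_p by (cases p) auto

lemma m_nonneg: "0 \<le> m k"
  using m_pos[of k] by simp

lemma lp_leI:
  assumes "lp_le p m c T" "0 \<le> T"
  shows "c \<in> lp p m" and "lp_norm p m c \<le> T"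
proof -
  let ?g = "\<lambda>k. (cmod (c k) * m k) powr P"
  show mem: "c \<in> lp p m"
  proof (cases "p = \<infinity>")
    case True
    then show ?thesis using assms by (auto simp: lp_def lp_le_def intro!: bdd_aboveI2)
  next
    case False
    have "?g summable_on UNIV"
      by (rule nonneg_bdd_above_summable_on)
         (use False assms in \<open>auto simp: lp_le_def intro!: bdd_aboveI2[where M = "T powr P"]\<close>)
    then show ?thesis using False by (simp add: lp_def)
  qed
  show "lp_norm p m c \<le> T"
  proof (cases "p = \<infinity>")
    case True
    then show ?thesis using assms by (auto simp: lp_norm_def lp_le_def intro!: cSUP_least)
  next
    case False
    have "infsum ?g UNIV \<le> T powr P"
      using False mem assms by (intro infsum_le_finite_sums) (auto simp: lp_def lp_le_def)
    then have "infsum ?g UNIV powr (1 / P) \<le> (T powr P) powr (1 / P)"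
      using P_ge_1[OF False] by (intro powr_mono2) (auto intro!: infsum_nonneg)
    then show ?thesis
      using False P_ge_1[OF False] assms(2) by (simp add: lp_norm_def powr_powr)
  qed
qed

lemma lp_norm_nonneg: "c \<in> lp p m \<Longrightarrow> 0 \<le> lp_norm p m c"
proof (cases "p = \<infinity>")
  case True
  assume "c \<in> lp p m"
  then have "cmod (c 0) * m 0 \<le> lp_norm p m c"
    using True by (auto simp: lp_def lp_norm_def intro!: cSUP_upper)
  then show ?thesis
    by (smt (verit) m_nonneg mult_nonneg_nonneg norm_ge_zero)
qed (simp add: lp_norm_def)

lemma lp_norm_powr:
  assumes "p \<noteq> \<infinity>"
  shows "lp_norm p m c powr P = (\<Sum>\<^sub>\<infinity>k. (cmod (c k) * m k) powr P)"
  using assms P_ge_1[OF assms] by (simp add: lp_norm_def powr_powr infsum_nonneg)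

lemma lp_le_lp_norm: "c \<in> lp p m \<Longrightarrow> lp_le p m c (lp_norm p m c)"
proof (cases "p = \<infinity>")
  case True
  assume "c \<in> lp p m"
  then show ?thesis
    using True by (auto simp: lp_def lp_le_def lp_norm_def intro!: cSUP_upper)
next
  case False
  assume c: "c \<in> lp p m"
  have "(\<Sum>k\<in>F. (cmod (c k) * m k) powr P) \<le> (\<Sum>\<^sub>\<infinity>k. (cmod (c k) * m k) powr P)" if "finite F" for F
    using that c False by (intro finite_sum_le_infsum) (auto simp: lp_def)
  then show ?thesis using lp_norm_powr[OF False, of c] False by (simp add: lp_le_def)
qed

lemma lp_le_coord:
  assumes "lp_le p m c T" "0 \<le> T"
  shows "cmod (c k) * m k \<le> T"
proof (cases "p = \<infinity>")
  case True
  then show ?thesis using assms by (simp add: lp_le_def)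
next
  case False
  have "(\<Sum>k\<in>{k}. (cmod (c k) * m k) powr P) \<le> T powr P"
    using assms False unfolding lp_le_def by (metis finite.emptyI finite.insertI)
  then have "(cmod (c k) * m k) powr P \<le> T powr P" by simp
  then show ?thesis
    using P_ge_1[OF False] assms(2) m_nonneg[of k] by (rule_tac powr_le_cancel_base[of P]) auto
qed

lemma lp_coord: "c \<in> lp p m \<Longrightarrow> cmod (c k) * m k \<le> lp_norm p m c"
  using lp_le_coord lp_le_lp_norm lp_norm_nonneg by blast

lemma lp_norm_eq_0D: "c \<in> lp p m \<Longrightarrow> lp_norm p m c = 0 \<Longrightarrow> c = (\<lambda>_. 0)"
  using lp_coord[of c] m_pos by (metis ext mult_le_0_iff norm_le_zero_iff not_less)

lemma lp_le_mono:
  assumes "lp_le p m d T" "\<And>k. cmod (c k) \<le> cmod (d k)"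
  shows "lp_le p m c T"
proof (cases "p = \<infinity>")
  case True
  have "cmod (c k) * m k \<le> T" for k
    using assms True by (meson lp_le_def m_nonneg mult_right_mono order_trans)
  then show ?thesis using True by (simp add: lp_le_def)
next
  case False
  have "(\<Sum>k\<in>F. (cmod (c k) * m k) powr P) \<le> T powr P" if "finite F" for F
  proof -
    have "(\<Sum>k\<in>F. (cmod (c k) * m k) powr P) \<le> (\<Sum>k\<in>F. (cmod (d k) * m k) powr P)"
      using P_ge_1[OF False]
      by (intro sum_mono powr_mono2 mult_right_mono assms m_nonneg) (auto simp: m_nonneg)
    then show ?thesis using assms(1) False that by (force simp: lp_le_def)
  qed
  then show ?thesis using False by (simp add: lp_le_def)
qed

lemma lp_mono:
  assumes "d \<in> lp p m" "\<And>k. cmod (c k) \<le> cmod (d k)"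
  shows "c \<in> lp p m" and "lp_norm p m c \<le> lp_norm p m d"
  using lp_leI[OF lp_le_mono[OF lp_le_lp_norm]] assms lp_norm_nonneg by blast+

text \<open>Minkowski's inequality by normalisation: \<open>(x + y) / (S + T)\<close> is the convex
  combination of \<open>x / S\<close> and \<open>y / T\<close> with weights
  \<open>S / (S + T)\<close> and \<open>T / (S + T)\<close>, so convexity of the power applies term
  by term. A vanishing bound is treated apart because of the divisions.\<close>

lemma lp_le_add:
  assumes "lp_le p m c S" "lp_le p m d T" "0 \<le> S" "0 \<le> T"
  shows "lp_le p m (\<lambda>k. c k + d k) (S + T)"
proof (cases "S = 0 \<or> T = 0")
  case True
  have zero: "e = (\<lambda>_. 0)" if "lp_le p m e 0" for e
    using lp_le_coord[OF that] m_pos by (metis ext mult_le_0_iff norm_le_zero_iff not_less order_refl)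
  show ?thesis using True assms zero[of c] zero[of d] by auto
next
  case False
  then have pos: "0 < S" "0 < T" using assms by auto
  have tri: "cmod (c k + d k) * m k \<le> cmod (c k) * m k + cmod (d k) * m k" for k
    using m_nonneg[of k] by (metis distrib_right mult_right_mono norm_triangle_ineq)
  show ?thesis
  proof (cases "p = \<infinity>")
    case True
    have "cmod (c k + d k) * m k \<le> S + T" for k
      using tri[of k] lp_le_coord[OF assms(1,3), of k] lp_le_coord[OF assms(2,4), of k] by linarith
    then show ?thesis using True by (simp add: lp_le_def)
  next
    case False
    note P = P_ge_1[OF False]
    have "(\<Sum>k\<in>F. (cmod (c k + d k) * m k) powr P) \<le> (S + T) powr P" if F: "finite F" for F
    proof -
      define u v where "u = S / (S + T)" and "v = T / (S + T)"
      have uv: "0 < u" "0 < v" "u + v = 1"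
        using pos by (auto simp: u_def v_def simp flip: add_divide_distrib)
      define x where "x = (\<lambda>k. cmod (c k) * m k)"
      define y where "y = (\<lambda>k. cmod (d k) * m k)"
      have xy: "0 \<le> x k" "0 \<le> y k" for k by (auto simp: x_def y_def m_nonneg)
      have "(cmod (c k + d k) * m k) powr P
            \<le> (S + T) powr P * (u * (x k powr P / S powr P) + v * (y k powr P / T powr P))" for k
      proof -
        have "(cmod (c k + d k) * m k) powr P \<le> (x k + y k) powr P"
          using tri[of k] P by (intro powr_mono2) (auto simp: x_def y_def m_nonneg)
        also have "x k + y k = (S + T) * (u * (x k / S) + v * (y k / T))"
        proof -
          have "(S + T) * u = S" "(S + T) * v = T" using pos by (auto simp: u_def v_def)
          then have "(S + T) * (u * (x k / S) + v * (y k / T)) = S * (x k / S) + T * (y k / T)"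
            by (simp only: distrib_left mult.assoc[symmetric])
          then show ?thesis using pos by simp
        qed
        also have "\<dots> powr P = (S + T) powr P * (u * (x k / S) + v * (y k / T)) powr P"
          by (rule powr_mult)
        also have "\<dots> \<le> (S + T) powr P * (u * (x k / S) powr P + v * (y k / T) powr P)"
          using pos uv xy[of k] P by (intro mult_left_mono powr_convex_nonneg) auto
        finally show ?thesis using pos xy[of k] by (simp add: powr_divide)
      qed
      then have "(\<Sum>k\<in>F. (cmod (c k + d k) * m k) powr P)
            \<le> (\<Sum>k\<in>F. (S + T) powr P * (u * (x k powr P / S powr P) + v * (y k powr P / T powr P)))"
        by (rule sum_mono)
      also have "\<dots> = (S + T) powr P * (u * ((\<Sum>k\<in>F. x k powr P) / S powr P) + v * ((\<Sum>k\<in>F. y k powr P) / T powr P))"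
        by (simp add: sum_distrib_left sum.distrib sum_divide_distrib distrib_left)
      also have "\<dots> \<le> (S + T) powr P * (u * 1 + v * 1)"
      proof -
        have "(\<Sum>k\<in>F. x k powr P) \<le> S powr P" "(\<Sum>k\<in>F. y k powr P) \<le> T powr P"
          using assms(1,2) False F by (auto simp: lp_le_def x_def y_def)
        then show ?thesis using pos uv by (intro mult_left_mono add_mono) auto
      qed
      finally show ?thesis using uv by simp
    qed
    then show ?thesis using False by (simp add: lp_le_def)
  qed
qed

lemma lp_add:
  assumes "c \<in> lp p m" "d \<in> lp p m"
  shows "(\<lambda>k. c k + d k) \<in> lp p m"
    and "lp_norm p m (\<lambda>k. c k + d k) \<le> lp_norm p m c + lp_norm p m d"
  using lp_leI[OF lp_le_add[OF lp_le_lp_norm lp_le_lp_norm]] assms lp_norm_nonneg by fastforce+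

lemma lp_scale:
  assumes "c \<in> lp p m"
  shows "(\<lambda>k. a * c k) \<in> lp p m" and "lp_norm p m (\<lambda>k. a * c k) = cmod a * lp_norm p m c"
proof -
  have le: "(\<lambda>k. a * c k) \<in> lp p m \<and> lp_norm p m (\<lambda>k. a * c k) \<le> cmod a * lp_norm p m c"
    if "c \<in> lp p m" for a c
  proof -
    have T: "0 \<le> lp_norm p m c" using that by (rule lp_norm_nonneg)
    have "lp_le p m (\<lambda>k. a * c k) (cmod a * lp_norm p m c)"
    proof (cases "p = \<infinity>")
      case True
      then show ?thesis
        using lp_coord[OF that] by (simp add: lp_le_def norm_mult mult.assoc mult_left_mono)
    next
      case False
      have "(\<Sum>k\<in>F. (cmod (a * c k) * m k) powr P) \<le> (cmod a * lp_norm p m c) powr P" if "finite F" for F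
      proof -
        have "(\<Sum>k\<in>F. (cmod (a * c k) * m k) powr P) = cmod a powr P * (\<Sum>k\<in>F. (cmod (c k) * m k) powr P)"
          using m_nonneg by (simp add: norm_mult mult.assoc powr_mult sum_distrib_left)
        also have "\<dots> \<le> cmod a powr P * lp_norm p m c powr P"
          using lp_le_lp_norm[OF \<open>c \<in> lp p m\<close>] that False by (intro mult_left_mono) (auto simp: lp_le_def)
        finally show ?thesis using T by (simp add: powr_mult)
      qed
      then show ?thesis using False by (simp add: lp_le_def)
    qed
    then show ?thesis using T lp_leI by simp
  qed
  show mem: "(\<lambda>k. a * c k) \<in> lp p m" using le assms by blast
  show "lp_norm p m (\<lambda>k. a * c k) = cmod a * lp_norm p m c"
  proof (cases "a = 0")
    case True
    then show ?thesis using le[OF assms, of a] lp_norm_nonneg[OF mem] by simp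
  next
    case False
    \<comment> \<open>The reverse inequality is \<open>le\<close> for the factor
      \<open>1 / a\<close>.\<close>
    have "lp_norm p m c \<le> cmod (1 / a) * lp_norm p m (\<lambda>k. a * c k)"
      using le[OF mem, of "1/a"] False by simp
    then have "cmod a * lp_norm p m c \<le> lp_norm p m (\<lambda>k. a * c k)"
      using False by (simp add: norm_divide field_simps)
    then show ?thesis using le[OF assms, of a] by linarith
  qed
qed

lemma lp_uminus:
  assumes "c \<in> lp p m"
  shows "(\<lambda>k. - c k) \<in> lp p m" and "lp_norm p m (\<lambda>k. - c k) = lp_norm p m c"
  using lp_scale[OF assms, of "-1"] by simp_all

lemma lp_diff:
  assumes "c \<in> lp p m" "d \<in> lp p m"
  shows "(\<lambda>k. c k - d k) \<in> lp p m"
    and "lp_norm p m (\<lambda>k. c k - d k) \<le> lp_norm p m c + lp_norm p m d"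
  using lp_add[OF assms(1) lp_uminus(1)[OF assms(2)]] lp_uminus(2)[OF assms(2)] by simp_all

lemma lp_finite_support:
  assumes "finite F" "\<And>k. k \<notin> F \<Longrightarrow> c k = 0"
  shows "c \<in> lp p m"
proof (cases "p = \<infinity>")
  case True
  have "range (\<lambda>k. cmod (c k) * m k) \<subseteq> insert 0 ((\<lambda>k. cmod (c k) * m k) ` F)"
    using assms(2) by force
  then have "finite (range (\<lambda>k. cmod (c k) * m k))"
    using assms(1) finite_subset by blast
  then show ?thesis using True by (simp add: lp_def bdd_above_finite)
next
  case False
  have "(\<lambda>k. (cmod (c k) * m k) powr P) summable_on UNIV"
    using assms by (intro finite_nonzero_values_imp_summable_on) (auto elim!: finite_subset[rotated])
  then show ?thesis using False by (simp add: lp_def)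
qed

lemma lp_zero: "(\<lambda>_. 0) \<in> lp p m" and lp_norm_zero: "lp_norm p m (\<lambda>_. 0) = 0"
proof -
  show "(\<lambda>_. 0) \<in> lp p m" by (rule lp_finite_support[of "{}"]) auto
  then show "lp_norm p m (\<lambda>_. 0) = 0" using lp_scale(2)[of "\<lambda>_. 0" 0] by simp
qed

lemma lp_sum:
  assumes "\<And>i. i \<in> I \<Longrightarrow> c i \<in> lp p m"
  shows "(\<lambda>k. \<Sum>i\<in>I. c i k) \<in> lp p m"
    and "lp_norm p m (\<lambda>k. \<Sum>i\<in>I. c i k) \<le> (\<Sum>i\<in>I. lp_norm p m (c i))"
proof -
  have "(\<lambda>k. \<Sum>i\<in>I. c i k) \<in> lp p m \<and>
        lp_norm p m (\<lambda>k. \<Sum>i\<in>I. c i k) \<le> (\<Sum>i\<in>I. lp_norm p m (c i))"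
    using assms
  proof (induction I rule: infinite_finite_induct)
    case (insert i I)
    then show ?case using lp_add[of "c i" "\<lambda>k. \<Sum>i\<in>I. c i k"] by force
  qed (auto simp: lp_zero lp_norm_zero)
  then show "(\<lambda>k. \<Sum>i\<in>I. c i k) \<in> lp p m"
    and "lp_norm p m (\<lambda>k. \<Sum>i\<in>I. c i k) \<le> (\<Sum>i\<in>I. lp_norm p m (c i))" by blast+
qed

text \<open>The predicate \<open>lp_le\<close> tests finitely many coordinates at a time, so a
  uniform bound passes to pointwise limits.\<close>

lemma lp_Fatou:
  assumes "\<And>k. (\<lambda>n. g n k) \<longlonglongrightarrow> h k" "\<And>n. g n \<in> lp p m" "\<And>n. lp_norm p m (g n) \<le> T"
  shows "h \<in> lp p m" and "lp_norm p m h \<le> T"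
proof -
  have T: "0 \<le> T" using lp_norm_nonneg[OF assms(2)] assms(3) order_trans by blast
  have "lp_le p m h T"
  proof (cases "p = \<infinity>")
    case True
    have "cmod (h k) * m k \<le> T" for k
    proof (rule LIMSEQ_le_const2)
      show "(\<lambda>n. cmod (g n k) * m k) \<longlonglongrightarrow> cmod (h k) * m k"
        by (intro tendsto_intros assms)
      show "\<exists>N. \<forall>n\<ge>N. cmod (g n k) * m k \<le> T"
        using lp_coord[OF assms(2)] assms(3) order_trans by blast
    qed
    then show ?thesis using True by (simp add: lp_le_def)
  next
    case False
    note P = P_ge_1[OF False]
    have "(\<Sum>k\<in>F. (cmod (h k) * m k) powr P) \<le> T powr P" if "finite F" for F
    proof (rule LIMSEQ_le_const2)
      show "(\<lambda>n. \<Sum>k\<in>F. (cmod (g n k) * m k) powr P) \<longlonglongrightarrow> (\<Sum>k\<in>F. (cmod (h k) * m k) powr P)"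
        using P by (intro tendsto_sum tendsto_powr' tendsto_intros assms) (auto simp: m_nonneg)
      have "(\<Sum>k\<in>F. (cmod (g n k) * m k) powr P) \<le> T powr P" for n
      proof -
        have "(\<Sum>k\<in>F. (cmod (g n k) * m k) powr P) \<le> lp_norm p m (g n) powr P"
          using lp_le_lp_norm[OF assms(2)] that False by (auto simp: lp_le_def)
        also have "\<dots> \<le> T powr P"
          using P assms lp_norm_nonneg by (intro powr_mono2) auto
        finally show ?thesis .
      qed
      then show "\<exists>N. \<forall>n\<ge>N. (\<Sum>k\<in>F. (cmod (g n k) * m k) powr P) \<le> T powr P" by blast
    qed
    then show ?thesis using False by (simp add: lp_le_def)
  qed
  then show "h \<in> lp p m" and "lp_norm p m h \<le> T" using lp_leI T by blast+
qed

text \<open>Completeness in the form that \<open>inclusion_bounded\<close> and the Neumann series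
  need: the partial sums converge pointwise, and \<open>lp_Fatou\<close> bounds their limit.\<close>

lemma lp_suminf:
  assumes mem: "\<And>j. c j \<in> lp p m" and sm: "summable (\<lambda>j. lp_norm p m (c j))"
  shows "\<And>k. summable (\<lambda>j. cmod (c j k))"
    and "(\<lambda>k. \<Sum>j. c j k) \<in> lp p m"
    and "lp_norm p m (\<lambda>k. \<Sum>j. c j k) \<le> (\<Sum>j. lp_norm p m (c j))"
proof -
  show sk: "summable (\<lambda>j. cmod (c j k))" for k
  proof (rule summable_comparison_test')
    show "summable (\<lambda>j. lp_norm p m (c j) / m k)" using sm by (rule summable_divide)
    show "norm (cmod (c j k)) \<le> lp_norm p m (c j) / m k" for j
      using lp_coord[OF mem, of j k] m_pos[of k] by (simp add: field_simps)
  qed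
  have lim: "(\<lambda>n. \<Sum>j<n. c j k) \<longlonglongrightarrow> (\<Sum>j. c j k)" for k
    by (rule summable_LIMSEQ[OF summable_norm_cancel[OF sk]])
  have bd: "lp_norm p m (\<lambda>k. \<Sum>j<n. c j k) \<le> (\<Sum>j. lp_norm p m (c j))" for n
    using lp_sum(2)[of "{..<n}" c] mem sum_le_suminf[OF sm, of "{..<n}"] lp_norm_nonneg[OF mem]
    by force
  show "(\<lambda>k. \<Sum>j. c j k) \<in> lp p m"
    and "lp_norm p m (\<lambda>k. \<Sum>j. c j k) \<le> (\<Sum>j. lp_norm p m (c j))"
    by (rule lp_Fatou[OF lim lp_sum(1) bd]; rule mem)+
qed

text \<open>The supremum in \<open>op_norm\<close> is totalised, so it has to be shown bounded
  before it carries information; rescaling to norm 1 then extends the bound to every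
  \<open>c\<close>.\<close>

lemma op_norm_bound:
  assumes "bounded_on_lp p m A"
  shows "bdd_above ((\<lambda>c. lp_norm p m (mat_app A c)) ` {c \<in> lp p m. lp_norm p m c \<le> 1})"
    and "0 \<le> op_norm p m A"
    and "\<And>c. c \<in> lp p m \<Longrightarrow> mat_app A c \<in> lp p m"
    and "\<And>c. c \<in> lp p m \<Longrightarrow> lp_norm p m (mat_app A c) \<le> op_norm p m A * lp_norm p m c"
proof -
  obtain K where K: "\<And>c. c \<in> lp p m \<Longrightarrow> mat_app A c \<in> lp p m \<and> lp_norm p m (mat_app A c) \<le> K * lp_norm p m c"
    using assms unfolding bounded_on_lp_def by blast
  show mem: "\<And>c. c \<in> lp p m \<Longrightarrow> mat_app A c \<in> lp p m" using K by blast
  show bdd: "bdd_above ((\<lambda>c. lp_norm p m (mat_app A c)) ` {c \<in> lp p m. lp_norm p m c \<le> 1})"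
  proof (rule bdd_aboveI2[where M = "\<bar>K\<bar>"])
    fix c assume c: "c \<in> {c \<in> lp p m. lp_norm p m c \<le> 1}"
    then have "lp_norm p m (mat_app A c) \<le> K * lp_norm p m c" using K by blast
    also have "\<dots> \<le> \<bar>K\<bar> * lp_norm p m c" using c lp_norm_nonneg by (intro mult_right_mono) auto
    also have "\<dots> \<le> \<bar>K\<bar> * 1" using c by (intro mult_left_mono) auto
    finally show "lp_norm p m (mat_app A c) \<le> \<bar>K\<bar>" by simp
  qed
  have up: "lp_norm p m (mat_app A c) \<le> op_norm p m A" if "c \<in> lp p m" "lp_norm p m c \<le> 1" for c
    unfolding op_norm_def using that by (intro cSUP_upper bdd) auto
  have "lp_norm p m (mat_app A (\<lambda>_. 0)) = 0" by (simp add: mat_app_def lp_norm_zero)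
  then show nn: "0 \<le> op_norm p m A" using up[OF lp_zero] lp_norm_zero by simp
  fix c assume c: "c \<in> lp p m"
  show "lp_norm p m (mat_app A c) \<le> op_norm p m A * lp_norm p m c"
  proof (cases "lp_norm p m c = 0")
    case True
    then show ?thesis using lp_norm_eq_0D[OF c] by (simp add: mat_app_def lp_norm_zero)
  next
    case False
    then have pos: "0 < lp_norm p m c" using lp_norm_nonneg[OF c] by simp
    define a where "a = complex_of_real (1 / lp_norm p m c)"
    have "mat_app A (\<lambda>k. a * c k) = (\<lambda>k. a * mat_app A c k)"
      by (simp add: mat_app_def mult.left_commute infsum_cmult_right')
    then have "cmod a * lp_norm p m (mat_app A c) \<le> op_norm p m A"
      using up[of "\<lambda>k. a * c k"] lp_scale[OF c, of a] lp_scale(2)[OF mem[OF c], of a] pos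
      by (simp add: a_def norm_divide)
    then show ?thesis using pos by (simp add: a_def norm_divide field_simps)
  qed
qed

lemma op_norm_le:
  assumes "\<And>c. c \<in> lp p m \<Longrightarrow> lp_norm p m (mat_app A c) \<le> K * lp_norm p m c" "0 \<le> K"
  shows "op_norm p m A \<le> K"
  unfolding op_norm_def
proof (rule cSUP_least)
  show "{c \<in> lp p m. lp_norm p m c \<le> 1} \<noteq> {}" using lp_zero lp_norm_zero by auto
  fix c assume "c \<in> {c \<in> lp p m. lp_norm p m c \<le> 1}"
  then show "lp_norm p m (mat_app A c) \<le> K"
    using assms mult_left_mono[of "lp_norm p m c" 1 K] by fastforce
qed

text \<open>Used twice: for the truncations of the solution and, with the constant sequence 1 and
  the weight \<open>w / m\<close>, for \<open>phi\<close>.\<close>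

lemma lp_tail_tendsto_0:
  assumes "c \<in> lp p m" "p \<noteq> \<infinity>" "\<And>F. finite F \<Longrightarrow> \<forall>\<^sub>F n in sequentially. F \<subseteq> S n"
  shows "(\<lambda>n. lp_norm p m (\<lambda>k. if k \<in> S n then 0 else c k)) \<longlonglongrightarrow> 0"
proof (rule LIMSEQ_I)
  fix e :: real assume e: "0 < e"
  note P = P_ge_1[OF assms(2)]
  \<comment> \<open>Half of \<open>e\<close>, because the bound supplied by \<open>lp_leI\<close> is
    not strict.\<close>
  define e' where "e' = e / 2"
  have e': "0 < e'" "e' < e" using e by (auto simp: e'_def)
  let ?g = "\<lambda>k. (cmod (c k) * m k) powr P"
  have sm: "?g summable_on UNIV" using assms by (simp add: lp_def)
  obtain F where F: "finite F" "dist (sum ?g F) (infsum ?g UNIV) \<le> e' powr P"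
    using infsum_finite_approximation[OF sm, of "e' powr P"] e' by auto
  obtain n0 where n0: "\<And>n. n \<ge> n0 \<Longrightarrow> F \<subseteq> S n"
    using assms(3)[OF F(1)] by (auto simp: eventually_sequentially)
  have "norm (lp_norm p m (\<lambda>k. if k \<in> S n then 0 else c k) - 0) < e" if "n \<ge> n0" for n
  proof -
    let ?t = "\<lambda>k. if k \<in> S n then 0 else c k"
    have "lp_le p m ?t e'"
    proof -
      have "(\<Sum>k\<in>G. (cmod (?t k) * m k) powr P) \<le> e' powr P" if G: "finite G" for G
      proof -
        have "(\<Sum>k\<in>G. (cmod (?t k) * m k) powr P) = (\<Sum>k\<in>G - F. (cmod (?t k) * m k) powr P)"
          using n0[OF \<open>n \<ge> n0\<close>] G by (intro sum.mono_neutral_right) auto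
        also have "\<dots> \<le> sum ?g (G - F)"
          by (rule sum_mono) auto
        also have "\<dots> = sum ?g (F \<union> G) - sum ?g F"
          using F G by (simp add: sum_diff[symmetric] Un_Diff)
        also have "\<dots> \<le> infsum ?g UNIV - sum ?g F"
          using finite_sum_le_infsum[OF sm, of "F \<union> G"] F G by simp
        also have "\<dots> \<le> e' powr P" using F(2) by (simp add: dist_real_def)
        finally show ?thesis .
      qed
      then show ?thesis using assms(2) by (simp add: lp_le_def)
    qed
    then show ?thesis using lp_leI[of ?t e'] lp_norm_nonneg[of ?t] e' by simp
  qed
  then show "\<exists>no. \<forall>n\<ge>no. norm (lp_norm p m (\<lambda>k. if k \<in> S n then 0 else c k) - 0) < e" by blast
qed

end

section \<open>Hoelder's inequality for the exponent \<open>r_exp p q\<close>\<close>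

lemma r_exp_eq_infinity: "1 \<le> p \<Longrightarrow> 1 \<le> q \<Longrightarrow> p \<le> q \<Longrightarrow> r_exp p q = \<infinity>"
  by (cases p; cases q) (auto simp: r_exp_def max_def zero_ereal_def one_ereal_def field_simps)

text \<open>The last equation covers \<open>p = \<infinity>\<close> as well:
  \<open>real_of_ereal \<infinity>\<close> is 0 and division by 0 yields 0, which is the intended
  value of \<open>1 / p\<close>.\<close>

lemma r_exp_finite:
  assumes "1 \<le> p" "1 \<le> q" "q < p"
  obtains r where "r_exp p q = ereal r" "1 \<le> r"
    "1 / r = 1 / real_of_ereal q - 1 / real_of_ereal p"
proof -
  obtain Q where q: "q = ereal Q" "1 \<le> Q" using assms by (cases q) auto
  show ?thesis
  proof (cases p)
    case (real P)
    then have P: "Q < P" using assms q by auto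
    define r where "r = 1 / (1 / Q - 1 / P)"
    have "1 / P < 1 / Q" "1 / Q \<le> 1" "0 < 1 / P"
      using P q by (auto simp: frac_less2)
    then have pos: "0 < 1 / Q - 1 / P" and "1 / Q - 1 / P \<le> 1" by linarith+
    then have "1 \<le> r" by (simp add: r_def)
    moreover have "r_exp p q = ereal r"
      using real q P pos by (simp add: r_exp_def max_def zero_ereal_def r_def inverse_eq_divide)
    ultimately show ?thesis using that[of r] real q by (simp add: r_def)
  next
    case PInf
    then show ?thesis using that[of Q] q by (simp add: r_exp_def max_def zero_ereal_def)
  qed (use assms in auto)
qed

lemma r_exp_ge_1: "1 \<le> p \<Longrightarrow> 1 \<le> q \<Longrightarrow> 1 \<le> r_exp p q"
  by (metis ereal_less_eq(1) ereal_less_eq(3) not_le one_ereal_def r_exp_eq_infinity r_exp_finite)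

text \<open>Summed over a sequence with values in \<open>[0, T]\<close>, this compares the sum of
  \<open>Q\<close>-th powers with the sum of \<open>P\<close>-th powers, as in the inclusion of
  unweighted spaces for increasing exponents.\<close>

lemma mult_powr_le_of_le:
  fixes x T :: real
  assumes "0 \<le> x" "x \<le> T" "0 < P" "P \<le> Q"
  shows "x powr Q \<le> x powr P * T powr (Q - P)"
proof -
  have "x powr Q = x powr P * x powr (Q - P)" by (simp flip: powr_add)
  also have "\<dots> \<le> x powr P * T powr (Q - P)"
    using assms by (intro mult_left_mono powr_mono2) auto
  finally show ?thesis .
qed

text \<open>With \<open>x = cmod d * (w / m)\<close> and \<open>y = cmod c * m\<close> the weights
  cancel. For \<open>p \<le> q\<close> the exponent \<open>r\<close> is infinite, and the supremum
  of \<open>x\<close> is combined with the comparison of exponents for \<open>y\<close>. For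
  \<open>p = \<infinity>\<close> one has \<open>r = q\<close> and takes the supremum of
  \<open>y\<close>. Otherwise \<open>1 / q = 1 / r + 1 / p\<close> with finite exponents, and
  Young's inequality is summed.\<close>

lemma Holder_lp:
  assumes "weighted_lp p m" "weighted_lp q w"
    and d: "d \<in> lp (r_exp p q) (\<lambda>k. w k / m k)" and c: "c \<in> lp p m"
  shows "(\<lambda>k. d k * c k) \<in> lp q w"
    and "lp_norm q w (\<lambda>k. d k * c k) \<le> lp_norm (r_exp p q) (\<lambda>k. w k / m k) d * lp_norm p m c"
proof -
  interpret X: weighted_lp p m by fact
  interpret Y: weighted_lp q w by fact
  interpret R: weighted_lp "r_exp p q" "\<lambda>k. w k / m k"
    by standard (simp_all add: r_exp_ge_1 X.one_le_p Y.one_le_p X.m_pos Y.m_pos)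
  define D where "D = lp_norm (r_exp p q) (\<lambda>k. w k / m k) d"
  define C where "C = lp_norm p m c"
  have D0: "0 \<le> D" and C0: "0 \<le> C"
    using R.lp_norm_nonneg[OF d] X.lp_norm_nonneg[OF c] by (simp_all add: D_def C_def)
  define x where "x = (\<lambda>k. cmod (d k) * (w k / m k))"
  define y where "y = (\<lambda>k. cmod (c k) * m k)"
  have xy0: "0 \<le> x k" "0 \<le> y k" for k using X.m_nonneg Y.m_nonneg by (auto simp: x_def y_def)
  have xD: "x k \<le> D" and yC: "y k \<le> C" for k
    using R.lp_coord[OF d] X.lp_coord[OF c] by (auto simp: x_def y_def D_def C_def)
  have prod: "cmod (d k * c k) * w k = x k * y k" for k
    using X.m_pos[of k] by (simp add: x_def y_def norm_mult)
  have sumy: "(\<Sum>k\<in>F. y k powr X.P) \<le> C powr X.P" if "p \<noteq> \<infinity>" "finite F" for F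
    using X.lp_le_lp_norm[OF c] that by (auto simp: lp_le_def y_def C_def)
  have sumx: "(\<Sum>k\<in>F. x k powr R.P) \<le> D powr R.P" if "r_exp p q \<noteq> \<infinity>" "finite F" for F
    using R.lp_le_lp_norm[OF d] that by (auto simp: lp_le_def x_def D_def)
  have "lp_le q w (\<lambda>k. d k * c k) (D * C)"
  proof (cases "q = \<infinity>")
    case True
    then show ?thesis
      using xD yC xy0 D0 by (auto simp: lp_le_def prod intro!: mult_mono)
  next
    case q: False
    have "(\<Sum>k\<in>F. (x k * y k) powr Y.P) \<le> (D * C) powr Y.P" if F: "finite F" for F
    proof -
      consider "p \<le> q" | "p = \<infinity>" | "q < p" "p \<noteq> \<infinity>" by fastforce
      then show ?thesis
      proof cases
        case 1
        then have p: "p \<noteq> \<infinity>" and PQ: "X.P \<le> Y.P"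
          using q X.one_le_p Y.one_le_p by (cases p; cases q; auto)+
        have "(x k * y k) powr Y.P \<le> D powr Y.P * (y k powr X.P * C powr (Y.P - X.P))" for k
        proof -
          have "(x k * y k) powr Y.P \<le> (D * y k) powr Y.P"
            using xy0 xD Y.P_ge_1[OF q] by (intro powr_mono2 mult_right_mono) auto
          also have "\<dots> = D powr Y.P * y k powr Y.P" by (rule powr_mult)
          also have "\<dots> \<le> D powr Y.P * (y k powr X.P * C powr (Y.P - X.P))"
            using X.P_ge_1[OF p] PQ xy0 yC by (intro mult_left_mono mult_powr_le_of_le) auto
          finally show ?thesis .
        qed
        then have "(\<Sum>k\<in>F. (x k * y k) powr Y.P) \<le> (\<Sum>k\<in>F. D powr Y.P * (y k powr X.P * C powr (Y.P - X.P)))"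
          by (rule sum_mono)
        also have "\<dots> = D powr Y.P * ((\<Sum>k\<in>F. y k powr X.P) * C powr (Y.P - X.P))"
          by (simp add: sum_distrib_left sum_distrib_right)
        also have "\<dots> \<le> D powr Y.P * (C powr X.P * C powr (Y.P - X.P))"
          by (intro mult_left_mono mult_right_mono sumy[OF p F]) auto
        finally show ?thesis by (simp add: powr_mult flip: powr_add)
      next
        case 2
        then have "q < p" using q by (cases q) auto
        then obtain r where r: "r_exp p q = ereal r" "1 \<le> r" "1 / r = 1 / Y.P - 1 / X.P"
          using r_exp_finite X.one_le_p Y.one_le_p by metis
        have "R.P = Y.P" using r 2 Y.P_ge_1[OF q] by (simp add: field_simps)
        then have "(\<Sum>k\<in>F. x k powr Y.P) \<le> D powr Y.P" using sumx[OF _ F] r by simp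
        have "(\<Sum>k\<in>F. (x k * y k) powr Y.P) \<le> (\<Sum>k\<in>F. x k powr Y.P * C powr Y.P)"
          using xy0 yC C0 Y.P_ge_1[OF q]
          by (intro sum_mono) (simp add: powr_mult mult_left_mono powr_mono2)
        also have "\<dots> = (\<Sum>k\<in>F. x k powr Y.P) * C powr Y.P" by (simp add: sum_distrib_right)
        also have "\<dots> \<le> D powr Y.P * C powr Y.P"
          by (intro mult_right_mono) (fact, simp)
        finally show ?thesis by (simp add: powr_mult)
      next
        case 3
        obtain r where r: "r_exp p q = ereal r" "1 \<le> r" "1 / r = 1 / Y.P - 1 / X.P"
          using r_exp_finite X.one_le_p Y.one_le_p 3 by metis
        have P: "1 \<le> X.P" and Q: "1 \<le> Y.P" using X.P_ge_1 Y.P_ge_1 q 3 by auto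
        have QP: "Y.P < X.P"
          using 3 q X.one_le_p Y.one_le_p by (cases p; cases q) auto
        have Qr: "Y.P < r"
        proof -
          have "1 / r < 1 / Y.P" using r P by simp
          then show ?thesis using r(2) Q by (simp add: field_simps)
        qed
        show ?thesis
        proof (cases "D = 0 \<or> C = 0")
          case True
          then have "x k * y k = 0" for k using xD[of k] yC[of k] xy0[of k] by auto
          then have "(\<Sum>k\<in>F. (x k * y k) powr Y.P) = 0" by (intro sum.neutral) auto
          then show ?thesis by simp
        next
          case False
          then have D: "0 < D" and C: "0 < C" using D0 C0 by auto
          \<comment> \<open>Young's inequality for the \<open>Y.P\<close>-th powers of the
            normalised values \<open>x k / D\<close> and \<open>y k / C\<close>. The exponents
            \<open>r / Y.P\<close> and \<open>X.P / Y.P\<close> are conjugate by the equation for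
            \<open>1 / r\<close>.\<close>
          have young: "(x k * y k) powr Y.P
              \<le> (D * C) powr Y.P * (Y.P / r * (x k powr r / D powr r) + Y.P / X.P * (y k powr X.P / C powr X.P))" for k
          proof -
            have e: "Y.P * (r / Y.P) = r" "Y.P * (X.P / Y.P) = X.P" using Q by auto
            have "(x k / D) powr Y.P * (y k / C) powr Y.P
                \<le> ((x k / D) powr Y.P) powr (r / Y.P) / (r / Y.P) + ((y k / C) powr Y.P) powr (X.P / Y.P) / (X.P / Y.P)"
              using QP Qr Q P r by (intro Youngs_inequality) (auto simp: field_simps)
            also have "\<dots> = (x k / D) powr r / (r / Y.P) + (y k / C) powr X.P / (X.P / Y.P)"
              unfolding powr_powr e ..
            also have "\<dots> = Y.P / r * (x k powr r / D powr r) + Y.P / X.P * (y k powr X.P / C powr X.P)"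
              using xy0[of k] C D by (simp add: powr_divide mult.commute)
            finally have *: "(x k / D) powr Y.P * (y k / C) powr Y.P \<le> \<dots>" .
            have "(x k * y k) powr Y.P = (D * C) powr Y.P * ((x k / D) powr Y.P * (y k / C) powr Y.P)"
              using xy0[of k] C D by (simp add: powr_mult powr_divide)
            with * show ?thesis by (simp add: mult_left_mono)
          qed
          have "(\<Sum>k\<in>F. (x k * y k) powr Y.P)
              \<le> (\<Sum>k\<in>F. (D * C) powr Y.P * (Y.P / r * (x k powr r / D powr r) + Y.P / X.P * (y k powr X.P / C powr X.P)))"
            by (rule sum_mono) (rule young)
          also have "\<dots> = (D * C) powr Y.P *
              (Y.P / r * ((\<Sum>k\<in>F. x k powr r) / D powr r) + Y.P / X.P * ((\<Sum>k\<in>F. y k powr X.P) / C powr X.P))"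
            by (simp only: sum_distrib_left[symmetric] sum.distrib sum_divide_distrib[symmetric])
          also have "\<dots> \<le> (D * C) powr Y.P * (Y.P / r * 1 + Y.P / X.P * 1)"
            using sumx[OF _ F] sumy[OF _ F] r 3 D C Q P
            by (intro mult_left_mono add_mono) auto
          also have "Y.P / r * 1 + Y.P / X.P * 1 = 1"
          proof -
            have "Y.P / r = Y.P * (1 / Y.P - 1 / X.P)"
              unfolding r(3)[symmetric] by simp
            then show ?thesis using Q by (simp add: right_diff_distrib)
          qed
          finally show ?thesis by simp
        qed
      qed
    qed
    then show ?thesis using q by (simp add: lp_le_def prod)
  qed
  then show "(\<lambda>k. d k * c k) \<in> lp q w" and "lp_norm q w (\<lambda>k. d k * c k) \<le> D * C"
    using Y.lp_leI D0 C0 by (metis mult_nonneg_nonneg)+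
qed

section \<open>Boundedness of the inclusion and a converse of Hoelder's inequality\<close>

locale lp_inclusion = X: weighted_lp p m + Y: weighted_lp q w
  for p :: ereal and m :: "int ^ 'd \<Rightarrow> real" and q w +
  assumes inclusion: "lp p m \<subseteq> lp q w"
begin

text \<open>Absolute values turn the closed graph argument into a comparison: the sum of a series of
  nonnegative sequences dominates each of its terms.\<close>

lemma inclusion_bounded:
  obtains K where "\<And>c. c \<in> lp p m \<Longrightarrow> lp_norm q w c \<le> K * lp_norm p m c"
proof (rule ccontr)
  assume "\<not> thesis"
  then have "\<exists>c\<in>lp p m. 4 ^ j * lp_norm p m c < lp_norm q w c" for j :: nat
    using that[of "4 ^ j"] by force
  then obtain c where c: "\<And>j. c j \<in> lp p m" "\<And>j :: nat. 4 ^ j * lp_norm p m (c j) < lp_norm q w (c j)"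
    by metis
  have pos: "0 < lp_norm p m (c j)" for j
    using X.lp_norm_nonneg[OF c(1)[of j]] X.lp_norm_eq_0D[OF c(1)[of j]] c(2)[of j] Y.lp_norm_zero
    by (cases "lp_norm p m (c j) = 0") auto
  \<comment> \<open>The factor \<open>4 ^ j\<close> is split evenly: the scaled terms have
    \<open>(p, m)\<close>-norm at most \<open>(1/2) ^ j\<close>, so their series converges, while
    their \<open>(q, w)\<close>-norms still exceed \<open>2 ^ j\<close>.\<close>
  define t where "t = (\<lambda>j. 1 / (2 ^ j * lp_norm p m (c j)))"
  have t0: "0 \<le> t j" for j using pos[of j] by (simp add: t_def)
  define d where "d = (\<lambda>j k. complex_of_real (t j) * complex_of_real (cmod (c j k)))"
  have absc: "(\<lambda>k. complex_of_real (cmod (c j k))) \<in> lp p m" for j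
    by (rule X.lp_mono(1)[OF c(1)[of j]]) simp
  have dX: "d j \<in> lp p m" for j
    unfolding d_def by (rule X.lp_scale[OF absc])
  have "lp_norm p m (d j) \<le> (1/2) ^ j" for j
  proof -
    have "lp_norm p m (d j) = t j * lp_norm p m (\<lambda>k. complex_of_real (cmod (c j k)))"
      unfolding d_def by (subst X.lp_scale(2)[OF absc]) (simp add: t0)
    also have "\<dots> \<le> t j * lp_norm p m (c j)"
      by (intro mult_left_mono X.lp_mono(2)[OF c(1)] t0) simp
    finally show ?thesis using pos[of j] by (simp add: t_def power_divide)
  qed
  then have sm: "summable (\<lambda>j. lp_norm p m (d j))"
    using X.lp_norm_nonneg[OF dX]
    by (intro summable_comparison_test'[OF summable_geometric[of "1/2::real"]]) auto
  define s where "s = (\<lambda>k. \<Sum>j. d j k)"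
  have "s \<in> lp q w" using X.lp_suminf(2)[OF dX sm] inclusion by (auto simp: s_def)
  have dom: "cmod (t j * c j k) \<le> cmod (s k)" for j k
  proof -
    have smk: "summable (\<lambda>j. t j * cmod (c j k))"
      using X.lp_suminf(1)[OF dX sm, of k] t0 by (simp add: d_def norm_mult)
    have "t j * cmod (c j k) \<le> (\<Sum>j. t j * cmod (c j k))"
      using sum_le_suminf[OF smk, of "{j}"] t0 by simp
    also have "s k = complex_of_real (\<Sum>j. t j * cmod (c j k))"
      using smk by (simp add: s_def d_def flip: suminf_of_real of_real_mult)
    then have "(\<Sum>j. t j * cmod (c j k)) \<le> cmod (s k)" by simp
    finally show ?thesis using t0 by (simp add: norm_mult)
  qed
  have "2 ^ j < lp_norm q w s" for j
  proof -
    have cq: "c j \<in> lp q w" using c inclusion by auto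
    have "2 ^ j = t j * (4 ^ j * lp_norm p m (c j))"
      using pos[of j] by (simp add: t_def flip: power_divide)
    also have "\<dots> < t j * lp_norm q w (c j)"
      using c(2)[of j] pos[of j] by (intro mult_strict_left_mono) (auto simp: t_def)
    also have "\<dots> = lp_norm q w (\<lambda>k. t j * c j k)"
      using Y.lp_scale(2)[OF cq, of "t j"] t0 by simp
    also have "\<dots> \<le> lp_norm q w s"
      by (rule Y.lp_mono(2)[OF \<open>s \<in> lp q w\<close> dom])
    finally show ?thesis .
  qed
  then show False
    using real_arch_pow[of 2 "lp_norm q w s"] by (meson less_asym one_less_numeral_iff semiring_norm(76))
qed

text \<open>A converse of Hoelder's inequality, which makes \<open>phi\<close> a genuine sum or
  supremum. The bounded inclusion is tested on unit sequences if \<open>p \<le> q\<close>, and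
  otherwise on the finitely supported sequences for which Hoelder's inequality is sharp.\<close>

lemma one_in_lp_ratio: "(\<lambda>_. 1) \<in> lp (r_exp p q) (\<lambda>k. w k / m k)"
proof -
  obtain K0 where K0: "\<And>c. c \<in> lp p m \<Longrightarrow> lp_norm q w c \<le> K0 * lp_norm p m c"
    using inclusion_bounded by blast
  define K where "K = max K0 1"
  have K: "lp_norm q w c \<le> K * lp_norm p m c" if "c \<in> lp p m" for c
    using K0[OF that] mult_right_mono[OF max.cobounded1[of K0 1] X.lp_norm_nonneg[OF that]] by (simp add: K_def)
  have K1: "1 \<le> K" by (simp add: K_def)
  interpret R: weighted_lp "r_exp p q" "\<lambda>k. w k / m k"
    by standard (simp_all add: r_exp_ge_1 X.one_le_p Y.one_le_p X.m_pos Y.m_pos)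
  have upos: "0 < w k / m k" for k by (simp add: X.m_pos Y.m_pos)
  show ?thesis
  proof (cases "p \<le> q")
    case True
    have "w k / m k \<le> K" for k
    proof -
      define e where "e = (\<lambda>l::int ^ 'd. if l = k then 1 else (0::complex))"
      have e: "e \<in> lp p m" by (rule X.lp_finite_support[of "{k}"]) (auto simp: e_def)
      have "lp_le p m e (m k)"
      proof (cases "p = \<infinity>")
        case False
        have "(\<Sum>l\<in>F. (cmod (e l) * m l) powr X.P) \<le> m k powr X.P" if "finite F" for F
        proof -
          have "(\<Sum>l\<in>F. (cmod (e l) * m l) powr X.P) = (\<Sum>l\<in>F. if l = k then m k powr X.P else 0)"
            by (rule sum.cong) (auto simp: e_def)
          then show ?thesis using that by simp
        qed
        then show ?thesis using False by (simp add: lp_le_def)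
      qed (use X.m_nonneg in \<open>auto simp: lp_le_def e_def\<close>)
      then have "lp_norm p m e \<le> m k" using X.lp_leI X.m_nonneg by blast
      moreover have "w k \<le> lp_norm q w e"
        using Y.lp_coord[of e k] e inclusion by (auto simp: e_def)
      moreover have "K * lp_norm p m e \<le> K * m k"
        using K1 calculation(1) by (intro mult_left_mono) auto
      ultimately have "w k \<le> K * m k" using K[OF e] by linarith
      then show ?thesis using X.m_pos[of k] by (simp add: field_simps)
    qed
    then show ?thesis
      using r_exp_eq_infinity[OF X.one_le_p Y.one_le_p True] by (auto simp: lp_def intro!: bdd_aboveI2)
  next
    case False
    then obtain r where r: "r_exp p q = ereal r" "1 \<le> r" "1 / r = 1 / Y.P - 1 / X.P"
      using r_exp_finite X.one_le_p Y.one_le_p by (metis not_le)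
    have q: "q \<noteq> \<infinity>" using False by auto
    note Q = Y.P_ge_1[OF q]
    define u where "u = (\<lambda>k. w k / m k)"
    have u: "0 < u k" for k using upos by (simp add: u_def)
    have bound: "(\<Sum>k\<in>F. u k powr r) \<le> K powr r" if F: "finite F" "F \<noteq> {}" for F
    proof -
      define S where "S = (\<Sum>k\<in>F. u k powr r)"
      have S: "0 < S" unfolding S_def using F u by (intro sum_pos) (auto simp: less_imp_neq[THEN not_sym])
      \<comment> \<open>Chosen so that on \<open>F\<close> both \<open>(cmod c * m) powr X.P\<close>
        and \<open>(cmod c * w) powr Y.P\<close> equal \<open>u powr r\<close>. If
        \<open>p = \<infinity>\<close>, then \<open>X.P\<close> and \<open>r / X.P\<close> are 0, so
        \<open>cmod c * m\<close> is the indicator of \<open>F\<close> and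
        \<open>S powr (1 / X.P)\<close> is 1, the correct norm bound.\<close>
      define c where "c = (\<lambda>k. if k \<in> F then complex_of_real (u k powr (r / X.P) / m k) else 0)"
      have c: "c \<in> lp p m" using F by (intro X.lp_finite_support[of F]) (auto simp: c_def)
      have cm: "cmod (c k) * m k = (if k \<in> F then u k powr (r / X.P) else 0)" for k
        using X.m_pos[of k] by (simp add: c_def norm_divide del: of_real_divide)
      have "lp_le p m c (S powr (1 / X.P))"
      proof (cases "p = \<infinity>")
        case True
        then show ?thesis using S u by (auto simp: lp_le_def cm simp: less_imp_neq[THEN not_sym])
      next
        case p: False
        note P = X.P_ge_1[OF p]
        have "(\<Sum>k\<in>G. (cmod (c k) * m k) powr X.P) \<le> (S powr (1 / X.P)) powr X.P" if G: "finite G" for G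
        proof -
          have "(\<Sum>k\<in>G. (cmod (c k) * m k) powr X.P) = (\<Sum>k\<in>G \<inter> F. (cmod (c k) * m k) powr X.P)"
            using G by (intro sum.mono_neutral_right) (auto simp: cm)
          also have "\<dots> \<le> (\<Sum>k\<in>F. (cmod (c k) * m k) powr X.P)"
            using F by (intro sum_mono2) auto
          also have "\<dots> = S"
            unfolding S_def using P by (intro sum.cong) (auto simp: cm powr_powr)
          finally show ?thesis using S P by (simp add: powr_powr)
        qed
        then show ?thesis using p by (simp add: lp_le_def)
      qed
      then have 1: "lp_norm p m c \<le> S powr (1 / X.P)" using X.lp_leI by force
      have "S = (\<Sum>k\<in>F. (cmod (c k) * w k) powr Y.P)"
        unfolding S_def
      proof (rule sum.cong)
        fix k assume "k \<in> F"
        have "cmod (c k) * w k = (cmod (c k) * m k) * u k" using X.m_pos[of k] by (simp add: u_def)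
        also have "\<dots> = u k powr (r / X.P + 1)" using \<open>k \<in> F\<close> u[of k] by (simp add: cm powr_add)
        finally have "(cmod (c k) * w k) powr Y.P = u k powr ((r / X.P + 1) * Y.P)" by (simp add: powr_powr)
        also have "(r / X.P + 1) * Y.P = r"
        proof -
          have "r / X.P + 1 = r * (1 / X.P + 1 / r)" using r(2) by (simp add: field_simps)
          also have "\<dots> = r * (1 / Y.P)" using r(3) by simp
          finally show ?thesis using Q by simp
        qed
        finally show "u k powr r = (cmod (c k) * w k) powr Y.P" by simp
      qed simp
      also have "\<dots> \<le> lp_norm q w c powr Y.P"
        using Y.lp_le_lp_norm[of c] c inclusion F q by (auto simp: lp_le_def)
      finally have "S powr (1 / Y.P) \<le> (lp_norm q w c powr Y.P) powr (1 / Y.P)"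
        using S Q by (intro powr_mono2) auto
      also have "\<dots> = lp_norm q w c"
        using Q Y.lp_norm_nonneg[of c] c inclusion by (auto simp: powr_powr)
      also have "\<dots> \<le> K * S powr (1 / X.P)"
        using K[OF c] mult_left_mono[OF 1, of K] K1 by linarith
      \<comment> \<open>Division by \<open>S powr (1 / X.P)\<close> leaves the exponent
        \<open>1 / r\<close>. Since \<open>K\<close> does not depend on \<open>F\<close>, the
        partial sums are uniformly bounded.\<close>
      finally have "S powr (1 / Y.P) * S powr (- (1 / X.P)) \<le> K * S powr (1 / X.P) * S powr (- (1 / X.P))"
        by (intro mult_right_mono) auto
      then have "S powr (1 / Y.P - 1 / X.P) \<le> K"
        using S by (simp add: mult.assoc flip: powr_add)
      then have "(S powr (1 / r)) powr r \<le> K powr r" using r by (intro powr_mono2) auto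
      then show ?thesis using S r(2) by (simp add: powr_powr S_def)
    qed
    have "(\<Sum>k\<in>F. u k powr r) \<le> K powr r" if "finite F" for F
      using bound[OF that] by (cases "F = {}") auto
    then have "lp_le (r_exp p q) u (\<lambda>_. 1) K"
      using r(1) u by (simp add: lp_le_def less_imp_le)
    then show ?thesis using R.lp_leI(1)[of "\<lambda>_. 1" K] K1 by (simp add: u_def)
  qed
qed

end

section \<open>Solid matrix norms\<close>

lemma sum_le_infsum_ennreal:
  fixes f :: "'a \<Rightarrow> ennreal"
  shows "finite F \<Longrightarrow> sum f F \<le> infsum f UNIV"
  by (subst nonneg_infsum_complete) (auto intro!: SUP_upper)

lemma infsum_le_ennreal:
  fixes f :: "'a \<Rightarrow> ennreal"
  shows "(\<And>F. finite F \<Longrightarrow> sum f F \<le> T) \<Longrightarrow> infsum f UNIV \<le> T"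
  by (subst nonneg_infsum_complete) (auto intro!: SUP_least)

lemma le_infsum_ennreal:
  fixes f :: "'a \<Rightarrow> ennreal"
  shows "f x \<le> infsum f UNIV"
  using sum_le_infsum_ennreal[of "{x}" f] by simp

lemma infsum_mono_ennreal:
  fixes f g :: "'a \<Rightarrow> ennreal"
  shows "(\<And>x. f x \<le> g x) \<Longrightarrow> infsum f UNIV \<le> infsum g UNIV"
  by (meson infsum_le_ennreal order_trans sum_le_infsum_ennreal sum_mono)

lemma infsum_suminf_le_ennreal:
  fixes f :: "nat \<Rightarrow> 'a \<Rightarrow> ennreal"
  shows "(\<Sum>\<^sub>\<infinity>x. \<Sum>j. f j x) \<le> (\<Sum>j. \<Sum>\<^sub>\<infinity>x. f j x)"
proof (rule infsum_le_ennreal)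
  fix F :: "'a set" assume F: "finite F"
  have "(\<Sum>x\<in>F. \<Sum>j. f j x) = (\<Sum>j. \<Sum>x\<in>F. f j x)"
    by (rule suminf_sum[symmetric]) simp
  also have "\<dots> \<le> (\<Sum>j. \<Sum>\<^sub>\<infinity>x. f j x)"
    by (intro suminf_le sum_le_infsum_ennreal F) auto
  finally show "(\<Sum>x\<in>F. \<Sum>j. f j x) \<le> (\<Sum>j. \<Sum>\<^sub>\<infinity>x. f j x)" .
qed

lemma infsum_cmult_le_ennreal:
  fixes f :: "'a \<Rightarrow> ennreal"
  shows "(\<Sum>\<^sub>\<infinity>x. c * f x) \<le> c * (\<Sum>\<^sub>\<infinity>x. f x)"
  by (intro infsum_le_ennreal) (auto simp: mult_left_mono sum_le_infsum_ennreal simp flip: sum_distrib_left)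

definition id_mat :: "'d mat" where
  "id_mat = (\<lambda>k l. if k = l then 1 else 0)"

text \<open>In \<open>translate_le\<close> the shift may differ from row to row and from column to
  column: a matrix assembled from different translates of pieces of one matrix is in general
  dominated by no single translate of it. Comparing rows with rows and columns with columns matches
  the two suprema in \<open>norm_A1v\<close>. Domination by a series in
  \<open>countably_subadditive\<close> spares any discussion of convergence in the algebra.\<close>

locale solid_matrix_norm =
  fixes N :: "('d::finite) mat \<Rightarrow> ennreal"
  assumes countably_subadditive:
      "\<And>B C. (\<And>k l. ennreal (cmod (C k l)) \<le> (\<Sum>j. ennreal (cmod (B j k l)))) \<Longrightarrow> N C \<le> (\<Sum>j. N (B j))"
    and scale_le: "\<And>a A. N (\<lambda>k l. a * A k l) \<le> ennreal (cmod a) * N A"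
    and entry_le: "\<And>A k l. ennreal (cmod (A k l)) \<le> N A"
    and id_mat_le: "N id_mat \<le> 1"
    and translate_le: "\<And>A B. \<lbrakk>\<And>k. \<exists>s. \<forall>l. cmod (B k l) \<le> cmod (A (k + s) (l + s));
        \<And>l. \<exists>s. \<forall>k. cmod (B k l) \<le> cmod (A (k + s) (l + s))\<rbrakk> \<Longrightarrow> N B \<le> N A"
begin

lemma mono: "(\<And>k l. cmod (B k l) \<le> cmod (A k l)) \<Longrightarrow> N B \<le> N A"
  by (rule translate_le) (auto intro!: exI[of _ 0])

lemma zero: "N (\<lambda>k l. 0) = 0"
  using scale_le[of 0 "\<lambda>k l. 0"] by simp

text \<open>A two-term sum is a series padded with zero matrices.\<close>

lemma add_le:
  assumes "\<And>k l. cmod (C k l) \<le> cmod (A k l) + cmod (B k l)"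
  shows "N C \<le> N A + N B"
proof -
  define S where "S = (\<lambda>j::nat. if j = 0 then A else if j = 1 then B else (\<lambda>k l. 0))"
  have two: "(\<Sum>j. g j) = g 0 + g 1" if "\<And>j. j \<notin> {0,1} \<Longrightarrow> g j = 0" for g :: "nat \<Rightarrow> ennreal"
    using suminf_finite[of "{0,1}" g] that by simp
  have "N C \<le> (\<Sum>j. N (S j))"
  proof (rule countably_subadditive)
    fix k l
    have "(\<Sum>j. ennreal (cmod (S j k l))) = ennreal (cmod (A k l)) + ennreal (cmod (B k l))"
      by (subst two) (auto simp: S_def)
    then show "ennreal (cmod (C k l)) \<le> (\<Sum>j. ennreal (cmod (S j k l)))"
      using assms[of k l] by (simp add: ennreal_leI flip: ennreal_plus)
  qed
  also have "\<dots> = N A + N B" by (subst two) (auto simp: S_def zero)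
  finally show ?thesis .
qed

end

text \<open>A common shift of both indices preserves \<open>k - l\<close> and hence the weight;
  \<open>1 \<le> v\<close> makes the norm dominate each entry. The same two facts serve
  \<open>norm_A1v\<close> and \<open>norm_Cv\<close>.\<close>

lemma solid_matrix_norm_Av:
  assumes v: "\<And>k. 1 \<le> v k" and v0: "v 0 = 1"
  shows "solid_matrix_norm (norm_Av v)"
proof
  have v_nn: "0 \<le> v k" for k using v[of k] by simp
  have upper: "ennreal (cmod (A k l) * v (k - l)) \<le> norm_Av v A" for A k l
    unfolding norm_Av_def by (rule SUP_upper2[of "(k, l)"]) auto
  have least: "norm_Av v A \<le> T" if "\<And>k l. ennreal (cmod (A k l) * v (k - l)) \<le> T" for A T
    unfolding norm_Av_def using that by (auto intro!: SUP_least)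
  show "norm_Av v C \<le> (\<Sum>j. norm_Av v (B j))"
    if le: "\<And>k l. ennreal (cmod (C k l)) \<le> (\<Sum>j. ennreal (cmod (B j k l)))" for B C
  proof (rule least)
    fix k l
    have "ennreal (cmod (C k l) * v (k - l)) \<le> (\<Sum>j. ennreal (cmod (B j k l))) * ennreal (v (k - l))"
      using le[of k l] v_nn by (simp add: ennreal_mult mult_right_mono)
    also have "\<dots> = (\<Sum>j. ennreal (cmod (B j k l) * v (k - l)))"
      using v_nn by (simp add: ennreal_mult)
    also have "\<dots> \<le> (\<Sum>j. norm_Av v (B j))" by (intro suminf_le upper) auto
    finally show "ennreal (cmod (C k l) * v (k - l)) \<le> (\<Sum>j. norm_Av v (B j))" .
  qed
  show "norm_Av v (\<lambda>k l. a * A k l) \<le> ennreal (cmod a) * norm_Av v A" for a A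
  proof (rule least)
    fix k l
    have "ennreal (cmod (a * A k l) * v (k - l)) = ennreal (cmod a) * ennreal (cmod (A k l) * v (k - l))"
      unfolding norm_mult mult.assoc by (rule ennreal_mult') simp
    then show "ennreal (cmod (a * A k l) * v (k - l)) \<le> ennreal (cmod a) * norm_Av v A"
      by (simp only: mult_left_mono[OF upper] zero_le)
  qed
  show "ennreal (cmod (A k l)) \<le> norm_Av v A" for A k l
    using upper[of A k l] v[of "k - l"] mult_left_mono[of 1 "v (k - l)" "cmod (A k l)"]
    by (auto intro: order_trans[OF ennreal_leI])
  show "norm_Av v id_mat \<le> 1"
    by (rule least) (auto simp: id_mat_def v0)
  show "norm_Av v B \<le> norm_Av v A"
    if "\<And>k. \<exists>s. \<forall>l. cmod (B k l) \<le> cmod (A (k + s) (l + s))" for A B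
  proof (rule least)
    fix k l
    obtain s where "cmod (B k l) \<le> cmod (A (k + s) (l + s))" using \<open>\<And>k. \<exists>s. _ k s\<close> by blast
    then have "ennreal (cmod (B k l) * v (k - l)) \<le> ennreal (cmod (A (k + s) (l + s)) * v ((k + s) - (l + s)))"
      using v_nn by (intro ennreal_leI) (simp add: mult_right_mono)
    also have "\<dots> \<le> norm_Av v A" by (rule upper)
    finally show "ennreal (cmod (B k l) * v (k - l)) \<le> norm_Av v A" .
  qed
qed

lemma solid_matrix_norm_A1v:
  assumes v: "\<And>k. 1 \<le> v k" and v0: "v 0 = 1"
  shows "solid_matrix_norm (norm_A1v v)"
proof
  have v_nn: "0 \<le> v k" for k using v[of k] by simp
  define row where "row = (\<lambda>A k. \<Sum>\<^sub>\<infinity>l. ennreal (cmod (A k l) * v (k - l)))"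
  define col where "col = (\<lambda>A l. \<Sum>\<^sub>\<infinity>k. ennreal (cmod (A k l) * v (k - l)))"
  have N_def: "norm_A1v v A = max (SUP k. row A k) (SUP l. col A l)" for A
    by (simp add: norm_A1v_def row_def col_def)
  have upper: "row A k \<le> norm_A1v v A" "col A k \<le> norm_A1v v A" for A k
    unfolding N_def by (rule max.coboundedI1 max.coboundedI2, rule SUP_upper, simp)+
  have least: "norm_A1v v A \<le> T" if "\<And>k. row A k \<le> T" "\<And>l. col A l \<le> T" for A T
    unfolding N_def using that by (auto intro!: SUP_least)
  show "norm_A1v v C \<le> (\<Sum>j. norm_A1v v (B j))"
    if le: "\<And>k l. ennreal (cmod (C k l)) \<le> (\<Sum>j. ennreal (cmod (B j k l)))" for B C
  proof -
    have *: "ennreal (cmod (C k l) * v (k - l)) \<le> (\<Sum>j. ennreal (cmod (B j k l) * v (k - l)))" for k l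
      using le[of k l] v_nn by (simp add: ennreal_mult mult_right_mono)
    show ?thesis
    proof (rule least)
      fix k
      have "row C k \<le> (\<Sum>\<^sub>\<infinity>l. \<Sum>j. ennreal (cmod (B j k l) * v (k - l)))"
        unfolding row_def by (intro infsum_mono_ennreal *)
      also have "\<dots> \<le> (\<Sum>j. row (B j) k)"
        unfolding row_def by (rule infsum_suminf_le_ennreal)
      also have "\<dots> \<le> (\<Sum>j. norm_A1v v (B j))" by (intro suminf_le upper) auto
      finally show "row C k \<le> (\<Sum>j. norm_A1v v (B j))" .
      have "col C k \<le> (\<Sum>\<^sub>\<infinity>l. \<Sum>j. ennreal (cmod (B j l k) * v (l - k)))"
        unfolding col_def by (intro infsum_mono_ennreal *)
      also have "\<dots> \<le> (\<Sum>j. col (B j) k)"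
        unfolding col_def by (rule infsum_suminf_le_ennreal)
      also have "\<dots> \<le> (\<Sum>j. norm_A1v v (B j))" by (intro suminf_le upper) auto
      finally show "col C k \<le> (\<Sum>j. norm_A1v v (B j))" .
    qed
  qed
  show "norm_A1v v (\<lambda>k l. a * A k l) \<le> ennreal (cmod a) * norm_A1v v A" for a A
  proof (rule least)
    fix k
    have "row (\<lambda>k l. a * A k l) k \<le> ennreal (cmod a) * row A k"
      using infsum_cmult_le_ennreal[of "ennreal (cmod a)" "\<lambda>l. ennreal (cmod (A k l) * v (k - l))"] v_nn
      by (simp add: row_def norm_mult mult.assoc ennreal_mult'')
    then show "row (\<lambda>k l. a * A k l) k \<le> ennreal (cmod a) * norm_A1v v A"
      by (rule order_trans) (intro mult_left_mono upper, simp)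
    have "col (\<lambda>k l. a * A k l) k \<le> ennreal (cmod a) * col A k"
      using infsum_cmult_le_ennreal[of "ennreal (cmod a)" "\<lambda>l. ennreal (cmod (A l k) * v (l - k))"] v_nn
      by (simp add: col_def norm_mult mult.assoc ennreal_mult'')
    then show "col (\<lambda>k l. a * A k l) k \<le> ennreal (cmod a) * norm_A1v v A"
      by (rule order_trans) (intro mult_left_mono upper, simp)
  qed
  show "ennreal (cmod (A k l)) \<le> norm_A1v v A" for A k l
  proof -
    have "ennreal (cmod (A k l)) \<le> ennreal (cmod (A k l) * v (k - l))"
      using v[of "k - l"] mult_left_mono[of 1 "v (k - l)" "cmod (A k l)"] by (intro ennreal_leI) auto
    also have "\<dots> \<le> row A k" unfolding row_def by (rule le_infsum_ennreal)
    finally show ?thesis using upper(1)[of A k] by (rule order_trans)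
  qed
  show "norm_A1v v id_mat \<le> 1"
  proof (rule least)
    fix k
    have "row id_mat k = (\<Sum>\<^sub>\<infinity>l\<in>{k}. ennreal (cmod (id_mat k l) * v (k - l)))"
      unfolding row_def by (rule infsum_cong_neutral) (auto simp: id_mat_def)
    then show "row id_mat k \<le> 1" by (simp add: id_mat_def v0)
    have "col id_mat k = (\<Sum>\<^sub>\<infinity>l\<in>{k}. ennreal (cmod (id_mat l k) * v (l - k)))"
      unfolding col_def by (rule infsum_cong_neutral) (auto simp: id_mat_def)
    then show "col id_mat k \<le> 1" by (simp add: id_mat_def v0)
  qed
  show "norm_A1v v B \<le> norm_A1v v A"
    if r: "\<And>k. \<exists>s. \<forall>l. cmod (B k l) \<le> cmod (A (k + s) (l + s))"
      and c: "\<And>l. \<exists>s. \<forall>k. cmod (B k l) \<le> cmod (A (k + s) (l + s))" for A B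
  proof (rule least)
    have bij: "bij_betw (\<lambda>l. l + s) UNIV UNIV" for s :: "int ^ 'a"
      by (rule bij_betwI[where g = "\<lambda>l. l - s"]) auto
    fix k
    obtain s where s: "\<And>l. cmod (B k l) \<le> cmod (A (k + s) (l + s))" using r by blast
    have "row B k \<le> (\<Sum>\<^sub>\<infinity>l. ennreal (cmod (A (k + s) (l + s)) * v ((k + s) - (l + s))))"
      unfolding row_def using s v_nn by (intro infsum_mono_ennreal ennreal_leI) (simp add: mult_right_mono)
    also have "\<dots> = row A (k + s)"
      unfolding row_def
      by (rule infsum_reindex_bij_betw[OF bij, of "\<lambda>l. ennreal (cmod (A (k + s) l) * v ((k + s) - l))"])
    finally show "row B k \<le> norm_A1v v A" using upper(1) order_trans by blast
    obtain s where s: "\<And>l. cmod (B l k) \<le> cmod (A (l + s) (k + s))" using c by blast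
    have "col B k \<le> (\<Sum>\<^sub>\<infinity>l. ennreal (cmod (A (l + s) (k + s)) * v ((l + s) - (k + s))))"
      unfolding col_def using s v_nn by (intro infsum_mono_ennreal ennreal_leI) (simp add: mult_right_mono)
    also have "\<dots> = col A (k + s)"
      unfolding col_def
      by (rule infsum_reindex_bij_betw[OF bij, of "\<lambda>l. ennreal (cmod (A l (k + s)) * v (l - (k + s)))"])
    finally show "col B k \<le> norm_A1v v A" using upper(2) order_trans by blast
  qed
qed

text \<open>The norm sees a matrix only through suprema along its diagonals, and a common shift
  moves an entry along its diagonal.\<close>

lemma solid_matrix_norm_Cv:
  assumes v: "\<And>k. 1 \<le> v k" and v0: "v 0 = 1"
  shows "solid_matrix_norm (norm_Cv v)"
proof
  have v_nn: "0 \<le> v k" for k using v[of k] by simp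
  define diag where "diag = (\<lambda>(A :: 'a mat) l. SUP k. ennreal (cmod (A k (k - l))))"
  have N_def: "norm_Cv v A = (\<Sum>\<^sub>\<infinity>l. diag A l * ennreal (v l))" for A
    by (simp add: norm_Cv_def diag_def)
  have upper: "ennreal (cmod (A k (k - l))) \<le> diag A l" for A k l
    unfolding diag_def by (rule SUP_upper) simp
  have least: "diag A l \<le> T" if "\<And>k. ennreal (cmod (A k (k - l))) \<le> T" for A l T
    unfolding diag_def using that by (auto intro: SUP_least)
  show "norm_Cv v C \<le> (\<Sum>j. norm_Cv v (B j))"
    if le: "\<And>k l. ennreal (cmod (C k l)) \<le> (\<Sum>j. ennreal (cmod (B j k l)))" for B C
  proof -
    have "diag C l \<le> (\<Sum>j. diag (B j) l)" for l
    proof (rule least)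
      fix k
      show "ennreal (cmod (C k (k - l))) \<le> (\<Sum>j. diag (B j) l)"
        by (rule order_trans[OF le]) (intro suminf_le upper; simp)
    qed
    then have "norm_Cv v C \<le> (\<Sum>\<^sub>\<infinity>l. \<Sum>j. diag (B j) l * ennreal (v l))"
      unfolding N_def by (intro infsum_mono_ennreal) (simp add: mult_right_mono)
    also have "\<dots> \<le> (\<Sum>j. norm_Cv v (B j))" unfolding N_def by (rule infsum_suminf_le_ennreal)
    finally show ?thesis .
  qed
  show "norm_Cv v (\<lambda>k l. a * A k l) \<le> ennreal (cmod a) * norm_Cv v A" for a A
  proof -
    have "diag (\<lambda>k l. a * A k l) l \<le> ennreal (cmod a) * diag A l" for l
      by (rule least) (simp add: norm_mult ennreal_mult mult_left_mono upper)
    then have "norm_Cv v (\<lambda>k l. a * A k l) \<le> (\<Sum>\<^sub>\<infinity>l. ennreal (cmod a) * (diag A l * ennreal (v l)))"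
      unfolding N_def mult.assoc[symmetric] by (intro infsum_mono_ennreal mult_right_mono) auto
    also have "\<dots> \<le> ennreal (cmod a) * norm_Cv v A"
      unfolding N_def by (rule infsum_cmult_le_ennreal)
    finally show ?thesis .
  qed
  show "ennreal (cmod (A k l)) \<le> norm_Cv v A" for A k l
  proof -
    have "ennreal (cmod (A k l)) * 1 \<le> diag A (k - l) * ennreal (v (k - l))"
      using upper[of A k "k - l"] v[of "k - l"] by (intro mult_mono) auto
    also have "\<dots> \<le> norm_Cv v A" unfolding N_def by (rule le_infsum_ennreal)
    finally show ?thesis by simp
  qed
  show "norm_Cv v id_mat \<le> 1"
  proof -
    have "diag id_mat l \<le> (if l = 0 then 1 else 0)" for l
      by (rule least) (auto simp: id_mat_def)
    then have "norm_Cv v id_mat \<le> (\<Sum>\<^sub>\<infinity>l. (if l = 0 then 1 else 0) * ennreal (v l))"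
      unfolding N_def by (intro infsum_mono_ennreal mult_right_mono) auto
    also have "\<dots> = (\<Sum>\<^sub>\<infinity>l\<in>{0}. (if l = 0 then 1 else 0) * ennreal (v l))"
      by (rule infsum_cong_neutral) auto
    finally show ?thesis by (simp add: v0)
  qed
  show "norm_Cv v B \<le> norm_Cv v A"
    if r: "\<And>k. \<exists>s. \<forall>l. cmod (B k l) \<le> cmod (A (k + s) (l + s))" for A B
  proof -
    have "diag B l \<le> diag A l" for l
    proof (rule least)
      fix k
      obtain s where s: "\<And>l. cmod (B k l) \<le> cmod (A (k + s) (l + s))" using r by blast
      have "ennreal (cmod (B k (k - l))) \<le> ennreal (cmod (A (k + s) ((k + s) - l)))"
        using s[of "k - l"] by (simp add: algebra_simps)
      also have "\<dots> \<le> diag A l" by (rule upper)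
      finally show "ennreal (cmod (B k (k - l))) \<le> diag A l" .
    qed
    then show ?thesis unfolding N_def by (intro infsum_mono_ennreal mult_right_mono) auto
  qed
qed

text \<open>By submultiplicativity and symmetry,
  \<open>1 = v 0 \<le> v k * v (- k) = v k * v k\<close>.\<close>

lemma admissible_ge_1:
  assumes "admissible v"
  shows "1 \<le> v k"
proof -
  have "v (k + - k) \<le> v k * v (- k)" using assms unfolding admissible_def by blast
  then have "1 \<le> v k * v k" "0 \<le> v k" using assms by (simp_all add: admissible_def)
  then show ?thesis by (metis abs_of_nonneg power2_eq_square abs_square_less_1 not_le)
qed

lemma weighted_algebra_norm_solid:
  assumes f: "is_norm f" and N: "weighted_algebra_norm f N"
  shows "solid_matrix_norm N"
proof -
  have "\<exists>v. (\<forall>k. 1 \<le> v k) \<and> v 0 = 1 \<and> (N = norm_Av v \<or> N = norm_A1v v \<or> N = norm_Cv v)"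
    using N unfolding weighted_algebra_norm_def
  proof (elim disjE exE conjE)
    \<comment> \<open>The norm \<open>norm_As f s\<close> is \<open>norm_Av\<close> for the weight
      \<open>(1 + f (of_idx k)) powr s\<close>, so three kinds of norm remain.\<close>
    fix s assume s: "real CARD('a) < s" "N = norm_As f s"
    have "of_idx 0 = (0 :: real ^ 'a)" by (simp add: of_idx_def vec_eq_iff)
    then have "f (of_idx 0) = 0" using f by (simp add: is_norm_def)
    moreover have "1 \<le> (1 + f (of_idx k)) powr s" for k
      using f s(1) by (intro ge_one_powr_ge_zero) (auto simp: is_norm_def)
    ultimately show ?thesis using s(2)
      by (intro exI[of _ "\<lambda>k. (1 + f (of_idx k)) powr s"]) (auto simp: norm_As_def norm_Av_def fun_eq_iff)
  qed (use admissible_ge_1 in \<open>auto simp: admissible_def\<close>)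
  then show ?thesis
    using solid_matrix_norm_Av solid_matrix_norm_A1v solid_matrix_norm_Cv by metis
qed

section \<open>Positive matrices on \<open>l2\<close>\<close>

interpretation l2: weighted_lp 2 "\<lambda>_. 1"
  by standard simp_all

abbreviation l2_norm :: "('d::finite) sqn \<Rightarrow> real" where
  "l2_norm \<equiv> lp_norm 2 (\<lambda>_. 1)"

definition ip :: "('d::finite) sqn \<Rightarrow> 'd sqn \<Rightarrow> complex" where
  "ip c d = (\<Sum>\<^sub>\<infinity>k. c k * cnj (d k))"

definition unit_sqn :: "int ^ 'd \<Rightarrow> 'd sqn" where
  "unit_sqn l = (\<lambda>k. if k = l then 1 else 0)"

lemma l2_iff: "c \<in> l2 \<longleftrightarrow> (\<lambda>k. (cmod (c k))\<^sup>2) summable_on UNIV"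
  by (simp add: lp_def)

lemma l2_norm_power2: "(l2_norm c)\<^sup>2 = (\<Sum>\<^sub>\<infinity>k. (cmod (c k))\<^sup>2)"
proof -
  have "0 \<le> (\<Sum>\<^sub>\<infinity>k. (cmod (c k))\<^sup>2)" by (intro infsum_nonneg) simp
  then show ?thesis by (simp add: lp_norm_def powr_half_sqrt)
qed

text \<open>The rule would rewrite the exponent in \<open>lp 2\<close> to \<open>ereal 2\<close>, out of reach of the lemmas on \<open>l2\<close>.\<close>

declare numeral_eq_ereal [simp del]

lemma unit_sqn_lp: "1 \<le> p \<Longrightarrow> (\<And>k. 0 < m k) \<Longrightarrow> unit_sqn l \<in> lp p m"
  by (rule weighted_lp.lp_finite_support[of _ _ "{l}"]) (auto simp: unit_sqn_def weighted_lp_def)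

lemma unit_sqn_l2: "unit_sqn l \<in> l2"
  by (rule unit_sqn_lp) (auto simp: numeral_eq_ereal)

lemma infsum_single:
  fixes f :: "'a \<Rightarrow> 'b::{comm_monoid_add,t2_space}"
  assumes "\<And>k. k \<noteq> l \<Longrightarrow> f k = 0"
  shows "infsum f UNIV = f l"
proof -
  have "infsum f UNIV = infsum f {l}" by (rule infsum_cong_neutral) (use assms in auto)
  then show ?thesis by simp
qed

lemma mat_app_unit: "mat_app A (unit_sqn l) = (\<lambda>k. A k l)"
  unfolding mat_app_def by (subst infsum_single[of l]) (auto simp: unit_sqn_def)

lemma mat_app_id: "mat_app id_mat c = c"
  unfolding mat_app_def by (rule ext, subst infsum_single) (auto simp: id_mat_def)

lemma ip_unit_right: "ip c (unit_sqn k) = c k"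
  unfolding ip_def by (subst infsum_single[of k]) (auto simp: unit_sqn_def)

lemma ip_summable: "c \<in> l2 \<Longrightarrow> d \<in> l2 \<Longrightarrow> (\<lambda>k. c k * cnj (d k)) summable_on UNIV"
  by (rule abs_summable_summable, rule abs_summable_product)
     (auto simp: l2_iff norm_mult power2_eq_square)

lemma ip_self:
  assumes "c \<in> l2"
  shows "ip c c = of_real ((l2_norm c)\<^sup>2)"
  unfolding l2_norm_power2 ip_def complex_mult_cnj cmod_power2[symmetric]
  using assms by (intro infsumI has_sum_of_real has_sum_infsum) (simp add: l2_iff)

lemma ip_cnj: "cnj (ip c d) = ip d c"
  unfolding ip_def by (subst infsum_cnj[symmetric]) (simp add: mult.commute)

lemma ip_add_scale_left:
  assumes "c \<in> l2" "c' \<in> l2" "d \<in> l2"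
  shows "ip (\<lambda>k. c k + z * c' k) d = ip c d + z * ip c' d"
proof -
  have "ip (\<lambda>k. c k + z * c' k) d = (\<Sum>\<^sub>\<infinity>k. c k * cnj (d k) + z * (c' k * cnj (d k)))"
    unfolding ip_def by (rule infsum_cong) (simp add: algebra_simps)
  also have "\<dots> = ip c d + (\<Sum>\<^sub>\<infinity>k. z * (c' k * cnj (d k)))"
    unfolding ip_def by (intro infsum_add summable_on_cmult_right ip_summable assms)
  finally show ?thesis by (simp add: ip_def infsum_cmult_right')
qed

lemma ip_add_scale_right:
  assumes "c \<in> l2" "d \<in> l2" "d' \<in> l2"
  shows "ip c (\<lambda>k. d k + z * d' k) = ip c d + cnj z * ip c d'"
  using arg_cong[OF ip_add_scale_left[OF assms(2,3,1), of z], of cnj] by (simp add: ip_cnj)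

lemma l2_add_scale: "c \<in> l2 \<Longrightarrow> d \<in> l2 \<Longrightarrow> (\<lambda>k. c k + z * d k) \<in> l2"
  by (intro l2.lp_add(1) l2.lp_scale(1))

lemma mat_app_add_scale:
  assumes A: "bounded_on_lp p m A" and "c \<in> lp p m" "d \<in> lp p m"
  shows "mat_app A (\<lambda>k. c k + z * d k) = (\<lambda>k. mat_app A c k + z * mat_app A d k)"
proof
  fix k
  have s: "(\<lambda>l. A k l * c l) summable_on UNIV" "(\<lambda>l. A k l * d l) summable_on UNIV"
    using assms unfolding bounded_on_lp_def by auto
  have "mat_app A (\<lambda>k. c k + z * d k) k = (\<Sum>\<^sub>\<infinity>l. A k l * c l + z * (A k l * d l))"
    unfolding mat_app_def by (rule infsum_cong) (simp add: algebra_simps)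
  also have "\<dots> = mat_app A c k + (\<Sum>\<^sub>\<infinity>l. z * (A k l * d l))"
    unfolding mat_app_def by (intro infsum_add summable_on_cmult_right s)
  finally show "mat_app A (\<lambda>k. c k + z * d k) k = mat_app A c k + z * mat_app A d k"
    by (simp add: mat_app_def infsum_cmult_right')
qed

lemma mat_app_diff:
  assumes A: "bounded_on_lp p m A" and "c \<in> lp p m" "d \<in> lp p m"
  shows "mat_app A (\<lambda>k. c k - d k) = (\<lambda>k. mat_app A c k - mat_app A d k)"
  using mat_app_add_scale[OF assms, of "-1"] by simp

lemma mat_app_cmult: "mat_app A (\<lambda>k. z * c k) = (\<lambda>k. z * mat_app A c k)"
  by (simp add: mat_app_def mult.left_commute infsum_cmult_right')

text \<open>The coefficients are those of a sesquilinear form evaluated at \<open>c + z d\<close>.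
  That the values are real at \<open>z = 1\<close> and \<open>z = \<i>\<close> makes the form
  Hermitian; nonnegativity along a suitable real line gives the inequality.\<close>

lemma quadratic_form_Cauchy_Schwarz:
  fixes \<alpha> \<beta> \<gamma> \<delta> :: complex
  assumes nn: "\<And>z. \<alpha> + cnj z * \<beta> + z * \<gamma> + z * cnj z * \<delta> \<in> \<real>\<^sub>\<ge>\<^sub>0"
    and \<alpha>: "\<alpha> \<in> \<real>\<^sub>\<ge>\<^sub>0" and \<delta>: "\<delta> \<in> \<real>\<^sub>\<ge>\<^sub>0"
  shows "\<gamma> = cnj \<beta>" and "(cmod \<beta>)\<^sup>2 \<le> Re \<alpha> * Re \<delta>"
proof -
  note iff = complex_nonneg_Reals_iff
  have im: "Im \<alpha> = 0" "Im \<delta> = 0" and re: "0 \<le> Re \<alpha>" "0 \<le> Re \<delta>" using \<alpha> \<delta> by (auto simp: iff)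
  have "Im \<beta> + Im \<gamma> = 0" using nn[of 1] im by (simp add: iff)
  moreover have "Re \<gamma> = Re \<beta>" using nn[of \<i>] im by (simp add: iff)
  ultimately show \<gamma>: "\<gamma> = cnj \<beta>" by (simp add: complex_eq_iff)
  \<comment> \<open>The choice \<open>z = - t * \<beta>\<close> aligns the phases, so both mixed
    terms equal \<open>- t\<close> times the square of \<open>cmod \<beta>\<close>. The minimum over
    \<open>t\<close> is at \<open>1 / Re \<delta>\<close>; if \<open>Re \<delta> = 0\<close>, the
    expression is affine in \<open>t\<close> and large \<open>t\<close> forces
    \<open>\<beta> = 0\<close>.\<close>
  have *: "0 \<le> Re \<alpha> - 2 * t * (cmod \<beta>)\<^sup>2 + t\<^sup>2 * (cmod \<beta>)\<^sup>2 * Re \<delta>" for t :: real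
    using nn[of "- of_real t * \<beta>"] im unfolding cmod_power2
    by (simp add: iff \<gamma> power2_eq_square algebra_simps)
  show "(cmod \<beta>)\<^sup>2 \<le> Re \<alpha> * Re \<delta>"
  proof (cases "Re \<delta> = 0")
    case True
    have "cmod \<beta> = 0"
    proof (rule ccontr)
      assume "cmod \<beta> \<noteq> 0"
      then have "2 * ((Re \<alpha> + 1) / (2 * (cmod \<beta>)\<^sup>2)) * (cmod \<beta>)\<^sup>2 = Re \<alpha> + 1" by simp
      then show False using *[of "(Re \<alpha> + 1) / (2 * (cmod \<beta>)\<^sup>2)"] True by simp
    qed
    then show ?thesis using True by simp
  next
    case False
    then have "0 < Re \<delta>" using re by simp
    then show ?thesis using *[of "1 / Re \<delta>"] by (simp add: power2_eq_square field_simps)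
  qed
qed

lemma l2_positive_ip: "l2_positive A \<longleftrightarrow> bounded_on_l2 A \<and> (\<forall>c\<in>l2. ip (mat_app A c) c \<in> \<real>\<^sub>\<ge>\<^sub>0)"
  by (simp add: l2_positive_def ip_def)

lemma l2_positive_form:
  assumes A: "l2_positive A" and c: "c \<in> l2" and d: "d \<in> l2"
  shows "ip (mat_app A d) c = cnj (ip (mat_app A c) d)"
    and "(cmod (ip (mat_app A c) d))\<^sup>2 \<le> Re (ip (mat_app A c) c) * Re (ip (mat_app A d) d)"
proof -
  have bdd: "bounded_on_l2 A" and pos: "\<And>c. c \<in> l2 \<Longrightarrow> ip (mat_app A c) c \<in> \<real>\<^sub>\<ge>\<^sub>0"
    using A by (auto simp: l2_positive_ip)
  note mem = l2.op_norm_bound(3)[OF bdd]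
  have "ip (mat_app A c) c + cnj z * ip (mat_app A c) d + z * ip (mat_app A d) c + z * cnj z * ip (mat_app A d) d \<in> \<real>\<^sub>\<ge>\<^sub>0" for z
    using pos[OF l2_add_scale[OF c d, of z]]
    by (simp add: mat_app_add_scale[OF bdd c d] ip_add_scale_left ip_add_scale_right c d mem l2_add_scale algebra_simps)
  from quadratic_form_Cauchy_Schwarz[OF this pos[OF c] pos[OF d]]
  show "ip (mat_app A d) c = cnj (ip (mat_app A c) d)"
    and "(cmod (ip (mat_app A c) d))\<^sup>2 \<le> Re (ip (mat_app A c) c) * Re (ip (mat_app A d) d)" .
qed

lemma bounded_on_l2_id: "bounded_on_l2 id_mat"
  unfolding bounded_on_lp_def mat_app_id
proof (intro conjI ballI allI exI[of _ 1])
  fix c :: "'a sqn" and k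
  show "(\<lambda>l. id_mat k l * c l) summable_on UNIV"
    by (rule finite_nonzero_values_imp_summable_on) (auto simp: id_mat_def intro: finite_subset[of _ "{k}"])
qed auto

lemma l2_positive_id: "l2_positive id_mat"
  using bounded_on_l2_id by (simp add: l2_positive_ip mat_app_id ip_self complex_nonneg_Reals_iff)

lemma ip_Cauchy_Schwarz:
  assumes "c \<in> l2" "d \<in> l2"
  shows "cmod (ip c d) \<le> l2_norm c * l2_norm d"
proof -
  have "(cmod (ip c d))\<^sup>2 \<le> (l2_norm c)\<^sup>2 * (l2_norm d)\<^sup>2"
    using l2_positive_form(2)[OF l2_positive_id assms] by (simp add: mat_app_id ip_self assms)
  then have "(cmod (ip c d))\<^sup>2 \<le> (l2_norm c * l2_norm d)\<^sup>2" by (simp add: power_mult_distrib)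
  then show ?thesis
    by (rule power2_le_imp_le) (intro mult_nonneg_nonneg l2.lp_norm_nonneg assms)
qed

text \<open>Cauchy-Schwarz for the form of \<open>A\<close>, applied to \<open>c\<close> and
  \<open>d = mat_app A c\<close>, bounds the fourth power of the norm of \<open>d\<close> by the
  form at \<open>c\<close> times the form at \<open>d\<close>; the latter is at most
  \<open>M\<close> times the squared norm of \<open>d\<close>, which cancels. Bounds on the
  quadratic form thus become norm bounds without a square root of \<open>A\<close>.\<close>

lemma l2_positive_norm:
  assumes A: "l2_positive A" and M: "\<And>c. c \<in> l2 \<Longrightarrow> Re (ip (mat_app A c) c) \<le> M * (l2_norm c)\<^sup>2"
    and c: "c \<in> l2"
  shows "(l2_norm (mat_app A c))\<^sup>2 \<le> M * Re (ip (mat_app A c) c)"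
proof -
  let ?d = "mat_app A c"
  have d: "?d \<in> l2" using A c l2.op_norm_bound(3) by (auto simp: l2_positive_ip)
  have re: "0 \<le> Re (ip ?d c)"
    using A c by (auto simp: l2_positive_ip complex_nonneg_Reals_iff)
  have "((l2_norm ?d)\<^sup>2)\<^sup>2 \<le> Re (ip ?d c) * Re (ip (mat_app A ?d) ?d)"
    using l2_positive_form(2)[OF A c d] unfolding ip_self[OF d] norm_of_real by simp
  also have "\<dots> \<le> Re (ip ?d c) * (M * (l2_norm ?d)\<^sup>2)"
    by (intro mult_left_mono M d re)
  finally have "(l2_norm ?d)\<^sup>2 * (l2_norm ?d)\<^sup>2 \<le> (M * Re (ip ?d c)) * (l2_norm ?d)\<^sup>2"
    by (simp add: power2_eq_square mult_ac)
  moreover have "0 \<le> M * Re (ip ?d c)"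
  proof -
    have "0 \<le> M" 
    proof -
      have "0 \<le> Re (ip (mat_app A (unit_sqn 0)) (unit_sqn 0))"
        using A unit_sqn_l2 by (auto simp: l2_positive_ip complex_nonneg_Reals_iff)
      also have "\<dots> \<le> M * (l2_norm (unit_sqn 0 :: 'a sqn))\<^sup>2" by (rule M[OF unit_sqn_l2])
      also have "(l2_norm (unit_sqn 0 :: 'a sqn))\<^sup>2 = 1"
        unfolding l2_norm_power2 by (subst infsum_single[of 0]) (auto simp: unit_sqn_def)
      finally show ?thesis by simp
    qed
    then show ?thesis using re by simp
  qed
  ultimately show ?thesis
    using mult_right_le_imp_le[of "(l2_norm ?d)\<^sup>2" "(l2_norm ?d)\<^sup>2"]
    by (cases "l2_norm ?d = 0") auto
qed

lemma l2_form_le: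
  assumes A: "bounded_on_l2 A" and c: "c \<in> l2"
  shows "Re (ip (mat_app A c) c) \<le> op_norm 2 (\<lambda>_. 1) A * (l2_norm c)\<^sup>2"
proof -
  have "Re (ip (mat_app A c) c) \<le> cmod (ip (mat_app A c) c)" by (rule complex_Re_le_cmod)
  also have "\<dots> \<le> l2_norm (mat_app A c) * l2_norm c"
    by (intro ip_Cauchy_Schwarz l2.op_norm_bound(3) A c)
  also have "\<dots> \<le> (op_norm 2 (\<lambda>_. 1) A * l2_norm c) * l2_norm c"
    by (intro mult_right_mono l2.op_norm_bound(4) A c l2.lp_norm_nonneg)
  finally show ?thesis by (simp add: power2_eq_square)
qed

text \<open>The bounded inverse gives \<open>l2_norm c \<le> S * l2_norm (mat_app A c)\<close>, and
  \<open>l2_positive_norm\<close> bounds the square of the right-hand side by a multiple of the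
  form.\<close>

lemma l2_positive_invertible_coercive:
  assumes A: "l2_positive A" and inv: "l2_invertible A"
  obtains \<delta> where "0 < \<delta>" "\<And>c. c \<in> l2 \<Longrightarrow> \<delta> * (l2_norm c)\<^sup>2 \<le> Re (ip (mat_app A c) c)"
proof -
  obtain B where B: "bounded_on_l2 B" "\<And>c. c \<in> l2 \<Longrightarrow> mat_app B (mat_app A c) = c"
    using inv by (auto simp: l2_invertible_def l2_inverse_of_def)
  have bdd: "bounded_on_l2 A" using A by (simp add: l2_positive_ip)
  define M where "M = op_norm 2 (\<lambda>_. 1) A"
  define S where "S = op_norm 2 (\<lambda>_. 1) B"
  have M0: "0 \<le> M" and S0: "0 \<le> S" using l2.op_norm_bound(2) bdd B by (auto simp: M_def S_def)
  \<comment> \<open>The summand 1 only makes \<open>K\<close> positive, so that \<open>1 / K\<close>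
    can serve as the coercivity constant.\<close>
  define K where "K = S\<^sup>2 * M + 1"
  have K: "0 < K" using M0 by (simp add: K_def add_nonneg_pos)
  have "(l2_norm c)\<^sup>2 \<le> K * Re (ip (mat_app A c) c)" if c: "c \<in> l2" for c
  proof -
    have Ac: "mat_app A c \<in> l2" by (rule l2.op_norm_bound(3)[OF bdd c])
    have "l2_norm c \<le> S * l2_norm (mat_app A c)"
      using l2.op_norm_bound(4)[OF B(1) Ac] B(2)[OF c] by (simp add: S_def)
    then have "(l2_norm c)\<^sup>2 \<le> (S * l2_norm (mat_app A c))\<^sup>2"
      using l2.lp_norm_nonneg[OF c] by (intro power_mono)
    also have "\<dots> \<le> S\<^sup>2 * (M * Re (ip (mat_app A c) c))"
      unfolding power_mult_distrib M_def
      by (intro mult_left_mono l2_positive_norm[OF A _ c] l2_form_le bdd) auto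
    also have "\<dots> \<le> K * Re (ip (mat_app A c) c)"
    proof -
      have "0 \<le> Re (ip (mat_app A c) c)" using A c by (auto simp: l2_positive_ip complex_nonneg_Reals_iff)
      then show ?thesis by (simp add: K_def algebra_simps)
    qed
    finally show ?thesis .
  qed
  then show ?thesis using K by (intro that[of "1 / K"]) (auto simp: field_simps)
qed

lemma l2_inverse_of_unique:
  assumes "l2_inverse_of A B" "l2_inverse_of A C"
  shows "B = C"
proof (intro ext)
  fix k l
  have "bounded_on_l2 C" using assms(2) by (simp only: l2_inverse_of_def)
  then have "mat_app C (unit_sqn l) \<in> l2" by (rule l2.op_norm_bound(3)[OF _ unit_sqn_l2])
  then have "mat_app B (mat_app A (mat_app C (unit_sqn l))) = mat_app C (unit_sqn l)"
    using assms(1) unfolding l2_inverse_of_def by blast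
  moreover have "mat_app A (mat_app C (unit_sqn l)) = unit_sqn l"
    using assms(2) unit_sqn_l2 unfolding l2_inverse_of_def by blast
  ultimately have "mat_app B (unit_sqn l) = mat_app C (unit_sqn l)" by simp
  then show "B k l = C k l" by (simp add: mat_app_unit fun_eq_iff)
qed

lemma l2_inverse_of_l2_inv: "l2_invertible A \<Longrightarrow> l2_inverse_of A (l2_inv A)"
  unfolding l2_invertible_def l2_inv_def using l2_inverse_of_unique by (metis theI)

text \<open>For Hermitian \<open>A\<close> the operator \<open>T\<close> inverse to \<open>A\<close> is Hermitian as well, so its rows are the
  conjugates of its square-summable columns and \<open>T\<close> is given by a matrix.\<close>

lemma l2_inverse_of_operator:
  assumes A: "l2_positive A"
    and mem: "\<And>c. c \<in> l2 \<Longrightarrow> T c \<in> l2" and bd: "\<And>c. c \<in> l2 \<Longrightarrow> l2_norm (T c) \<le> K * l2_norm c"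
    and AT: "\<And>c. c \<in> l2 \<Longrightarrow> mat_app A (T c) = c" and TA: "\<And>c. c \<in> l2 \<Longrightarrow> T (mat_app A c) = c"
  shows "l2_inverse_of A (\<lambda>k l. T (unit_sqn l) k)"
proof -
  define B where "B = (\<lambda>k l. T (unit_sqn l) k)"
  have herm: "ip (T c) d = ip c (T d)" if "c \<in> l2" "d \<in> l2" for c d
    using l2_positive_form(1)[OF A mem[OF that(2)] mem[OF that(1)]] AT[OF that(1)] AT[OF that(2)]
    by (simp add: ip_cnj)
  have B_cnj: "B k l = cnj (T (unit_sqn k) l)" for k l
  proof -
    have "B k l = ip (T (unit_sqn l)) (unit_sqn k)" by (simp add: B_def ip_unit_right)
    also have "\<dots> = ip (unit_sqn l) (T (unit_sqn k))" by (rule herm) (rule unit_sqn_l2)+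
    also have "\<dots> = cnj (T (unit_sqn k) l)" by (metis ip_cnj ip_unit_right)
    finally show ?thesis .
  qed
  have summ: "(\<lambda>l. B k l * c l) summable_on UNIV" if "c \<in> l2" for c k
    using ip_summable[OF that mem[OF unit_sqn_l2[of k]]] by (simp add: B_cnj mult.commute)
  have app: "mat_app B c = T c" if "c \<in> l2" for c
  proof
    fix k
    have "mat_app B c k = ip c (T (unit_sqn k))"
      by (simp add: mat_app_def ip_def B_cnj mult.commute)
    also have "\<dots> = T c k"
      using herm[OF that unit_sqn_l2] by (simp add: ip_unit_right flip: herm)
    finally show "mat_app B c k = T c k" .
  qed
  have "bounded_on_l2 B"
    unfolding bounded_on_lp_def using summ app mem bd by (auto intro: exI[of _ K])
  moreover have "bounded_on_l2 A" using A by (simp add: l2_positive_ip)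
  ultimately show ?thesis
    using AT TA app[OF l2.op_norm_bound(3)[of A]] app unfolding l2_inverse_of_def B_def[symmetric] by simp
qed

text \<open>The matrix \<open>G = 1 - A / M\<close> has its form between 0 and
  \<open>\<rho> < 1\<close> times the squared norm, hence is a contraction by
  \<open>l2_positive_norm\<close>. Its Neumann series \<open>T\<close> inverts
  \<open>1 - G = A / M\<close>, so \<open>T / M\<close> inverts \<open>A\<close>.\<close>

lemma l2_coercive_invertible:
  assumes A: "l2_positive A" and \<delta>: "0 < \<delta>"
    and coercive: "\<And>c. c \<in> l2 \<Longrightarrow> \<delta> * (l2_norm c)\<^sup>2 \<le> Re (ip (mat_app A c) c)"
  shows "l2_invertible A"
proof -
  have bdd: "bounded_on_l2 A" using A by (simp add: l2_positive_ip)
  \<comment> \<open>An upper bound of the form; adding \<open>\<delta>\<close> ensures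
    \<open>\<delta> \<le> M\<close> and thus \<open>0 \<le> \<rho>\<close>.\<close>
  define M where "M = op_norm 2 (\<lambda>_. 1) A + \<delta>"
  have M: "\<delta> \<le> M" "0 < M" using l2.op_norm_bound(2)[OF bdd] \<delta> by (auto simp: M_def)
  have upper: "Re (ip (mat_app A c) c) \<le> M * (l2_norm c)\<^sup>2" if "c \<in> l2" for c
    using l2_form_le[OF bdd that] \<delta> by (simp add: M_def distrib_right add_increasing2)
  define \<rho> where "\<rho> = 1 - \<delta> / M"
  have \<rho>: "0 \<le> \<rho>" "\<rho> < 1" using M \<delta> by (auto simp: \<rho>_def)
  define G where "G = (\<lambda>k l. id_mat k l - A k l / of_real M)"
  define a where "a = complex_of_real (- 1 / M)"
  have Ac: "mat_app A c \<in> l2" if "c \<in> l2" for c by (rule l2.op_norm_bound(3)[OF bdd that])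
  have rowG: "(\<lambda>l. G k l * c l) summable_on UNIV" if "c \<in> l2" for c k
  proof -
    have "(\<lambda>l. id_mat k l * c l + a * (A k l * c l)) summable_on UNIV"
      using bdd bounded_on_l2_id that unfolding bounded_on_lp_def
      by (intro summable_on_add summable_on_cmult_right) auto
    then show ?thesis by (simp add: G_def a_def algebra_simps)
  qed
  have appG: "mat_app G c = (\<lambda>k. c k + a * mat_app A c k)" if "c \<in> l2" for c
  proof
    fix k
    have "mat_app G c k = (\<Sum>\<^sub>\<infinity>l. id_mat k l * c l + a * (A k l * c l))"
      unfolding mat_app_def by (rule infsum_cong) (simp add: G_def a_def algebra_simps)
    also have "\<dots> = mat_app id_mat c k + (\<Sum>\<^sub>\<infinity>l. a * (A k l * c l))"
      unfolding mat_app_def using bdd bounded_on_l2_id that unfolding bounded_on_lp_def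
      by (intro infsum_add summable_on_cmult_right) auto
    finally show "mat_app G c k = c k + a * mat_app A c k"
      by (simp add: mat_app_id infsum_cmult_right' flip: mat_app_def[of A, THEN fun_cong]) 
  qed
  have memG: "mat_app G c \<in> l2" if "c \<in> l2" for c
    unfolding appG[OF that] by (intro l2_add_scale that Ac)
  have ipG: "ip (mat_app G c) c = of_real ((l2_norm c)\<^sup>2) + a * ip (mat_app A c) c" if "c \<in> l2" for c
    unfolding appG[OF that] using that Ac by (simp add: ip_add_scale_left ip_self)
  have "bounded_on_l2 G"
  proof -
    have "l2_norm (mat_app G c) \<le> (1 + cmod a * op_norm 2 (\<lambda>_. 1) A) * l2_norm c" if c: "c \<in> l2" for c
    proof -
      have "l2_norm (mat_app G c) \<le> l2_norm c + cmod a * l2_norm (mat_app A c)"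
        unfolding appG[OF c]
        using l2.lp_add(2)[OF c l2.lp_scale(1)[OF Ac[OF c], of a]] l2.lp_scale(2)[OF Ac[OF c], of a] by simp
      also have "\<dots> \<le> l2_norm c + cmod a * (op_norm 2 (\<lambda>_. 1) A * l2_norm c)"
        by (intro add_left_mono mult_left_mono l2.op_norm_bound(4) bdd c) auto
      finally show ?thesis by (simp add: algebra_simps)
    qed
    then show ?thesis unfolding bounded_on_lp_def using rowG memG by blast
  qed
  moreover have "ip (mat_app G c) c \<in> \<real>\<^sub>\<ge>\<^sub>0" if "c \<in> l2" for c
    using upper[OF that] A that M unfolding ipG[OF that]
    by (auto simp: l2_positive_ip complex_nonneg_Reals_iff a_def field_simps)
  ultimately have G: "l2_positive G" by (simp add: l2_positive_ip)
  have upG: "Re (ip (mat_app G c) c) \<le> \<rho> * (l2_norm c)\<^sup>2" if "c \<in> l2" for c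
    using coercive[OF that] M unfolding ipG[OF that] by (simp add: a_def \<rho>_def field_simps)
  have contr: "l2_norm (mat_app G c) \<le> \<rho> * l2_norm c" if "c \<in> l2" for c
  proof (rule power2_le_imp_le)
    have "(l2_norm (mat_app G c))\<^sup>2 \<le> \<rho> * Re (ip (mat_app G c) c)"
      by (rule l2_positive_norm[OF G upG that])
    also have "\<dots> \<le> \<rho> * (\<rho> * (l2_norm c)\<^sup>2)" by (intro mult_left_mono upG that \<rho>)
    finally show "(l2_norm (mat_app G c))\<^sup>2 \<le> (\<rho> * l2_norm c)\<^sup>2"
      by (simp add: power2_eq_square mult_ac)
  qed (intro mult_nonneg_nonneg l2.lp_norm_nonneg \<rho> that)
  define X where "X = (\<lambda>j. mat_app G ^^ j)"
  have memX: "X j c \<in> l2" if "c \<in> l2" for j c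
    using that memG by (induction j) (auto simp: X_def)
  have normX: "l2_norm (X j c) \<le> \<rho> ^ j * l2_norm c" if "c \<in> l2" for j c
  proof (induction j)
    case (Suc j)
    have "l2_norm (X (Suc j) c) \<le> \<rho> * l2_norm (X j c)"
      using contr[OF memX[OF that]] by (simp add: X_def)
    also have "\<dots> \<le> \<rho> * (\<rho> ^ j * l2_norm c)" by (intro mult_left_mono Suc \<rho>)
    finally show ?case by simp
  qed (simp add: X_def)
  define T where "T = (\<lambda>c k. \<Sum>j. X j c k)"
  have geom: "summable (\<lambda>j. \<rho> ^ j * l2_norm c)" for c
    using \<rho> by (intro summable_mult2 summable_geometric) auto
  have sm: "summable (\<lambda>j. l2_norm (X j c))" if "c \<in> l2" for c
    using normX[OF that] l2.lp_norm_nonneg[OF memX[OF that]]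
    by (intro summable_comparison_test'[OF geom[of c]]) auto
  have memT: "T c \<in> l2" if "c \<in> l2" for c
    unfolding T_def by (rule l2.lp_suminf(2)) (use memX sm that in auto)
  define K where "K = 1 / (1 - \<rho>)"
  have normT: "l2_norm (T c) \<le> K * l2_norm c" if "c \<in> l2" for c
  proof -
    have "l2_norm (T c) \<le> (\<Sum>j. l2_norm (X j c))"
      unfolding T_def by (rule l2.lp_suminf(3)) (use memX sm that in auto)
    also have "\<dots> \<le> (\<Sum>j. \<rho> ^ j * l2_norm c)"
      by (intro suminf_le normX sm geom that)
    also have "\<dots> = K * l2_norm c"
      using \<rho> by (simp add: K_def suminf_geometric flip: suminf_mult2)
    finally show ?thesis .
  qed
  have smX: "summable (\<lambda>j. X j c k)" if "c \<in> l2" for c k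
    by (rule summable_norm_cancel, rule l2.lp_suminf(1)) (use memX sm that in auto)
  have T_head: "T c = (\<lambda>k. c k + T (mat_app G c) k)" if "c \<in> l2" for c
  proof
    fix k
    have "(\<Sum>j. X (Suc j) c k) = T c k - X 0 c k"
      unfolding T_def by (rule suminf_split_head[OF smX[OF that]])
    then show "T c k = c k + T (mat_app G c) k"
      by (simp add: T_def X_def funpow_swap1)
  qed
  \<comment> \<open>The defect of \<open>T\<close> as a right inverse of \<open>1 - G\<close>. It is
    unchanged when \<open>c\<close> is replaced by \<open>mat_app G c\<close> and is bounded by a
    multiple of the norm of \<open>c\<close>, so it vanishes because the powers of \<open>G\<close>
    tend to 0. This avoids interchanging \<open>G\<close> with an infinite sum.\<close>
  define E where "E = (\<lambda>c k. T c k - mat_app G (T c) k - c k)"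
  have E_step: "E (mat_app G c) = E c" if "c \<in> l2" for c
  proof -
    have "mat_app G (T c) = mat_app G (\<lambda>k. c k + 1 * T (mat_app G c) k)"
      by (subst T_head[OF that]) simp
    also have "\<dots> = (\<lambda>k. mat_app G c k + 1 * mat_app G (T (mat_app G c)) k)"
      by (intro mat_app_add_scale[OF \<open>bounded_on_l2 G\<close>] memT memG that)
    finally have "mat_app G (T c) k = mat_app G c k + mat_app G (T (mat_app G c)) k" for k by simp
    moreover have "T c k = c k + T (mat_app G c) k" for k by (rule fun_cong[OF T_head[OF that]])
    ultimately show ?thesis by (intro ext) (simp add: E_def)
  qed
  have E_mem: "E c \<in> l2" if "c \<in> l2" for c
    unfolding E_def by (intro l2.lp_diff(1) memT memG that)
  have E_norm: "l2_norm (E c) \<le> (K + \<rho> * K + 1) * l2_norm c" if "c \<in> l2" for c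
  proof -
    have "l2_norm (E c) \<le> l2_norm (\<lambda>k. T c k - mat_app G (T c) k) + l2_norm c"
      unfolding E_def by (intro l2.lp_diff memT memG that)
    also have "l2_norm (\<lambda>k. T c k - mat_app G (T c) k) \<le> l2_norm (T c) + l2_norm (mat_app G (T c))"
      by (intro l2.lp_diff memT memG that)
    also have "l2_norm (mat_app G (T c)) \<le> \<rho> * (K * l2_norm c)"
      using contr[OF memT[OF that]] mult_left_mono[OF normT[OF that] \<rho>(1)] by linarith
    finally show ?thesis using normT[OF that] by (simp add: algebra_simps)
  qed
  have "E c = (\<lambda>_. 0)" if c: "c \<in> l2" for c
  proof -
    have EX: "E (X j c) = E c" for j
      by (induction j) (use E_step memX[OF c] in \<open>auto simp: X_def\<close>)
    have "l2_norm (E c) \<le> (K + \<rho> * K + 1) * (\<rho> ^ j * l2_norm c)" for j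
    proof -
      have "0 \<le> K" using \<rho> by (simp add: K_def)
      then have "(K + \<rho> * K + 1) * l2_norm (X j c) \<le> (K + \<rho> * K + 1) * (\<rho> ^ j * l2_norm c)"
        using \<rho> by (intro mult_left_mono normX c) auto
      then show ?thesis using E_norm[OF memX[OF c], of j] by (simp add: EX)
    qed
    moreover have "(\<lambda>j. (K + \<rho> * K + 1) * (\<rho> ^ j * l2_norm c)) \<longlonglongrightarrow> (K + \<rho> * K + 1) * (0 * l2_norm c)"
      using \<rho> by (intro tendsto_intros LIMSEQ_power_zero) auto
    ultimately have "l2_norm (E c) \<le> 0"
      by (intro LIMSEQ_le_const[of "\<lambda>j. (K + \<rho> * K + 1) * (\<rho> ^ j * l2_norm c)"]) auto
    then show ?thesis using l2.lp_norm_eq_0D E_mem[OF c] l2.lp_norm_nonneg[OF E_mem[OF c]] by simp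
  qed
  then have TG: "T c k - mat_app G (T c) k = c k" if "c \<in> l2" for c k
    using that by (auto simp: E_def fun_eq_iff)
  have X_add: "X j (\<lambda>k. c k + z * d k) = (\<lambda>k. X j c k + z * X j d k)" if "c \<in> l2" "d \<in> l2" for j c d z
    by (induction j) (use that memX mat_app_add_scale[OF \<open>bounded_on_l2 G\<close>] in \<open>auto simp: X_def\<close>)
  have T_add: "T (\<lambda>k. c k + z * d k) = (\<lambda>k. T c k + z * T d k)" if "c \<in> l2" "d \<in> l2" for c d z
    unfolding T_def X_add[OF that]
    using smX that by (simp add: suminf_add[symmetric] summable_mult suminf_mult)
  \<comment> \<open>Since \<open>a = - 1 / M\<close>, this is \<open>T / M\<close>.\<close>
  define R where "R = (\<lambda>c k. - a * T c k)"
  have a0: "a \<noteq> 0" using M by (simp add: a_def)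
  have "mat_app A (R c) = c" if "c \<in> l2" for c
  proof -
    have "T c k - (T c k + a * mat_app A (T c) k) = c k" for k
      using TG[OF that, of k] unfolding appG[OF memT[OF that]] .
    then show ?thesis unfolding R_def mat_app_cmult by (simp add: fun_eq_iff)
  qed
  moreover have "R (mat_app A c) = c" if "c \<in> l2" for c
  proof -
    have "T (mat_app G c) = (\<lambda>k. T c k + a * T (mat_app A c) k)"
      unfolding appG[OF that] by (rule T_add[OF that Ac[OF that]])
    with T_head[OF that] show ?thesis by (simp add: R_def fun_eq_iff add_eq_0_iff)
  qed
  moreover have "R c \<in> l2" if "c \<in> l2" for c
    unfolding R_def by (intro l2.lp_scale(1) memT that)
  moreover have "l2_norm (R c) \<le> cmod a * K * l2_norm c" if "c \<in> l2" for c
    using l2.lp_scale(2)[OF memT[OF that], of "- a"] normT[OF that] mult_left_mono[of _ _ "cmod a"]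
    by (simp add: R_def mult.assoc)
  ultimately have "l2_inverse_of A (\<lambda>k l. R (unit_sqn l) k)"
    by (intro l2_inverse_of_operator[OF A]) auto
  then show ?thesis unfolding l2_invertible_def by blast
qed

section \<open>The largest point of the spectrum of a positive invertible matrix\<close>

lemma l2_form_scale:
  assumes "bounded_on_l2 A" "c \<in> l2"
  shows "Re (ip (mat_app A (\<lambda>k. of_real t * c k)) (\<lambda>k. of_real t * c k)) = t\<^sup>2 * Re (ip (mat_app A c) c)"
proof -
  have "ip (mat_app A (\<lambda>k. of_real t * c k)) (\<lambda>k. of_real t * c k)
      = (\<Sum>\<^sub>\<infinity>k. of_real (t\<^sup>2) * (mat_app A c k * cnj (c k)))"
    unfolding ip_def mat_app_cmult by (rule infsum_cong) (simp add: power2_eq_square)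
  also have "\<dots> = of_real (t\<^sup>2) * ip (mat_app A c) c"
    unfolding ip_def by (rule infsum_cmult_right')
  finally show ?thesis by (simp only: Re_complex_of_real Im_complex_of_real times_complex.sel)
qed

lemma l2_norm_unit: "l2_norm (unit_sqn l) = 1"
proof -
  have "(l2_norm (unit_sqn l))\<^sup>2 = 1"
    unfolding l2_norm_power2 by (subst infsum_single[of l]) (auto simp: unit_sqn_def)
  then show ?thesis using l2.lp_norm_nonneg[OF unit_sqn_l2, of l] by (simp add: power2_eq_1_iff)
qed

lemma mat_app_shifted_id:
  assumes A: "bounded_on_l2 A" and c: "c \<in> l2"
  shows "mat_app (\<lambda>k l. z * id_mat k l - A k l) c = (\<lambda>k. z * c k + - 1 * mat_app A c k)"
    and "(\<lambda>l. (z * id_mat k l - A k l) * c l) summable_on UNIV"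
proof -
  have s: "(\<lambda>l. z * (id_mat k l * c l)) summable_on UNIV" "(\<lambda>l. - 1 * (A k l * c l)) summable_on UNIV" for k
    using A bounded_on_l2_id c unfolding bounded_on_lp_def by (intro summable_on_cmult_right; blast)+
  have eq: "(z * id_mat k l - A k l) * c l = z * (id_mat k l * c l) + - 1 * (A k l * c l)" for k l
    by (simp add: algebra_simps)
  show "(\<lambda>l. (z * id_mat k l - A k l) * c l) summable_on UNIV"
    unfolding eq by (intro summable_on_add s)
  show "mat_app (\<lambda>k l. z * id_mat k l - A k l) c = (\<lambda>k. z * c k + - 1 * mat_app A c k)"
  proof
    fix k
    have "mat_app (\<lambda>k l. z * id_mat k l - A k l) c k
        = (\<Sum>\<^sub>\<infinity>l. z * (id_mat k l * c l)) + (\<Sum>\<^sub>\<infinity>l. - 1 * (A k l * c l))"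
      unfolding mat_app_def eq by (intro infsum_add s)
    also have "\<dots> = z * mat_app id_mat c k + - 1 * mat_app A c k"
      unfolding mat_app_def by (simp only: infsum_cmult_right')
    finally show "mat_app (\<lambda>k l. z * id_mat k l - A k l) c k = z * c k + - 1 * mat_app A c k"
      by (simp add: mat_app_id)
  qed
qed

lemma bounded_on_l2_shifted_id:
  assumes A: "bounded_on_l2 A"
  shows "bounded_on_l2 (\<lambda>k l. z * id_mat k l - A k l)"
proof -
  have main: "(\<lambda>k. z * c k + - 1 * mat_app A c k) \<in> l2 \<and>
        l2_norm (\<lambda>k. z * c k + - 1 * mat_app A c k) \<le> (cmod z + op_norm 2 (\<lambda>_. 1) A) * l2_norm c"
    if c: "c \<in> l2" for c
  proof -
    note z = l2.lp_scale[OF c, of z]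
    note m = l2.lp_scale[OF l2.op_norm_bound(3)[OF A c], of "- 1"]
    show ?thesis
      using l2.lp_add[OF z(1) m(1)] z(2) m(2) l2.op_norm_bound(4)[OF A c]
      by (simp add: distrib_right)
  qed
  show ?thesis
    unfolding bounded_on_lp_def
    by (intro conjI ballI allI exI[of _ "cmod z + op_norm 2 (\<lambda>_. 1) A"])
       (simp_all only: mat_app_shifted_id[OF A] main)
qed

lemma ip_shifted_id:
  assumes A: "bounded_on_l2 A" and c: "c \<in> l2"
  shows "ip (mat_app (\<lambda>k l. z * id_mat k l - A k l) c) c = z * of_real ((l2_norm c)\<^sup>2) - ip (mat_app A c) c"
proof -
  have "ip (\<lambda>k. 0 + z * c k) c = z * ip c c"
    using ip_add_scale_left[OF l2.lp_zero c c, of z] by (simp add: ip_def)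
  then show ?thesis
    unfolding mat_app_shifted_id(1)[OF A c]
    using ip_add_scale_left[OF l2.lp_scale(1)[OF c] l2.op_norm_bound(3)[OF A c] c, of z "- 1"]
    by (simp add: ip_self[OF c])
qed

lemma l2_invertible_uminus:
  assumes "l2_invertible A"
  shows "l2_invertible (\<lambda>k l. - A k l)"
proof -
  obtain B where B: "bounded_on_l2 A" "bounded_on_l2 B"
     "\<And>c. c \<in> l2 \<Longrightarrow> mat_app A (mat_app B c) = c" "\<And>c. c \<in> l2 \<Longrightarrow> mat_app B (mat_app A c) = c"
    using assms unfolding l2_invertible_def l2_inverse_of_def by blast
  have app: "mat_app (\<lambda>k l. - M k l) c = (\<lambda>k. - mat_app M c k)" for M :: "'a mat" and c
    by (simp add: mat_app_def infsum_uminus)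
  have app': "mat_app M (\<lambda>k. - c k) = (\<lambda>k. - mat_app M c k)" for M :: "'a mat" and c
    by (simp add: mat_app_def infsum_uminus)
  have "bounded_on_l2 (\<lambda>k l. - M k l)" if "bounded_on_l2 M" for M :: "'a mat"
  proof -
    have "(\<lambda>l. - M k l * c l) summable_on UNIV" if "c \<in> l2" for c k
      using \<open>bounded_on_l2 M\<close> that unfolding bounded_on_lp_def by (auto simp: summable_on_uminus)
    moreover have "mat_app (\<lambda>k l. - M k l) c \<in> l2"
      "l2_norm (mat_app (\<lambda>k l. - M k l) c) \<le> op_norm 2 (\<lambda>_. 1) M * l2_norm c" if "c \<in> l2" for c
      unfolding app using l2.lp_uminus[OF l2.op_norm_bound(3)[OF \<open>bounded_on_l2 M\<close> that]]
        l2.op_norm_bound(4)[OF \<open>bounded_on_l2 M\<close> that] by simp_all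
    ultimately show ?thesis unfolding bounded_on_lp_def by blast
  qed
  then show ?thesis
    unfolding l2_invertible_def l2_inverse_of_def
    by (intro exI[of _ "\<lambda>k l. - B k l"]) (simp add: B app app')
qed

lemma l2_invertible_uminus_iff: "l2_invertible (\<lambda>k l. - A k l) \<longleftrightarrow> l2_invertible A"
  using l2_invertible_uminus[of A] l2_invertible_uminus[of "\<lambda>k l. - A k l"] by auto

text \<open>The top of the numerical range is the largest point of the spectrum: above it \<open>t - A\<close> is
  coercive, and at it \<open>t - A\<close> is positive but not coercive.\<close>

lemma lambda_plus_pos:
  fixes A :: "('d::finite) mat"
  assumes A: "l2_positive A" and inv: "l2_invertible A"
  shows "0 < lambda_plus A"
proof -
  have bdd: "bounded_on_l2 A" using A by (simp add: l2_positive_ip)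
  define R where "R = {c :: 'd sqn. c \<in> l2 \<and> l2_norm c \<le> 1}"
  define form where "form = (\<lambda>c. Re (ip (mat_app A c) c))"
  define M where "M = (SUP c\<in>R. form c)"
  have R_unit: "unit_sqn 0 \<in> R" by (simp add: R_def unit_sqn_l2 l2_norm_unit)
  have "form c \<le> op_norm 2 (\<lambda>_. 1) A" if "c \<in> R" for c
  proof -
    have "form c \<le> op_norm 2 (\<lambda>_. 1) A * (l2_norm c)\<^sup>2"
      using that l2_form_le[OF bdd] by (simp add: form_def R_def)
    also have "\<dots> \<le> op_norm 2 (\<lambda>_. 1) A * 1"
      using that l2.op_norm_bound(2)[OF bdd] l2.lp_norm_nonneg[of c]
      by (intro mult_left_mono) (auto simp: R_def power_le_one)
    finally show ?thesis by simp
  qed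
  then have bddR: "bdd_above (form ` R)" by (rule bdd_aboveI2)
  have le_M: "form c \<le> M * (l2_norm c)\<^sup>2" if c: "c \<in> l2" for c
  proof (cases "l2_norm c = 0")
    case True
    then have "c = (\<lambda>_. 0)" by (rule l2.lp_norm_eq_0D[OF c])
    then show ?thesis by (simp add: form_def ip_def l2.lp_norm_zero)
  next
    case False
    then have pos: "0 < l2_norm c" using l2.lp_norm_nonneg[OF c] by simp
    define t where "t = 1 / l2_norm c"
    have "(\<lambda>k. of_real t * c k) \<in> R"
      using l2.lp_scale[OF c, of "of_real t"] pos by (simp add: R_def t_def norm_divide)
    then have "form (\<lambda>k. of_real t * c k) \<le> M" unfolding M_def by (intro cSUP_upper bddR)
    then have "t\<^sup>2 * form c \<le> M" unfolding form_def using l2_form_scale[OF bdd c, of t] by simp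
    then show ?thesis using pos by (simp add: t_def power_divide field_simps)
  qed
  obtain \<delta> where \<delta>: "0 < \<delta>" "\<And>c. c \<in> l2 \<Longrightarrow> \<delta> * (l2_norm c)\<^sup>2 \<le> Re (ip (mat_app A c) c)"
    using l2_positive_invertible_coercive[OF A inv] by blast
  have "\<delta> \<le> form (unit_sqn 0)" using \<delta>(2)[OF unit_sqn_l2, of 0] by (simp add: form_def l2_norm_unit)
  moreover have "form (unit_sqn 0) \<le> M" unfolding M_def by (intro cSUP_upper bddR R_unit)
  ultimately have Mpos: "0 < M" using \<delta>(1) by linarith
  define D where "D = (\<lambda>(t::real) k l. of_real t * id_mat k l - A k l)"
  \<comment> \<open>The spectrum refers to \<open>A - t\<close>, coercivity to \<open>t - A\<close>;
    the sign does not affect invertibility.\<close>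
  have spec: "complex_of_real t \<in> l2_spectrum A \<longleftrightarrow> \<not> l2_invertible (D t)" for t
  proof -
    have "(\<lambda>k l. A k l - (if k = l then of_real t else 0)) = (\<lambda>k l. - D t k l)"
      by (auto simp: D_def id_mat_def fun_eq_iff)
    then show ?thesis by (simp add: l2_spectrum_def l2_invertible_uminus_iff)
  qed
  have im: "Im (ip (mat_app A c) c) = 0" if "c \<in> l2" for c
    using A that by (auto simp: l2_positive_ip complex_nonneg_Reals_iff)
  have formD: "Re (ip (mat_app (D t) c) c) = t * (l2_norm c)\<^sup>2 - form c" "Im (ip (mat_app (D t) c) c) = 0"
    if "c \<in> l2" for t c
    using ip_shifted_id[OF bdd that, of "of_real t"] im[OF that] by (simp_all add: D_def form_def)
  have D_pos: "l2_positive (D t)" if "M \<le> t" for t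
  proof -
    have "form c \<le> t * (l2_norm c)\<^sup>2" if "c \<in> l2" for c
      using le_M[OF that] mult_right_mono[OF \<open>M \<le> t\<close>, of "(l2_norm c)\<^sup>2"] by simp
    then show ?thesis
      using bounded_on_l2_shifted_id[OF bdd, of "of_real t"] formD
      by (simp add: l2_positive_ip complex_nonneg_Reals_iff D_def)
  qed
  have "lambda_plus A = M"
    unfolding lambda_plus_def
  proof (rule Greatest_equality)
    show "complex_of_real M \<in> l2_spectrum A"
      unfolding spec
    proof
      assume "l2_invertible (D M)"
      then obtain \<epsilon> where \<epsilon>: "0 < \<epsilon>" "\<And>c. c \<in> l2 \<Longrightarrow> \<epsilon> * (l2_norm c)\<^sup>2 \<le> Re (ip (mat_app (D M) c) c)"
        using l2_positive_invertible_coercive[OF D_pos] by blast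
      then have form_le: "form c \<le> (M - \<epsilon>) * (l2_norm c)\<^sup>2" if "c \<in> l2" for c
        using \<epsilon>(2)[OF that] formD[OF that] by (simp add: algebra_simps)
      have "form (unit_sqn 0) \<le> M - \<epsilon>" using form_le[OF unit_sqn_l2, of 0] by (simp add: l2_norm_unit)
      \<comment> \<open>The sign is what allows
        \<open>(M - \<epsilon>) * (l2_norm c)\<^sup>2\<close> to be bounded by
        \<open>M - \<epsilon>\<close> on the whole unit ball.\<close>
      then have nn: "0 \<le> M - \<epsilon>" using \<open>\<delta> \<le> form (unit_sqn 0)\<close> \<delta>(1) by linarith
      have "M \<le> M - \<epsilon>"
        unfolding M_def
      proof (rule cSUP_least)
        show "R \<noteq> {}" using R_unit by blast
        fix c assume c: "c \<in> R"
        then have "form c \<le> (M - \<epsilon>) * (l2_norm c)\<^sup>2" by (simp add: form_le R_def)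
        also have "\<dots> \<le> (M - \<epsilon>) * 1"
          using c nn l2.lp_norm_nonneg[of c] by (intro mult_left_mono) (auto simp: R_def power_le_one)
        finally show "form c \<le> (SUP c\<in>R. form c) - \<epsilon>" by (simp add: M_def)
      qed
      then show False using \<epsilon>(1) by simp
    qed
    fix t assume "complex_of_real t \<in> l2_spectrum A"
    then have notinv: "\<not> l2_invertible (D t)" by (simp add: spec)
    show "t \<le> M"
    proof (rule ccontr)
      assume "\<not> t \<le> M"
      then have t: "M \<le> t" "0 < t - M" by auto
      have "(t - M) * (l2_norm c)\<^sup>2 \<le> Re (ip (mat_app (D t) c) c)" if "c \<in> l2" for c
        unfolding formD(1)[OF that] left_diff_distrib using le_M[OF that] by simp
      from l2_coercive_invertible[OF D_pos[OF t(1)] t(2) this] notinv show False by blast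
    qed
  qed
  then show ?thesis using Mpos by simp
qed

section \<open>Direct sums\<close>

text \<open>Each \<open>G i\<close> is a matrix on the whole lattice and is compressed to the fibre
  of \<open>L\<close> over \<open>i\<close>. Blocks thus stay at their own indices, and bounds for
  \<open>G i\<close> are inherited by restricting sequences to the fibre.\<close>

definition direct_sum :: "(int ^ 'd \<Rightarrow> 'i) \<Rightarrow> ('i \<Rightarrow> 'd mat) \<Rightarrow> 'd mat" where
  "direct_sum L G = (\<lambda>k l. if L k = L l then G (L k) k l else 0)"

lemma infsum_partition:
  fixes f :: "'a \<Rightarrow> 'b::banach" and L :: "'a \<Rightarrow> 'i"
  assumes "f summable_on UNIV"
  shows "(\<Sum>\<^sub>\<infinity>k. f k) = (\<Sum>\<^sub>\<infinity>i. \<Sum>\<^sub>\<infinity>k. if L k = i then f k else 0)"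
    and "(\<lambda>i. \<Sum>\<^sub>\<infinity>k. if L k = i then f k else 0) summable_on UNIV"
proof -
  let ?S = "Sigma UNIV (\<lambda>i. {k. L k = i})"
  have bij: "bij_betw (\<lambda>k. (L k, k)) UNIV ?S"
    by (rule bij_betwI[where g = snd]) auto
  have s: "(\<lambda>(i, k). f k) summable_on ?S"
    using summable_on_reindex_bij_betw[OF bij, of "\<lambda>(i, k). f k"] assms by simp
  have inner: "(\<Sum>\<^sub>\<infinity>k\<in>{k. L k = i}. f k) = (\<Sum>\<^sub>\<infinity>k. if L k = i then f k else 0)" for i
    by (rule infsum_cong_neutral) auto
  have "(\<Sum>\<^sub>\<infinity>k. f k) = (\<Sum>\<^sub>\<infinity>(i, k)\<in>?S. f k)"
    using infsum_reindex_bij_betw[OF bij, of "\<lambda>(i, k). f k"] by simp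
  also have "\<dots> = (\<Sum>\<^sub>\<infinity>i. \<Sum>\<^sub>\<infinity>k\<in>{k. L k = i}. f k)"
    by (rule infsum_Sigma'_banach[OF s, symmetric])
  finally show "(\<Sum>\<^sub>\<infinity>k. f k) = (\<Sum>\<^sub>\<infinity>i. \<Sum>\<^sub>\<infinity>k. if L k = i then f k else 0)"
    by (simp add: inner)
  show "(\<lambda>i. \<Sum>\<^sub>\<infinity>k. if L k = i then f k else 0) summable_on UNIV"
    using summable_on_Sigma_banach[OF s] by (simp add: inner)
qed

text \<open>A sequence is the orthogonal sum of its restrictions \<open>res c i\<close> to the
  fibres of \<open>L\<close>; squared norms and forms add up over \<open>i\<close>, so bounds
  uniform in \<open>i\<close> survive. Cutting the image of \<open>res c i\<close> back to the fibre
  only lowers its norm.\<close>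

lemma direct_sum_coercive:
  fixes L :: "int ^ ('d::finite) \<Rightarrow> 'i"
  assumes G: "\<And>i. l2_positive (G i)"
    and \<delta>: "\<And>i c. c \<in> l2 \<Longrightarrow> \<delta> * (l2_norm c)\<^sup>2 \<le> Re (ip (mat_app (G i) c) c)"
    and M: "\<And>i c. c \<in> l2 \<Longrightarrow> l2_norm (mat_app (G i) c) \<le> M * l2_norm c" "0 \<le> M"
  shows "l2_positive (direct_sum L G)"
    and "\<And>c. c \<in> l2 \<Longrightarrow> \<delta> * (l2_norm c)\<^sup>2 \<le> Re (ip (mat_app (direct_sum L G) c) c)"
proof -
  define B where "B = direct_sum L G"
  define res where "res = (\<lambda>c i k. if L k = i then c k else (0::complex))"
  have res_mem: "res c i \<in> l2" if "c \<in> l2" for c i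
    by (rule l2.lp_mono(1)[OF that]) (simp add: res_def)
  have bddG: "bounded_on_l2 (G i)" for i using G by (simp add: l2_positive_ip)
  have B_eq: "B k l * c l = G (L k) k l * res c (L k) l" for k l c
    by (simp add: B_def direct_sum_def res_def)
  have summ: "(\<lambda>l. B k l * c l) summable_on UNIV" if "c \<in> l2" for k c
    unfolding B_eq using bddG res_mem[OF that] unfolding bounded_on_lp_def by blast
  have app: "mat_app B c k = mat_app (G (L k)) (res c (L k)) k" for c k
    unfolding mat_app_def B_eq ..
  have sq: "(\<Sum>\<^sub>\<infinity>k. if L k = i then (cmod (c k))\<^sup>2 else 0) = (l2_norm (res c i))\<^sup>2" for c i
    unfolding l2_norm_power2 by (rule infsum_cong) (simp add: res_def)
  have norm_part: "(l2_norm c)\<^sup>2 = (\<Sum>\<^sub>\<infinity>i. (l2_norm (res c i))\<^sup>2)"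
      "(\<lambda>i. (l2_norm (res c i))\<^sup>2) summable_on UNIV" if "c \<in> l2" for c
    using infsum_partition[of "\<lambda>k. (cmod (c k))\<^sup>2" L] that
    by (simp_all add: sq l2_norm_power2[of c] l2_iff)
  have bd: "lp_le 2 (\<lambda>_. 1) (mat_app B c) (M * l2_norm c)" if c: "c \<in> l2" for c
  proof -
    have "(\<Sum>k\<in>F. (cmod (mat_app B c k))\<^sup>2) \<le> (M * l2_norm c)\<^sup>2" if F: "finite F" for F
    proof -
      have "(\<Sum>k\<in>F. (cmod (mat_app B c k))\<^sup>2) = (\<Sum>i\<in>L ` F. \<Sum>k\<in>{k\<in>F. L k = i}. (cmod (mat_app B c k))\<^sup>2)"
        by (rule sum.image_gen[OF F])
      also have "\<dots> \<le> (\<Sum>i\<in>L ` F. M\<^sup>2 * (l2_norm (res c i))\<^sup>2)"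
      proof (rule sum_mono)
        fix i
        have mem: "mat_app (G i) (res c i) \<in> l2" by (rule l2.op_norm_bound(3)[OF bddG res_mem[OF c]])
        have "(\<Sum>k\<in>{k\<in>F. L k = i}. (cmod (mat_app B c k))\<^sup>2)
            = (\<Sum>k\<in>{k\<in>F. L k = i}. (cmod (mat_app (G i) (res c i) k))\<^sup>2)"
          by (rule sum.cong) (auto simp: app)
        also have "\<dots> \<le> (l2_norm (mat_app (G i) (res c i)))\<^sup>2"
          unfolding l2_norm_power2 using mem F by (intro finite_sum_le_infsum) (auto simp: l2_iff)
        also have "\<dots> \<le> (M * l2_norm (res c i))\<^sup>2"
          by (intro power_mono M res_mem c l2.lp_norm_nonneg mem)
        finally show "(\<Sum>k\<in>{k\<in>F. L k = i}. (cmod (mat_app B c k))\<^sup>2) \<le> M\<^sup>2 * (l2_norm (res c i))\<^sup>2"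
          by (simp add: power_mult_distrib)
      qed
      also have "\<dots> = M\<^sup>2 * (\<Sum>i\<in>L ` F. (l2_norm (res c i))\<^sup>2)" by (simp add: sum_distrib_left)
      also have "\<dots> \<le> M\<^sup>2 * (l2_norm c)\<^sup>2"
        unfolding norm_part(1)[OF c] using norm_part(2)[OF c] F
        by (intro mult_left_mono finite_sum_le_infsum) auto
      finally show ?thesis by (simp add: power_mult_distrib)
    qed
    moreover have "real_of_ereal 2 = 2" "(2::ereal) \<noteq> \<infinity>" by (simp_all add: numeral_eq_ereal)
    ultimately show ?thesis
      using M(2) l2.lp_norm_nonneg[OF c] by (simp add: lp_le_def)
  qed
  have nonneg: "0 \<le> M * l2_norm c" if "c \<in> l2" for c
    using M(2) l2.lp_norm_nonneg[OF that] by simp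
  have memB: "mat_app B c \<in> l2" if "c \<in> l2" for c
    using l2.lp_leI(1)[OF bd nonneg] that by blast
  have bddB: "bounded_on_l2 B"
    unfolding bounded_on_lp_def
    using summ memB l2.lp_leI(2)[OF bd nonneg] by blast
  have form: "ip (mat_app B c) c = (\<Sum>\<^sub>\<infinity>i. ip (mat_app (G i) (res c i)) (res c i))"
     "(\<lambda>i. ip (mat_app (G i) (res c i)) (res c i)) summable_on UNIV" if "c \<in> l2" for c
  proof -
    have part: "(\<Sum>\<^sub>\<infinity>k. if L k = i then mat_app B c k * cnj (c k) else 0) = ip (mat_app (G i) (res c i)) (res c i)" for i
      unfolding ip_def by (rule infsum_cong) (auto simp: res_def app)
    show "ip (mat_app B c) c = (\<Sum>\<^sub>\<infinity>i. ip (mat_app (G i) (res c i)) (res c i))"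
      and "(\<lambda>i. ip (mat_app (G i) (res c i)) (res c i)) summable_on UNIV"
      using infsum_partition[OF ip_summable[OF memB[OF that] that], of L]
      by (simp_all only: part ip_def[symmetric])
  qed
  have Gi: "0 \<le> Re (ip (mat_app (G i) (res c i)) (res c i))" "Im (ip (mat_app (G i) (res c i)) (res c i)) = 0"
    if "c \<in> l2" for c i
    using G[of i] res_mem[OF that, of i] by (auto simp: l2_positive_ip complex_nonneg_Reals_iff)
  have Re_form: "Re (ip (mat_app B c) c) = (\<Sum>\<^sub>\<infinity>i. Re (ip (mat_app (G i) (res c i)) (res c i)))" if "c \<in> l2" for c
    unfolding form(1)[OF that] by (rule infsum_Re[OF form(2)[OF that], symmetric])
  have "Im (ip (mat_app B c) c) = 0" if "c \<in> l2" for c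
    unfolding form(1)[OF that] infsum_Im[OF form(2)[OF that], symmetric] using Gi[OF that] by simp
  moreover have "0 \<le> Re (ip (mat_app B c) c)" if "c \<in> l2" for c
    unfolding Re_form[OF that] by (intro infsum_nonneg Gi that)
  ultimately show "l2_positive (direct_sum L G)"
    using bddB by (simp add: l2_positive_ip complex_nonneg_Reals_iff B_def)
  fix c :: "'d sqn" assume c: "c \<in> l2"
  have "\<delta> * (l2_norm c)\<^sup>2 = (\<Sum>\<^sub>\<infinity>i. \<delta> * (l2_norm (res c i))\<^sup>2)"
    unfolding norm_part(1)[OF c] by (rule infsum_cmult_right'[symmetric])
  also have "\<dots> \<le> (\<Sum>\<^sub>\<infinity>i. Re (ip (mat_app (G i) (res c i)) (res c i)))"
    by (intro infsum_mono summable_on_cmult_right norm_part(2)[OF c] summable_on_Re form(2)[OF c] \<delta> res_mem c)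
  finally show "\<delta> * (l2_norm c)\<^sup>2 \<le> Re (ip (mat_app (direct_sum L G) c) c)"
    unfolding Re_form[OF c, symmetric] B_def .
qed

section \<open>Translates\<close>

definition translate_mat :: "int ^ 'd \<Rightarrow> 'd mat \<Rightarrow> 'd mat" where
  "translate_mat s A = (\<lambda>k l. A (k - s) (l - s))"

lemma bij_plus: "bij_betw (\<lambda>k::int ^ 'd. k + s) UNIV UNIV"
  by (rule bij_betwI[where g = "\<lambda>k. k - s"]) auto

lemma l2_translate:
  "(\<lambda>k. c (k + s)) \<in> l2 \<longleftrightarrow> c \<in> l2" "l2_norm (\<lambda>k. c (k + s)) = l2_norm c"
proof -
  show "(\<lambda>k. c (k + s)) \<in> l2 \<longleftrightarrow> c \<in> l2"
    unfolding l2_iff by (rule summable_on_reindex_bij_betw[OF bij_plus, of "\<lambda>k. (cmod (c k))\<^sup>2"])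
  show "l2_norm (\<lambda>k. c (k + s)) = l2_norm c"
    unfolding lp_norm_def
    using infsum_reindex_bij_betw[OF bij_plus, of "\<lambda>k. (cmod (c k) * 1) powr real_of_ereal 2"]
    by (simp add: numeral_eq_ereal)
qed

lemma mat_app_translate: "mat_app (translate_mat s A) c = (\<lambda>k. mat_app A (\<lambda>k. c (k + s)) (k - s))"
proof
  fix k
  show "mat_app (translate_mat s A) c k = mat_app A (\<lambda>k. c (k + s)) (k - s)"
    unfolding mat_app_def translate_mat_def
    using infsum_reindex_bij_betw[OF bij_plus, of "\<lambda>l. A (k - s) (l - s) * c l" s] by simp
qed

lemma l2_positive_translate:
  assumes A: "l2_positive A"
  shows "l2_positive (translate_mat s A)"
    and "\<And>c. ip (mat_app (translate_mat s A) c) c = ip (mat_app A (\<lambda>k. c (k + s))) (\<lambda>k. c (k + s))"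
    and "\<And>c. l2_norm (mat_app (translate_mat s A) c) = l2_norm (mat_app A (\<lambda>k. c (k + s)))"
proof -
  show ip: "ip (mat_app (translate_mat s A) c) c = ip (mat_app A (\<lambda>k. c (k + s))) (\<lambda>k. c (k + s))" for c
    unfolding ip_def mat_app_translate
    using infsum_reindex_bij_betw[OF bij_plus, of "\<lambda>k. mat_app A (\<lambda>k. c (k + s)) (k - s) * cnj (c k)" s] by simp
  show norm: "l2_norm (mat_app (translate_mat s A) c) = l2_norm (mat_app A (\<lambda>k. c (k + s)))" for c
    unfolding mat_app_translate using l2_translate(2)[of "mat_app A (\<lambda>k. c (k + s))" "- s"] by simp
  have bdd: "bounded_on_l2 A" using A by (simp add: l2_positive_ip)
  have "(\<lambda>l. translate_mat s A k l * c l) summable_on UNIV" if "c \<in> l2" for k c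
  proof -
    have "(\<lambda>l. A (k - s) l * c (l + s)) summable_on UNIV"
      using bdd[unfolded bounded_on_lp_def, THEN conjunct1, rule_format, of "\<lambda>k. c (k + s)" "k - s"]
        that l2_translate(1)[of c s] by simp
    then show ?thesis
      using summable_on_reindex_bij_betw[OF bij_plus, of "\<lambda>l. A (k - s) (l - s) * c l" s]
      by (simp add: translate_mat_def)
  qed
  moreover have "mat_app (translate_mat s A) c \<in> l2" if "c \<in> l2" for c
    using l2.op_norm_bound(3)[OF bdd] that l2_translate(1)[of c s]
      l2_translate(1)[of "mat_app A (\<lambda>k. c (k + s))" "- s"]
    by (simp add: mat_app_translate)
  moreover have "l2_norm (mat_app (translate_mat s A) c) \<le> op_norm 2 (\<lambda>_. 1) A * l2_norm c" if "c \<in> l2" for c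
    using l2.op_norm_bound(4)[OF bdd] that l2_translate[of c s] by (simp add: norm) metis
  ultimately have "bounded_on_l2 (translate_mat s A)" unfolding bounded_on_lp_def by blast
  then show "l2_positive (translate_mat s A)"
    using A l2_translate(1)[of _ s] by (auto simp: l2_positive_ip ip)
qed

lemma l2_positive_scaled_id:
  fixes c :: "('d::finite) sqn"
  assumes "0 \<le> t"
  shows "l2_positive (\<lambda>k l :: int ^ 'd. of_real t * id_mat k l)"
    and "mat_app (\<lambda>k l. of_real t * id_mat k l) c = (\<lambda>k. of_real t * c k)"
proof -
  show app: "mat_app (\<lambda>k l. of_real t * id_mat k l) c = (\<lambda>k. of_real t * c k)" for c :: "'d sqn"
    unfolding mat_app_def by (rule ext, subst infsum_single) (auto simp: id_mat_def)
  have "(\<lambda>l. of_real t * id_mat k l * c l) summable_on UNIV" for k :: "int ^ 'd" and c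
    by (rule finite_nonzero_values_imp_summable_on) (auto simp: id_mat_def intro: finite_subset[of _ "{k}"])
  moreover have "(\<lambda>k. of_real t * c k) \<in> l2" "l2_norm (\<lambda>k. of_real t * c k) \<le> t * l2_norm c" if "c \<in> l2" for c :: "'d sqn"
    using l2.lp_scale[OF that, of "of_real t"] assms by simp_all
  ultimately have "bounded_on_l2 (\<lambda>k l :: int ^ 'd. of_real t * id_mat k l)"
    unfolding bounded_on_lp_def app by blast
  moreover have "ip (\<lambda>k. of_real t * c k) c = of_real (t * (l2_norm c)\<^sup>2)" if "c \<in> l2" for c :: "'d sqn"
    using ip_add_scale_left[OF l2.lp_zero that that, of "of_real t"] by (simp add: ip_self[OF that]) (simp add: ip_def)
  ultimately show "l2_positive (\<lambda>k l :: int ^ 'd. of_real t * id_mat k l)"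
    using assms unfolding l2_positive_ip app by (auto simp del: of_real_mult of_real_power)
qed

section \<open>Matrices acting on weighted sequence spaces\<close>

definition abs_mat :: "'d mat \<Rightarrow> 'd mat" where
  "abs_mat A = (\<lambda>k l. of_real (cmod (A k l)))"

definition abs_sqn :: "'d sqn \<Rightarrow> 'd sqn" where
  "abs_sqn c = (\<lambda>k. of_real (cmod (c k)))"

locale acting_norm = solid_matrix_norm N + X: weighted_lp p m
  for N :: "('d::finite) mat \<Rightarrow> ennreal" and p m +
  assumes acts: "\<And>B. B \<in> carrier_alg N \<Longrightarrow> bounded_on_lp p m B"
begin

lemma carrier_mono: "B \<in> carrier_alg N \<Longrightarrow> (\<And>k l. cmod (A k l) \<le> cmod (B k l)) \<Longrightarrow> A \<in> carrier_alg N"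
  using mono[of A B] by (simp add: carrier_alg_def)

lemma abs_mat_carrier: "B \<in> carrier_alg N \<Longrightarrow> abs_mat B \<in> carrier_alg N"
  by (erule carrier_mono) (simp add: abs_mat_def)

lemma abs_sqn_lp: "c \<in> lp p m \<Longrightarrow> abs_sqn c \<in> lp p m" "c \<in> lp p m \<Longrightarrow> lp_norm p m (abs_sqn c) \<le> lp_norm p m c"
  by (erule X.lp_mono; simp add: abs_sqn_def)+

lemma row_summable: "B \<in> carrier_alg N \<Longrightarrow> c \<in> lp p m \<Longrightarrow> (\<lambda>l. B k l * c l) summable_on UNIV"
  using acts unfolding bounded_on_lp_def by blast

lemma abs_row_summable: "B \<in> carrier_alg N \<Longrightarrow> c \<in> lp p m \<Longrightarrow> (\<lambda>l. cmod (B k l) * cmod (c l)) summable_on UNIV"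
  using row_summable[of B c k] by (simp add: summable_on_iff_abs_summable_on_complex norm_mult)

lemma mat_app_abs: "mat_app (abs_mat B) (abs_sqn c) k = of_real (\<Sum>\<^sub>\<infinity>l. cmod (B k l) * cmod (c l))"
  if "B \<in> carrier_alg N" "c \<in> lp p m"
  unfolding mat_app_def abs_mat_def abs_sqn_def of_real_mult[symmetric]
  by (intro infsumI has_sum_of_real has_sum_infsum abs_row_summable that)

text \<open>The image of \<open>c\<close> under \<open>A\<close> is dominated entrywise by
  \<open>t\<close> times the image of \<open>abs_sqn c\<close> under \<open>abs_mat B\<close>.
  Absolute values are needed on the right because cancellation may make \<open>B\<close> itself
  smaller; solidity keeps \<open>abs_mat B\<close> in the algebra.\<close>

lemma op_norm_dominated:
  assumes A: "A \<in> carrier_alg N" and B: "B \<in> carrier_alg N" and t: "0 \<le> t"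
    and le: "\<And>k l. cmod (A k l) \<le> t * cmod (B k l)"
  shows "op_norm p m A \<le> t * op_norm p m (abs_mat B)"
proof (rule X.op_norm_le)
  have bdd: "bounded_on_lp p m (abs_mat B)" by (intro acts abs_mat_carrier B)
  fix c assume c: "c \<in> lp p m"
  let ?e = "mat_app (abs_mat B) (abs_sqn c)"
  have e: "?e \<in> lp p m" by (intro X.op_norm_bound(3)[OF bdd] abs_sqn_lp c)
  have "cmod (mat_app A c k) \<le> cmod (of_real t * ?e k)" for k
  proof -
    have "cmod (mat_app A c k) \<le> (\<Sum>\<^sub>\<infinity>l. cmod (A k l * c l))"
      unfolding mat_app_def
      using abs_row_summable[OF A c] by (intro norm_infsum_bound) (simp add: norm_mult)
    also have "\<dots> \<le> (\<Sum>\<^sub>\<infinity>l. t * (cmod (B k l) * cmod (c l)))"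
      using abs_row_summable[OF A c] le
      by (intro infsum_mono summable_on_cmult_right abs_row_summable B c)
         (auto simp: norm_mult mult.assoc[symmetric] intro!: mult_right_mono)
    also have "\<dots> = t * (\<Sum>\<^sub>\<infinity>l. cmod (B k l) * cmod (c l))" by (rule infsum_cmult_right')
    also have "\<dots> = cmod (of_real t * ?e k)"
      unfolding mat_app_abs[OF B c] using t by (simp add: norm_mult infsum_nonneg)
    finally show ?thesis .
  qed
  then have "lp_norm p m (mat_app A c) \<le> lp_norm p m (\<lambda>k. of_real t * ?e k)"
    by (intro X.lp_mono(2) X.lp_scale(1) e)
  also have "\<dots> = t * lp_norm p m ?e" using X.lp_scale(2)[OF e, of "of_real t"] t by simp
  also have "\<dots> \<le> t * (op_norm p m (abs_mat B) * lp_norm p m (abs_sqn c))"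
    by (intro mult_left_mono X.op_norm_bound(4)[OF bdd] abs_sqn_lp c t)
  also have "\<dots> \<le> t * (op_norm p m (abs_mat B) * lp_norm p m c)"
    by (intro mult_left_mono abs_sqn_lp c t X.op_norm_bound(2)[OF bdd])
  finally show "lp_norm p m (mat_app A c) \<le> t * op_norm p m (abs_mat B) * lp_norm p m c"
    by (simp add: mult.assoc)
qed (intro mult_nonneg_nonneg t X.op_norm_bound(2) acts abs_mat_carrier B)

text \<open>As for the inclusion of sequence spaces, the sum of a series of nonnegative matrices in the
  algebra acts boundedly and dominates each of its terms.\<close>

lemma embedding_bound_exists: "\<exists>K. embedding_bound N p m K"
proof (rule ccontr)
  assume "\<not> ?thesis"
  then have "\<exists>B\<in>carrier_alg N. 4 ^ j * enn2real (N B) < op_norm p m B" for j :: nat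
    unfolding embedding_bound_def by (metis not_le)
  then obtain B where B: "\<And>j. B j \<in> carrier_alg N" "\<And>j :: nat. 4 ^ j * enn2real (N (B j)) < op_norm p m (B j)"
    by metis
  have fin: "N (B j) < \<infinity>" for j using B(1) by (simp add: carrier_alg_def)
  define \<nu> where "\<nu> = (\<lambda>j. enn2real (N (B j)))"
  have N_eq: "N (B j) = ennreal (\<nu> j)" for j using fin[of j] by (simp add: \<nu>_def less_top)
  have \<nu>: "0 < \<nu> j" for j
  proof (rule ccontr)
    assume "\<not> 0 < \<nu> j"
    then have \<nu>0: "\<nu> j = 0" by (simp add: \<nu>_def not_less enn2real_nonneg order_antisym)
    have "B j k l = 0" for k l using entry_le[of "B j" k l] by (simp add: N_eq \<nu>0)
    then have "op_norm p m (B j) \<le> 0"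
      by (intro X.op_norm_le) (simp_all add: mat_app_def X.lp_norm_zero)
    then show False using B(2)[of j] \<nu>0 by (simp add: \<nu>_def)
  qed
  \<comment> \<open>The scaled matrices have norm at most \<open>(1/2) ^ j\<close>, while the factor
    \<open>4 ^ j\<close> leaves operator norms above \<open>2 ^ j\<close>. Here
    \<open>entry_le\<close> has excluded \<open>\<nu> j = 0\<close>.\<close>
  define t where "t = (\<lambda>j. 1 / (2 ^ j * \<nu> j))"
  have t: "0 < t j" for j using \<nu>[of j] by (simp add: t_def)
  define C where "C = (\<lambda>j k l. complex_of_real (t j) * abs_mat (B j) k l)"
  have NC: "N (C j) \<le> ennreal ((1/2) ^ j)" for j
  proof -
    have "N (C j) \<le> ennreal (cmod (of_real (t j))) * N (abs_mat (B j))"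
      unfolding C_def by (rule scale_le)
    also have "\<dots> \<le> ennreal (t j) * ennreal (\<nu> j)"
      using mono[of "abs_mat (B j)" "B j"] t[of j]
      by (intro mult_mono) (auto simp: abs_mat_def N_eq)
    also have "\<dots> = ennreal ((1/2) ^ j)"
      using t[of j] \<nu>[of j] by (simp add: t_def power_divide flip: ennreal_mult)
    finally show ?thesis .
  qed
  have cmodC: "cmod (C j k l) = t j * cmod (B j k l)" for j k l
    using t[of j] by (simp add: C_def abs_mat_def norm_mult)
  have sm: "summable (\<lambda>j. t j * cmod (B j k l))" for k l
  proof (rule summable_comparison_test'[OF summable_geometric[of "1/2::real"]])
    fix j
    have "ennreal (cmod (C j k l)) \<le> ennreal ((1/2) ^ j)" using entry_le NC order_trans by blast
    then show "norm (t j * cmod (B j k l)) \<le> (1/2) ^ j" using t[of j] by (simp add: cmodC)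
  qed simp
  define S where "S = (\<lambda>k l. complex_of_real (\<Sum>j. t j * cmod (B j k l)))"
  have cmodS: "cmod (S k l) = (\<Sum>j. t j * cmod (B j k l))" for k l
    using t sm by (simp add: S_def suminf_nonneg less_imp_le)
  have "N S \<le> (\<Sum>j. N (C j))"
  proof (rule countably_subadditive)
    fix k l
    show "ennreal (cmod (S k l)) \<le> (\<Sum>j. ennreal (cmod (C j k l)))"
      unfolding cmodS cmodC using t sm by (subst suminf_ennreal2) (auto simp: less_imp_le)
  qed
  also have "\<dots> \<le> (\<Sum>j. ennreal ((1/2) ^ j))" by (intro suminf_le NC) auto
  also have "\<dots> = ennreal (\<Sum>j. (1/2) ^ j)" by (intro suminf_ennreal2 summable_geometric) auto
  also have "\<dots> < \<infinity>" by simp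
  finally have S: "S \<in> carrier_alg N" by (simp add: carrier_alg_def)
  have "2 ^ j < op_norm p m (abs_mat S)" for j
  proof -
    have le: "cmod (B j k l) \<le> (1 / t j) * cmod (S k l)" for k l
    proof -
      have "(\<Sum>i\<in>{j}. t i * cmod (B i k l)) \<le> cmod (S k l)"
        unfolding cmodS using t by (intro sum_le_suminf sm) (auto simp: less_imp_le)
      then show ?thesis using t[of j] by (simp add: field_simps)
    qed
    have "4 ^ j * \<nu> j < (1 / t j) * op_norm p m (abs_mat S)"
      using op_norm_dominated[OF B(1) S _ le] B(2)[of j] t[of j] by (simp add: \<nu>_def)
    then have "t j * (4 ^ j * \<nu> j) < op_norm p m (abs_mat S)" using t[of j] by (simp add: field_simps)
    moreover have "t j * (4 ^ j * \<nu> j) = 2 ^ j" using \<nu>[of j] by (simp add: t_def flip: power_divide)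
    ultimately show ?thesis by simp
  qed
  then show False
    using real_arch_pow[of 2 "op_norm p m (abs_mat S)"] by (meson less_asym one_less_numeral_iff semiring_norm(76))
qed

text \<open>The double series converges absolutely: \<open>abs_mat B\<close> maps
  \<open>abs_sqn c\<close> into \<open>lp p m\<close>, where rows of \<open>A\<close> are absolutely
  summable. Hence the order of summation may be exchanged.\<close>

lemma mat_app_assoc:
  assumes A: "A \<in> carrier_alg N" and B: "B \<in> carrier_alg N" and c: "c \<in> lp p m"
  shows "mat_app A (mat_app B c) k = (\<Sum>\<^sub>\<infinity>j. (\<Sum>\<^sub>\<infinity>l. A k l * B l j) * c j)"
proof -
  define f where "f = (\<lambda>(l, j). A k l * (B l j * c j))"
  define e where "e = (\<lambda>l. \<Sum>\<^sub>\<infinity>j. cmod (B l j) * cmod (c j))"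
  have "mat_app (abs_mat B) (abs_sqn c) \<in> lp p m"
    by (intro X.op_norm_bound(3) acts abs_mat_carrier B abs_sqn_lp c)
  then have "(\<lambda>l. cmod (A k l) * cmod (mat_app (abs_mat B) (abs_sqn c) l)) summable_on UNIV"
    by (rule abs_row_summable[OF A])
  moreover have e0: "0 \<le> e l" for l by (simp add: e_def infsum_nonneg)
  moreover have app_abs: "mat_app (abs_mat B) (abs_sqn c) l = of_real (e l)" for l
    by (simp add: mat_app_abs[OF B c] e_def)
  ultimately have outer: "(\<lambda>l. cmod (A k l) * e l) summable_on UNIV"
    by (simp add: app_abs)
  have inner: "(\<Sum>\<^sub>\<infinity>j. cmod (f (l, j))) = cmod (A k l) * e l" for l
    by (simp add: f_def e_def norm_mult infsum_cmult_right')
  have "(\<lambda>x. norm (f x)) summable_on (UNIV \<times> UNIV)"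
    unfolding Infinite_Sum.abs_summable_on_Sigma_iff
  proof (intro conjI ballI)
    show "(\<lambda>j. norm (f (l, j))) summable_on UNIV" for l
      using summable_on_cmult_right[OF abs_row_summable[OF B c], of "cmod (A k l)" l]
      by (simp add: f_def norm_mult)
    show "(\<lambda>l. norm (\<Sum>\<^sub>\<infinity>j. norm (f (l, j)))) summable_on UNIV"
      using outer e0 by (simp add: inner norm_mult)
  qed
  then have f: "(\<lambda>(l, j). A k l * (B l j * c j)) summable_on (UNIV \<times> UNIV)"
    unfolding f_def by (rule abs_summable_summable)
  have "mat_app A (mat_app B c) k = (\<Sum>\<^sub>\<infinity>l. \<Sum>\<^sub>\<infinity>j. A k l * (B l j * c j))"
    unfolding mat_app_def by (simp add: infsum_cmult_right')
  also have "\<dots> = (\<Sum>\<^sub>\<infinity>j. \<Sum>\<^sub>\<infinity>l. A k l * (B l j * c j))" by (rule infsum_swap_banach[OF f])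
  also have "\<dots> = (\<Sum>\<^sub>\<infinity>j. (\<Sum>\<^sub>\<infinity>l. A k l * B l j) * c j)"
    by (simp add: mult.assoc[symmetric] infsum_cmult_left')
  finally show ?thesis .
qed

text \<open>On \<open>l2\<close>, unit sequences show that the product matrices have the entries of
  the identity. With associativity on \<open>lp p m\<close> this suffices there too, with no density
  argument, so \<open>p = \<infinity>\<close> is included.\<close>

lemma inverse_on_lp:
  assumes A: "A \<in> carrier_alg N" and B: "B \<in> carrier_alg N" and inv: "l2_inverse_of A B" and c: "c \<in> lp p m"
  shows "mat_app A (mat_app B c) = c" and "mat_app B (mat_app A c) = c"
proof -
  have *: "mat_app C (mat_app D c) = c"
    if C: "C \<in> carrier_alg N" and D: "D \<in> carrier_alg N"
      and id: "\<And>d. d \<in> l2 \<Longrightarrow> mat_app C (mat_app D d) = d" for C D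
  proof
    fix k
    have "(\<Sum>\<^sub>\<infinity>l. C k l * D l j) = unit_sqn j k" for j
      using fun_cong[OF id[OF unit_sqn_l2, of j], of k] unfolding mat_app_unit by (simp add: mat_app_def)
    then have "mat_app C (mat_app D c) k = (\<Sum>\<^sub>\<infinity>j. unit_sqn j k * c j)"
      by (simp add: mat_app_assoc[OF C D c])
    also have "\<dots> = c k" by (subst infsum_single[of k]) (auto simp: unit_sqn_def)
    finally show "mat_app C (mat_app D c) k = c k" .
  qed
  show "mat_app A (mat_app B c) = c" by (rule *[OF A B]) (use inv in \<open>simp add: l2_inverse_of_def\<close>)
  show "mat_app B (mat_app A c) = c" by (rule *[OF B A]) (use inv in \<open>simp add: l2_inverse_of_def\<close>)
qed

end

section \<open>Finite sections\<close>

lemma finite_Cn: "finite (Cn n :: (int ^ 'd) set)"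
proof -
  have "(Cn n :: (int ^ 'd) set) \<subseteq> (\<lambda>g. \<chi> i. g i) ` (UNIV \<rightarrow>\<^sub>E {- int n..int n})"
  proof
    fix k :: "int ^ 'd" assume "k \<in> Cn n"
    then have "(\<lambda>i. k $ i) \<in> UNIV \<rightarrow>\<^sub>E {- int n..int n}" by (auto simp: Cn_def)
    then show "k \<in> (\<lambda>g. \<chi> i. g i) ` (UNIV \<rightarrow>\<^sub>E {- int n..int n})"
      by (intro image_eqI[of _ _ "\<lambda>i. k $ i"]) (auto simp: vec_eq_iff)
  qed
  moreover have "finite ((\<lambda>g. (\<chi> i. g i) :: int ^ 'd) ` (UNIV \<rightarrow>\<^sub>E {- int n..int n}))"
    by (intro finite_imageI finite_PiE) auto
  ultimately show ?thesis by (rule finite_subset)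
qed

lemma Cn_exhausts:
  assumes "finite (F :: (int ^ 'd) set)"
  shows "\<forall>\<^sub>F n in sequentially. F \<subseteq> Cn n"
proof -
  have "\<forall>\<^sub>F n in sequentially. k \<in> Cn n" for k :: "int ^ 'd"
  proof -
    have "k \<in> Cn n" if "(\<Sum>i\<in>UNIV. nat \<bar>k $ i\<bar>) \<le> n" for n
    proof -
      have "nat \<bar>k $ i\<bar> \<le> n" for i
        using member_le_sum[of i UNIV "\<lambda>i. nat \<bar>k $ i\<bar>"] that by simp
      then have "\<bar>k $ i\<bar> \<le> int n" for i by (metis nat_le_iff)
      then show ?thesis by (simp add: Cn_def abs_le_iff) (metis minus_le_iff)
    qed
    then show ?thesis by (auto simp: eventually_sequentially)
  qed
  then have "\<forall>\<^sub>F n in sequentially. \<forall>k\<in>F. k \<in> Cn n" by (intro eventually_ball_finite assms) auto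
  then show ?thesis by (simp add: subset_eq)
qed

lemma Pn_finite_support: "1 \<le> p \<Longrightarrow> (\<And>k. 0 < m k) \<Longrightarrow> Pn n b \<in> lp p m"
  by (rule weighted_lp.lp_finite_support[of _ _ "Cn n"]) (auto simp: Pn_def weighted_lp_def finite_Cn)

lemma Pn_l2: "Pn n b \<in> l2"
  by (rule Pn_finite_support) (auto simp: numeral_eq_ereal)

lemma mat_app_supported:
  assumes "\<And>l. l \<notin> Cn n \<Longrightarrow> y l = 0"
  shows "mat_app (section_mat A n) y = Pn n (mat_app A y)"
proof
  fix k
  show "mat_app (section_mat A n) y k = Pn n (mat_app A y) k"
    unfolding mat_app_def Pn_def section_mat_def using assms
    by (cases "k \<in> Cn n") (auto intro!: infsum_cong infsum_0)
qed

lemma mat_app_section_tilde: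
  assumes "\<And>l. l \<notin> Cn n \<Longrightarrow> y l = 0"
  shows "mat_app (section_tilde A n) y = mat_app (section_mat A n) y"
  unfolding mat_app_def section_tilde_def section_mat_def using assms
  by (intro ext infsum_cong) auto

text \<open>Centres of pairwise disjoint cubes congruent to \<open>Cn 0, Cn 1, \<dots>\<close>: the intervals
  \<open>[(n + 1)\<^sup>2 - n, (n + 1)\<^sup>2 + n]\<close> are disjoint.\<close>

definition cube_centre :: "nat \<Rightarrow> int ^ 'd" where
  "cube_centre n = (\<chi> i. (int n + 1)\<^sup>2)"

lemma cubes_disjoint:
  assumes "k - cube_centre n \<in> Cn n" "k - cube_centre n' \<in> Cn n'"
  shows "n = n'"
proof -
  have "\<not> n < n'" if "k - cube_centre n \<in> Cn n" "k - cube_centre n' \<in> Cn n'" for n n'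
  proof
    assume "n < n'"
    \<comment> \<open>It follows that \<open>(int n + 1)\<^sup>2 + int n\<close> is less than
      \<open>(int n' + 1)\<^sup>2 - int n' = (int n')\<^sup>2 + int n' + 1\<close>. One coordinate
      separates the cubes; \<open>undefined\<close> below names an arbitrary one.\<close>
    then have "(int n + 1)\<^sup>2 \<le> (int n')\<^sup>2" by (intro power_mono) auto
    moreover have "k $ i - (int n + 1)\<^sup>2 \<le> int n" "- int n' \<le> k $ i - (int n' + 1)\<^sup>2" for i
      using that by (auto simp: Cn_def cube_centre_def)
    then have "k $ undefined \<le> (int n + 1)\<^sup>2 + int n" "(int n' + 1)\<^sup>2 - int n' \<le> k $ undefined"
      by (metis diff_le_eq add.commute, metis diff_le_eq le_diff_eq minus_le_iff uminus_add_conv_diff)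
    moreover have "(int n' + 1)\<^sup>2 = (int n')\<^sup>2 + 2 * int n' + 1" by (simp add: power2_sum)
    ultimately show False using \<open>n < n'\<close> by linarith
  qed
  then show ?thesis using assms by (metis linorder_neqE_nat)
qed

text \<open>All lattice points outside the cubes share the label \<open>None\<close> and form one
  further block.\<close>

definition cube_label :: "int ^ 'd \<Rightarrow> nat option" where
  "cube_label k = (if \<exists>n. k - cube_centre n \<in> Cn n then Some (THE n. k - cube_centre n \<in> Cn n) else None)"

lemma cube_label_eq_Some: "cube_label k = Some n \<longleftrightarrow> k - cube_centre n \<in> Cn n"
proof
  assume "k - cube_centre n \<in> Cn n"
  then show "cube_label k = Some n" using cubes_disjoint by (auto simp: cube_label_def intro!: the_equality)
next
  assume "cube_label k = Some n"
  then have ex: "\<exists>n. k - cube_centre n \<in> Cn n" and n: "n = (THE n. k - cube_centre n \<in> Cn n)"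
    by (auto simp: cube_label_def split: if_splits)
  show "k - cube_centre n \<in> Cn n" unfolding n by (rule theI') (use ex cubes_disjoint in blast)
qed

section \<open>Solvability of the finite sections and uniform bounds for their inverses\<close>

locale positive_invertible =
  fixes A :: "('d::finite) mat"
  assumes pos: "l2_positive A" and inv: "l2_invertible A"
begin

abbreviation "\<Lambda> \<equiv> lambda_plus A"

lemma lambda_pos: "0 < \<Lambda>"
  by (rule lambda_plus_pos[OF pos inv])

lemma bounded: "bounded_on_l2 A"
  using pos by (simp add: l2_positive_ip)

text \<open>Serves \<open>section_tilde A n\<close>, with two labels, and \<open>blocks\<close>,
  with one label per cube. Translation changes neither the coercivity constant nor the norm of
  \<open>A\<close>, and \<open>\<Lambda>\<close> is positive, so all summands share the bounds
  \<open>\<delta>'\<close> and \<open>M\<close>.\<close>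

lemma direct_sum_invertible:
  fixes L :: "int ^ 'd \<Rightarrow> 'i"
  assumes G: "\<And>i. G i = (\<lambda>k l. of_real \<Lambda> * id_mat k l) \<or> (\<exists>s. G i = translate_mat s A)"
  shows "l2_invertible (direct_sum L G)"
proof -
  obtain \<delta> where \<delta>: "0 < \<delta>" "\<And>c. c \<in> l2 \<Longrightarrow> \<delta> * (l2_norm c)\<^sup>2 \<le> Re (ip (mat_app A c) c)"
    using l2_positive_invertible_coercive[OF pos inv] by blast
  define \<delta>' where "\<delta>' = min \<delta> \<Lambda>"
  define M where "M = max (op_norm 2 (\<lambda>_. 1) A) \<Lambda>"
  have ip_scaled: "ip (\<lambda>k. z * c k) c = z * of_real ((l2_norm c)\<^sup>2)" if "c \<in> l2" for z and c :: "'d sqn"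
    using ip_add_scale_left[OF l2.lp_zero that that, of z] ip_self[OF that] by (simp add: ip_def)
  have lower: "\<delta>' * (l2_norm c)\<^sup>2 \<le> Re (ip (mat_app (G i) c) c)"
    and upper: "l2_norm (mat_app (G i) c) \<le> M * l2_norm c" if c: "c \<in> l2" for i c
  proof -
    have "\<delta>' * (l2_norm c)\<^sup>2 \<le> Re (ip (mat_app (G i) c) c) \<and> l2_norm (mat_app (G i) c) \<le> M * l2_norm c"
      using G[of i]
    proof (elim disjE exE)
      assume "G i = (\<lambda>k l. of_real \<Lambda> * id_mat k l)"
      then have app: "mat_app (G i) c = (\<lambda>k. of_real \<Lambda> * c k)"
        using l2_positive_scaled_id(2)[of \<Lambda> c] lambda_pos by simp
      have "\<delta>' * (l2_norm c)\<^sup>2 \<le> \<Lambda> * (l2_norm c)\<^sup>2" by (intro mult_right_mono) (auto simp: \<delta>'_def)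
      moreover have "\<Lambda> * l2_norm c \<le> M * l2_norm c"
        using l2.lp_norm_nonneg[OF c] by (intro mult_right_mono) (auto simp: M_def)
      ultimately show ?thesis
        unfolding app ip_scaled[OF c] l2.lp_scale(2)[OF c] using lambda_pos by simp
    next
      fix s assume Gi: "G i = translate_mat s A"
      let ?c = "\<lambda>k. c (k + s)"
      have c': "?c \<in> l2" and norm: "l2_norm ?c = l2_norm c" using c by (simp_all add: l2_translate)
      have "\<delta>' * (l2_norm c)\<^sup>2 \<le> \<delta> * (l2_norm c)\<^sup>2" by (intro mult_right_mono) (auto simp: \<delta>'_def)
      moreover have "op_norm 2 (\<lambda>_. 1) A * l2_norm c \<le> M * l2_norm c"
        using l2.lp_norm_nonneg[OF c] by (intro mult_right_mono) (auto simp: M_def)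
      ultimately show ?thesis
        unfolding Gi l2_positive_translate(2,3)[OF pos]
        using \<delta>(2)[OF c'] l2.op_norm_bound(4)[OF bounded c'] norm by simp
    qed
    then show "\<delta>' * (l2_norm c)\<^sup>2 \<le> Re (ip (mat_app (G i) c) c)"
      and "l2_norm (mat_app (G i) c) \<le> M * l2_norm c" by auto
  qed
  have Gpos: "l2_positive (G i)" for i
    using G[of i] l2_positive_scaled_id(1)[of \<Lambda>] l2_positive_translate(1)[OF pos] lambda_pos by auto
  have "0 \<le> M" using lambda_pos by (simp add: M_def)
  from direct_sum_coercive[OF Gpos lower upper this, where L = L]
  show ?thesis
    using \<delta>(1) lambda_pos by (intro l2_coercive_invertible[of _ \<delta>']) (auto simp: \<delta>'_def)
qed

lemma section_tilde_direct_sum: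
  "section_tilde A n = direct_sum (\<lambda>k. k \<in> Cn n) (\<lambda>b. if b then translate_mat 0 A else (\<lambda>k l. of_real \<Lambda> * id_mat k l))"
  by (auto simp: section_tilde_def section_mat_def direct_sum_def translate_mat_def id_mat_def fun_eq_iff)

lemma section_tilde_inverse: "l2_inverse_of (section_tilde A n) (l2_inv (section_tilde A n))"
  unfolding section_tilde_direct_sum
  by (intro l2_inverse_of_l2_inv direct_sum_invertible) auto

lemma section_tilde_left_inverse:
  "c \<in> l2 \<Longrightarrow> mat_app (l2_inv (section_tilde A n)) (mat_app (section_tilde A n) c) = c"
  using section_tilde_inverse unfolding l2_inverse_of_def by blast

lemma section_tilde_outside:
  assumes "k \<notin> Cn n"
  shows "mat_app (section_tilde A n) y k = of_real \<Lambda> * y k"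
  unfolding mat_app_def using assms
  by (subst infsum_single[of k]) (auto simp: section_tilde_def section_mat_def)

text \<open>On sequences supported in \<open>Cn n\<close> the matrices
  \<open>section_tilde A n\<close> and \<open>section_mat A n\<close> agree. Conversely, a preimage
  of \<open>Pn n b\<close> under the former is supported there, because off the cube the matrix
  multiplies by \<open>\<Lambda>\<close>, which is not 0.\<close>

lemma section_solution_iff:
  "section_solution A b n y \<longleftrightarrow> y = mat_app (l2_inv (section_tilde A n)) (Pn n b)"
proof
  assume sol: "section_solution A b n y"
  then have supp: "\<And>l. l \<notin> Cn n \<Longrightarrow> y l = 0" by (simp add: section_solution_def)
  then have "y \<in> l2" by (rule l2.lp_finite_support[OF finite_Cn])
  then show "y = mat_app (l2_inv (section_tilde A n)) (Pn n b)"
    using section_tilde_left_inverse[of y n] sol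
    by (simp add: section_solution_def mat_app_section_tilde[OF supp])
next
  assume y: "y = mat_app (l2_inv (section_tilde A n)) (Pn n b)"
  have Sy: "mat_app (section_tilde A n) y = Pn n b"
    using section_tilde_inverse Pn_l2 unfolding y l2_inverse_of_def by blast
  have supp: "y k = 0" if "k \<notin> Cn n" for k
    using fun_cong[OF Sy, of k] section_tilde_outside[OF that, of y] lambda_pos that by (simp add: Pn_def)
  then show "section_solution A b n y"
    using Sy mat_app_section_tilde[of n y A] by (simp add: section_solution_def)
qed

lemma ex1_section_solution: "\<exists>!y. section_solution A b n y"
  by (simp add: section_solution_iff)

lemma xn_eq: "xn A b n = mat_app (l2_inv (section_tilde A n)) (Pn n b)"
  unfolding xn_def by (rule the_equality) (simp_all add: section_solution_iff)

lemma xn_solution: "section_solution A b n (xn A b n)"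
  by (simp add: section_solution_iff xn_eq)

text \<open>The filler off the cubes keeps the matrix coercive; a zero block there would destroy
  invertibility.\<close>

definition blocks :: "'d mat" where
  "blocks = direct_sum cube_label (\<lambda>i. case i of None \<Rightarrow> (\<lambda>k l. of_real \<Lambda> * id_mat k l)
                                           | Some n \<Rightarrow> translate_mat (cube_centre n) A)"

lemma blocks_inverse: "l2_inverse_of blocks (l2_inv blocks)"
  unfolding blocks_def
  by (intro l2_inverse_of_l2_inv direct_sum_invertible) (auto split: option.split)

text \<open>One summand per kind of column: for \<open>l\<close> in the cube the column is a cut-off
  translate of a column of the inverse of \<open>blocks\<close>, and for \<open>l\<close> outside it
  is \<open>1 / \<Lambda>\<close> times a unit sequence.\<close>

lemma section_tilde_inverse_entries:
  "cmod (l2_inv (section_tilde A n) k l)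
     \<le> cmod (l2_inv blocks (k + cube_centre n) (l + cube_centre n)) + cmod (of_real (1 / \<Lambda>) * id_mat k l)"
proof -
  define s :: "int ^ 'd" where "s = cube_centre n"
  define S where "S = section_tilde A n"
  define R where "R = l2_inv blocks"
  have column: "l2_inv S k l = y k" if "mat_app S y = unit_sqn l" "y \<in> l2" for y
  proof -
    have "l2_inv S k l = mat_app (l2_inv S) (unit_sqn l) k" by (simp add: mat_app_unit)
    also have "\<dots> = y k" unfolding that(1)[symmetric] S_def section_tilde_left_inverse[OF that(2)] ..
    finally show ?thesis .
  qed
  show ?thesis
  proof (cases "l \<in> Cn n")
    case True
    \<comment> \<open>The cut-off does no harm: rows of \<open>blocks\<close> indexed by the
      translated cube vanish off that cube, so they never meet the discarded entries.\<close>
    define y where "y = (\<lambda>k. if k \<in> Cn n then R (k + s) (l + s) else 0)"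
    have y: "y \<in> l2" by (rule l2.lp_finite_support[OF finite_Cn[of n]]) (simp add: y_def)
    have "mat_app S y = unit_sqn l"
    proof
      fix k
      show "mat_app S y k = unit_sqn l k"
      proof (cases "k \<in> Cn n")
        case k: True
        have label: "cube_label (j + s) = Some n \<longleftrightarrow> j \<in> Cn n" for j
          by (simp add: cube_label_eq_Some s_def)
        have "mat_app blocks (mat_app R (unit_sqn (l + s))) = unit_sqn (l + s)"
          using blocks_inverse unit_sqn_l2 unfolding R_def l2_inverse_of_def by blast
        then have "unit_sqn (l + s) (k + s) = (\<Sum>\<^sub>\<infinity>j. blocks (k + s) j * R j (l + s))"
          unfolding mat_app_unit by (simp add: mat_app_def fun_eq_iff)
        also have "\<dots> = (\<Sum>\<^sub>\<infinity>j. blocks (k + s) (j + s) * R (j + s) (l + s))"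
          by (rule infsum_reindex_bij_betw[OF bij_plus, of "\<lambda>j. blocks (k + s) j * R j (l + s)" s, symmetric])
        also have "\<dots> = (\<Sum>\<^sub>\<infinity>j. S k j * y j)"
        proof (rule infsum_cong)
          fix j
          have lk: "cube_label (k + s) = Some n" by (simp only: label k)
          have tr: "translate_mat (cube_centre n) A (k + s) (j + s) = A k j"
            by (simp add: translate_mat_def s_def)
          have "blocks (k + s) (j + s) = (if j \<in> Cn n then A k j else 0)"
            unfolding blocks_def direct_sum_def lk label[symmetric] option.case tr
            by (rule if_cong) auto
          then show "blocks (k + s) (j + s) * R (j + s) (l + s) = S k j * y j"
            using k by (simp add: S_def y_def section_tilde_def section_mat_def)
        qed
        finally show ?thesis by (simp add: mat_app_def unit_sqn_def)
      next
        case False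
        then show ?thesis
          using True section_tilde_outside[OF False, of y] by (auto simp: S_def y_def unit_sqn_def)
      qed
    qed
    from column[OF this y] show ?thesis by (simp add: y_def S_def R_def s_def)
  next
    case False
    define y where "y = (\<lambda>k. of_real (1 / \<Lambda>) * unit_sqn l k)"
    have y: "y \<in> l2" unfolding y_def by (intro l2.lp_scale(1) unit_sqn_l2)
    have "mat_app S y = (\<lambda>k. of_real (1 / \<Lambda>) * S k l)"
      unfolding y_def mat_app_cmult mat_app_unit ..
    also have "\<dots> = unit_sqn l"
      using False lambda_pos by (auto simp: S_def section_tilde_def section_mat_def unit_sqn_def fun_eq_iff)
    finally show ?thesis
      using column[OF _ y] by (simp add: y_def S_def id_mat_def unit_sqn_def)
  qed
qed

text \<open>Stability: all finite sections are blocks of the single matrix \<open>blocks\<close>, which belongs to the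
  algebra since its norm is insensitive to translations, and whose inverse does by inverse-closedness.\<close>

lemma section_tilde_inverse_uniformly_bounded:
  assumes N: "solid_matrix_norm N" and closed: "inverse_closed (carrier_alg N)" and A: "A \<in> carrier_alg N"
  obtains K where "K < \<infinity>" "\<And>n. N (l2_inv (section_tilde A n)) \<le> K"
proof -
  interpret solid_matrix_norm N by fact
  have scaled_id: "N (\<lambda>k l. of_real t * id_mat k l) < \<infinity>" for t
  proof -
    have "N (\<lambda>k l. of_real t * id_mat k l) \<le> ennreal (cmod (of_real t)) * N id_mat" by (rule scale_le)
    also have "\<dots> \<le> ennreal (cmod (of_real t)) * 1" by (intro mult_left_mono id_mat_le) simp
    also have "\<dots> < \<infinity>" by simp
    finally show ?thesis .
  qed
  \<comment> \<open>The part of \<open>blocks\<close> on the cubes. A row or column in the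
    \<open>n\<close>-th cube is compared with \<open>A\<close> through the shift
    \<open>- cube_centre n\<close>; the others are zero, so any shift will do.\<close>
  define B where "B = (\<lambda>k l. if cube_label k = cube_label l
      then case cube_label k of None \<Rightarrow> 0 | Some n \<Rightarrow> A (k - cube_centre n) (l - cube_centre n) else 0)"
  have "N B \<le> N A"
  proof (rule translate_le)
    show "\<exists>s. \<forall>l. cmod (B k l) \<le> cmod (A (k + s) (l + s))" for k
      by (rule exI[of _ "case cube_label k of None \<Rightarrow> 0 | Some n \<Rightarrow> - cube_centre n"])
         (auto simp: B_def split: option.split)
    show "\<exists>s. \<forall>k. cmod (B k l) \<le> cmod (A (k + s) (l + s))" for l
      by (rule exI[of _ "case cube_label l of None \<Rightarrow> 0 | Some n \<Rightarrow> - cube_centre n"])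
         (auto simp: B_def split: option.split)
  qed
  then have B: "N B < \<infinity>" using A by (auto simp: carrier_alg_def)
  have "N blocks \<le> N B + N (\<lambda>k l. of_real \<Lambda> * id_mat k l)"
    by (rule add_le) (auto simp: blocks_def B_def direct_sum_def translate_mat_def split: option.split)
  also have "\<dots> < \<infinity>" using B scaled_id by simp
  finally have "blocks \<in> carrier_alg N" by (simp add: carrier_alg_def)
  then have "l2_inv blocks \<in> carrier_alg N"
    using closed blocks_inverse by (auto simp: inverse_closed_def l2_invertible_def)
  then have R: "N (l2_inv blocks) < \<infinity>" by (simp add: carrier_alg_def)
  show ?thesis
  proof
    show "N (l2_inv blocks) + N (\<lambda>k l. of_real (1 / \<Lambda>) * id_mat k l) < \<infinity>"
      using R scaled_id unfolding infinity_ennreal_def ennreal_add_less_top by blast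
    fix n
    have "N (l2_inv (section_tilde A n))
        \<le> N (\<lambda>k l. l2_inv blocks (k + cube_centre n) (l + cube_centre n)) + N (\<lambda>k l. of_real (1 / \<Lambda>) * id_mat k l)"
      by (rule add_le) (rule section_tilde_inverse_entries)
    also have "\<dots> \<le> N (l2_inv blocks) + N (\<lambda>k l. of_real (1 / \<Lambda>) * id_mat k l)"
      by (intro add_right_mono translate_le) auto
    finally show "N (l2_inv (section_tilde A n)) \<le> N (l2_inv blocks) + N (\<lambda>k l. of_real (1 / \<Lambda>) * id_mat k l)" .
  qed
qed

end

section \<open>The function \<open>phi\<close> as the norm of a tail\<close>

context lp_inclusion
begin

text \<open>Lets Hoelder's inequality and the tail lemma apply to \<open>phi\<close>: it is a norm
  of the indicator of the complement of \<open>Cn n\<close>.\<close>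

lemma phi_eq_lp_norm:
  "phi p m q w n = lp_norm (r_exp p q) (\<lambda>k. w k / m k) (\<lambda>k. if k \<in> Cn n then 0 else 1)"
proof (cases "r_exp p q = \<infinity>")
  case True
  let ?g = "\<lambda>k. cmod (if k \<in> Cn n then 0 else 1) * (w k / m k)"
  have u: "0 \<le> w k / m k" for k by (simp add: X.m_nonneg Y.m_nonneg)
  have "bdd_above (range (\<lambda>k. w k / m k))" using one_in_lp_ratio True by (simp add: lp_def)
  then obtain T where T: "\<And>k. w k / m k \<le> T" by (auto simp: bdd_above_def)
  have bdd: "bdd_above ((\<lambda>k. w k / m k) ` (- Cn n))" by (rule bdd_aboveI2) (rule T)
  have T0: "0 \<le> T" using u[of 0] T[of 0] by linarith
  have bdd': "bdd_above (range ?g)" by (rule bdd_aboveI2[of _ _ T]) (use T T0 in auto)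
  \<comment> \<open>A point off the cube: the supremum over the complement is not over the empty
    set, and it is nonnegative, so the zeros on the cube do not affect it.\<close>
  have out: "(\<chi> i. int n + 1) \<in> - (Cn n :: (int ^ 'd) set)" by (simp add: Cn_def)
  have "(SUP k\<in>- Cn n. w k / m k) = (SUP k. ?g k)"
  proof (rule antisym)
    show "(SUP k\<in>- Cn n. w k / m k) \<le> (SUP k. ?g k)"
    proof (rule cSUP_least)
      fix k :: "int ^ 'd" assume "k \<in> - Cn n"
      then have "w k / m k = ?g k" by simp
      also have "\<dots> \<le> (SUP k. ?g k)" by (rule cSUP_upper[OF UNIV_I bdd'])
      finally show "w k / m k \<le> (SUP k. ?g k)" .
    qed (use out in blast)
    show "(SUP k. ?g k) \<le> (SUP k\<in>- Cn n. w k / m k)"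
    proof (rule cSUP_least)
      fix k
      show "?g k \<le> (SUP k\<in>- Cn n. w k / m k)"
      proof (cases "k \<in> Cn n")
        case True
        have "0 \<le> w (\<chi> i. int n + 1) / m (\<chi> i. int n + 1)" by (rule u)
        also have "\<dots> \<le> (SUP k\<in>- Cn n. w k / m k)" by (rule cSUP_upper[OF out bdd])
        finally show ?thesis using True by simp
      next
        case False
        then show ?thesis using cSUP_upper[OF _ bdd, of k] by simp
      qed
    qed simp
  qed
  then show ?thesis using True by (simp add: phi_def lp_norm_def)
next
  case False
  have "(\<Sum>\<^sub>\<infinity>k\<in>- Cn n. w k powr r / m k powr r)
      = (\<Sum>\<^sub>\<infinity>k. (cmod (if k \<in> Cn n then 0 else 1) * (w k / m k)) powr r)" for r
    by (rule infsum_cong_neutral) (auto simp: powr_divide X.m_nonneg Y.m_nonneg)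
  then show ?thesis using False by (simp add: phi_def Let_def lp_norm_def)
qed

lemma ratio_weighted_lp: "weighted_lp (r_exp p q) (\<lambda>k. w k / m k)"
  by standard (simp_all add: r_exp_ge_1 X.one_le_p Y.one_le_p X.m_pos Y.m_pos)

lemma outside_in_lp_ratio: "(\<lambda>k. if k \<in> Cn n then 0 else 1) \<in> lp (r_exp p q) (\<lambda>k. w k / m k)"
  by (rule weighted_lp.lp_mono(1)[OF ratio_weighted_lp one_in_lp_ratio]) simp

lemma phi_nonneg: "0 \<le> phi p m q w n"
  unfolding phi_eq_lp_norm by (rule weighted_lp.lp_norm_nonneg[OF ratio_weighted_lp outside_in_lp_ratio])

lemma lp_norm_le_phi:
  assumes "c \<in> lp p m" "\<And>k. k \<in> Cn n \<Longrightarrow> c k = 0"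
  shows "lp_norm q w c \<le> phi p m q w n * lp_norm p m c"
proof -
  have "c = (\<lambda>k. (if k \<in> Cn n then 0 else 1) * c k)" using assms(2) by auto
  then show ?thesis
    using Holder_lp(2)[OF X.weighted_lp_axioms Y.weighted_lp_axioms outside_in_lp_ratio assms(1), of n]
    by (simp add: phi_eq_lp_norm)
qed

lemma phi_tendsto_0:
  assumes "q < p"
  shows "phi p m q w \<longlonglongrightarrow> 0"
proof -
  have "r_exp p q \<noteq> \<infinity>" using r_exp_finite[OF X.one_le_p Y.one_le_p assms] by (metis PInfty_neq_ereal(1))
  from weighted_lp.lp_tail_tendsto_0[OF ratio_weighted_lp one_in_lp_ratio this Cn_exhausts]
  show ?thesis unfolding phi_eq_lp_norm .
qed

lemma inclusion_norm:
  "c \<in> lp p m \<Longrightarrow> lp_norm q w c \<le> lp_norm (r_exp p q) (\<lambda>k. w k / m k) (\<lambda>_. 1) * lp_norm p m c"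
  using Holder_lp(2)[OF X.weighted_lp_axioms Y.weighted_lp_axioms one_in_lp_ratio] by simp

end

section \<open>Error estimate and convergence\<close>

locale finite_section_method =
  X: acting_norm N p m + Y: acting_norm N q w + I: lp_inclusion p m q w + positive_invertible A
  for N :: "('d::finite) mat \<Rightarrow> ennreal" and p m q w and A :: "'d mat" +
  fixes b :: "'d sqn"
  assumes closed: "inverse_closed (carrier_alg N)" and A: "A \<in> carrier_alg N" and b: "b \<in> lp p m"
begin

abbreviation "sol \<equiv> mat_app (l2_inv A) b"
abbreviation "Sinv n \<equiv> l2_inv (section_tilde A n)"

lemma Ainv: "l2_inv A \<in> carrier_alg N" "l2_inverse_of A (l2_inv A)"
  using closed A inv l2_inverse_of_l2_inv by (auto simp: inverse_closed_def)

lemma x_lp: "sol \<in> lp p m"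
  by (intro X.X.op_norm_bound(3) X.acts Ainv b)

lemma A_x: "mat_app A sol = b"
  by (intro X.inverse_on_lp(1)[OF A Ainv b])

lemma Sinv_bound: obtains K where "K < \<infinity>" "\<And>n. N (Sinv n) \<le> K"
  using section_tilde_inverse_uniformly_bounded[OF X.solid_matrix_norm_axioms closed A] by blast

lemma Sinv: "Sinv n \<in> carrier_alg N"
proof -
  obtain K where "K < \<infinity>" "\<And>n. N (Sinv n) \<le> K" using Sinv_bound by blast
  then show ?thesis by (auto simp: carrier_alg_def intro: le_less_trans)
qed

lemma Pn_lp: "Pn n y \<in> lp p m"
  by (rule Pn_finite_support[OF X.X.one_le_p X.X.m_pos])

lemma Pn_norm: "y \<in> lp p m \<Longrightarrow> lp_norm p m (Pn n y) \<le> lp_norm p m y"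
  by (erule X.X.lp_mono(2)) (simp add: Pn_def)

lemma xn_lp: "xn A b n \<in> lp p m"
  unfolding xn_eq by (intro X.X.op_norm_bound(3) X.acts Sinv Pn_lp)

lemma xn_outside: "k \<notin> Cn n \<Longrightarrow> xn A b n k = 0"
  using xn_solution by (auto simp: section_solution_def)

lemma Pn_A_xn: "Pn n (mat_app A (xn A b n)) = Pn n b"
  using xn_solution[of b n] mat_app_supported[of n "xn A b n" A] xn_outside
  by (simp add: section_solution_def)

lemma error_lp: "(\<lambda>k. sol k - xn A b n k) \<in> lp p m"
  by (intro X.X.lp_diff(1) x_lp xn_lp)

text \<open>The residual \<open>b - A x\<^sub>n\<close> vanishes on \<open>Cn n\<close>, and \<open>x - x\<^sub>n\<close> is its image under \<open>A\<^sup>-\<^sup>1\<close>.\<close>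

lemma error_estimate:
  assumes K: "embedding_bound N p m K"
  shows "lp_norm q w (sol - xn A b n) \<le> error_const N p m q w K A n * lp_norm p m b * phi p m q w n"
proof -
  define z where "z = (\<lambda>k. sol k - xn A b n k)"
  define g where "g = (\<lambda>k. b k - mat_app A (xn A b n) k)"
  have bddA: "bounded_on_lp p m A" by (rule X.acts[OF A])
  have Az: "mat_app A z = g"
    unfolding z_def g_def using mat_app_diff[OF bddA x_lp xn_lp] by (simp add: A_x)
  have g: "g \<in> lp p m" unfolding g_def by (intro X.X.lp_diff(1) b X.X.op_norm_bound(3)[OF bddA] xn_lp)
  have g0: "g k = 0" if "k \<in> Cn n" for k
    using fun_cong[OF Pn_A_xn[of n], of k] that by (simp add: g_def Pn_def)
  have z: "z = mat_app (l2_inv A) g"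
    using X.inverse_on_lp(2)[OF A Ainv, of z] error_lp[of n] unfolding Az z_def[symmetric] by simp
  have opA: "0 \<le> op_norm p m A" by (rule X.X.op_norm_bound(2)[OF bddA])
  have "lp_norm p m (xn A b n) \<le> op_norm p m (Sinv n) * lp_norm p m (Pn n b)"
    unfolding xn_eq by (intro X.X.op_norm_bound(4) X.acts Sinv Pn_lp)
  also have "\<dots> \<le> op_norm p m (Sinv n) * lp_norm p m b"
    by (intro mult_left_mono Pn_norm b X.X.op_norm_bound(2) X.acts Sinv)
  \<comment> \<open>Here the operator norm of the inverse section is exchanged for its algebra norm,
    which brings \<open>K\<close> into the constant.\<close>
  also have "\<dots> \<le> K * enn2real (N (Sinv n)) * lp_norm p m b"
    using K Sinv by (intro mult_right_mono X.X.lp_norm_nonneg b) (auto simp: embedding_bound_def)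
  finally have xn_norm: "lp_norm p m (xn A b n) \<le> K * enn2real (N (Sinv n)) * lp_norm p m b" .
  have "lp_norm p m g \<le> lp_norm p m b + lp_norm p m (mat_app A (xn A b n))"
    unfolding g_def by (intro X.X.lp_diff(2) b X.X.op_norm_bound(3)[OF bddA] xn_lp)
  also have "lp_norm p m (mat_app A (xn A b n)) \<le> op_norm p m A * lp_norm p m (xn A b n)"
    by (intro X.X.op_norm_bound(4)[OF bddA] xn_lp)
  also have "\<dots> \<le> op_norm p m A * (K * enn2real (N (Sinv n)) * lp_norm p m b)"
    by (intro mult_left_mono xn_norm opA)
  finally have g_norm: "lp_norm p m g \<le> (1 + K * op_norm p m A * enn2real (N (Sinv n))) * lp_norm p m b"
    by (simp add: algebra_simps)
  have gq: "g \<in> lp q w" using g I.inclusion by blast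
  have bddAinv: "bounded_on_lp q w (l2_inv A)" by (rule Y.acts[OF Ainv(1)])
  have "lp_norm q w z \<le> op_norm q w (l2_inv A) * lp_norm q w g"
    unfolding z by (rule Y.X.op_norm_bound(4)[OF bddAinv gq])
  also have "\<dots> \<le> op_norm q w (l2_inv A) * (phi p m q w n * lp_norm p m g)"
    by (intro mult_left_mono I.lp_norm_le_phi g g0 Y.X.op_norm_bound(2)[OF bddAinv])
  also have "\<dots> \<le> op_norm q w (l2_inv A) *
      (phi p m q w n * ((1 + K * op_norm p m A * enn2real (N (Sinv n))) * lp_norm p m b))"
    by (intro mult_left_mono g_norm I.phi_nonneg Y.X.op_norm_bound(2)[OF bddAinv])
  also have "\<dots> = error_const N p m q w K A n * lp_norm p m b * phi p m q w n"
    by (simp add: error_const_def mult_ac)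
  finally show ?thesis by (simp add: z_def fun_diff_def)
qed

lemma error_nonneg: "0 \<le> lp_norm q w (sol - xn A b n)"
  using Y.X.lp_norm_nonneg[of "\<lambda>k. sol k - xn A b n k"] error_lp I.inclusion by (auto simp: fun_diff_def)

text \<open>The error constant depends on \<open>n\<close> only through the algebra norm of
  \<open>Sinv n\<close>, which stability bounds uniformly.\<close>

lemma convergence_of_phi:
  assumes "phi p m q w \<longlonglongrightarrow> 0"
  shows "(\<lambda>n. lp_norm q w (sol - xn A b n)) \<longlonglongrightarrow> 0"
proof -
  obtain K0 where K0: "embedding_bound N p m K0" using X.embedding_bound_exists by blast
  \<comment> \<open>A nonnegative \<open>K\<close> makes the error constant monotone in the norm of
    \<open>Sinv n\<close>.\<close>
  define K where "K = \<bar>K0\<bar>"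
  have K: "embedding_bound N p m K"
    using K0 unfolding embedding_bound_def K_def
    by (meson abs_ge_self enn2real_nonneg mult_right_mono order_trans)
  obtain M where M: "M < \<infinity>" "\<And>n. N (Sinv n) \<le> M" using Sinv_bound by blast
  have NM: "enn2real (N (Sinv n)) \<le> enn2real M" for n
    using M by (intro enn2real_mono) (auto simp: less_top)
  define C where "C = op_norm q w (l2_inv A) * (1 + K * op_norm p m A * enn2real M) * lp_norm p m b"
  have le: "lp_norm q w (sol - xn A b n) \<le> C * phi p m q w n" for n
  proof -
    have "error_const N p m q w K A n \<le> op_norm q w (l2_inv A) * (1 + K * op_norm p m A * enn2real M)"
      unfolding error_const_def
      by (intro mult_left_mono add_left_mono NM mult_nonneg_nonneg
            X.X.op_norm_bound(2)[OF X.acts[OF A]] Y.X.op_norm_bound(2)[OF Y.acts[OF Ainv(1)]])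
         (simp add: K_def)
    then have "error_const N p m q w K A n * lp_norm p m b * phi p m q w n \<le> C * phi p m q w n"
      unfolding C_def by (intro mult_right_mono I.phi_nonneg X.X.lp_norm_nonneg b)
    then show ?thesis using error_estimate[OF K, of n] by linarith
  qed
  have lim: "(\<lambda>n. C * phi p m q w n) \<longlonglongrightarrow> 0"
    using tendsto_mult_left[OF assms, of C] by simp
  show ?thesis
    by (rule tendsto_sandwich[OF _ _ tendsto_const lim]) (simp_all add: error_nonneg le)
qed

text \<open>Stability and consistency: \<open>P\<^sub>n x - x\<^sub>n\<close> is the image of \<open>P\<^sub>n A (P\<^sub>n x - x)\<close> under the inverse
  of \<open>section_tilde A n\<close>, and \<open>P\<^sub>n x\<close> tends to \<open>x\<close> because \<open>p < \<infinity>\<close>.\<close>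

lemma convergence_of_finite_p:
  assumes p: "p \<noteq> \<infinity>"
  shows "(\<lambda>n. lp_norm q w (sol - xn A b n)) \<longlonglongrightarrow> 0"
proof -
  obtain K0 where K0: "embedding_bound N p m K0" using X.embedding_bound_exists by blast
  obtain M where M: "M < \<infinity>" "\<And>n. N (Sinv n) \<le> M" using Sinv_bound by blast
  define S where "S = \<bar>K0\<bar> * enn2real M"
  have S: "op_norm p m (Sinv n) \<le> S" for n
  proof -
    have "op_norm p m (Sinv n) \<le> K0 * enn2real (N (Sinv n))"
      using K0 Sinv by (auto simp: embedding_bound_def)
    also have "\<dots> \<le> \<bar>K0\<bar> * enn2real M"
      using M by (intro mult_mono enn2real_mono) (auto simp: less_top)
    finally show ?thesis by (simp add: S_def)
  qed
  have S0: "0 \<le> S" by (simp add: S_def)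
  have bddA: "bounded_on_lp p m A" by (rule X.acts[OF A])
  define t where "t = (\<lambda>n k. if k \<in> Cn n then 0 else sol k)"
  have t: "t n \<in> lp p m" for n by (rule X.X.lp_mono(1)[OF x_lp]) (simp add: t_def)
  define D where "D = lp_norm (r_exp p q) (\<lambda>k. w k / m k) (\<lambda>_. 1)"
  have D0: "0 \<le> D"
    unfolding D_def by (rule weighted_lp.lp_norm_nonneg[OF I.ratio_weighted_lp I.one_in_lp_ratio])
  define C where "C = D * (1 + S * op_norm p m A)"
  have le: "lp_norm q w (sol - xn A b n) \<le> C * lp_norm p m (t n)" for n
  proof -
    \<comment> \<open>The error splits into the tail \<open>t n\<close> of the solution and
      \<open>v\<close>, which lives on the cube and is controlled by \<open>t n\<close> through
      stability.\<close>
    define v where "v = (\<lambda>k. Pn n sol k - xn A b n k)"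
    have v0: "v k = 0" if "k \<notin> Cn n" for k using that xn_outside[OF that] by (simp add: v_def Pn_def)
    have v: "v \<in> lp p m" unfolding v_def by (intro X.X.lp_diff(1) Pn_lp xn_lp)
    have v_l2: "v \<in> l2" by (rule l2.lp_finite_support[OF finite_Cn v0])
    have z_eq: "(\<lambda>k. sol k - xn A b n k) = (\<lambda>k. t n k + v k)" by (auto simp: t_def v_def Pn_def)
    have xt: "(\<lambda>k. Pn n sol k) = (\<lambda>k. sol k - t n k)" by (auto simp: t_def Pn_def)
    have "mat_app (section_tilde A n) v = Pn n (mat_app A v)"
      by (simp add: mat_app_section_tilde[OF v0] mat_app_supported[OF v0])
    also have "mat_app A v = (\<lambda>k. b k - mat_app A (t n) k - mat_app A (xn A b n) k)"
      unfolding v_def xt using mat_app_diff[OF bddA x_lp t] mat_app_diff[OF bddA X.X.lp_diff(1)[OF x_lp t] xn_lp]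
      by (simp add: A_x)
    also have "Pn n \<dots> = Pn n (\<lambda>k. - mat_app A (t n) k)"
    proof -
      have "mat_app A (xn A b n) k = b k" if "k \<in> Cn n" for k
        using fun_cong[OF Pn_A_xn[of n], of k] that by (simp add: Pn_def)
      then show ?thesis by (auto simp: Pn_def)
    qed
    finally have v_eq: "v = mat_app (Sinv n) (Pn n (\<lambda>k. - mat_app A (t n) k))"
      using section_tilde_left_inverse[OF v_l2, of n] by simp
    have At: "mat_app A (t n) \<in> lp p m" by (rule X.X.op_norm_bound(3)[OF bddA t])
    have "lp_norm p m v \<le> op_norm p m (Sinv n) * lp_norm p m (Pn n (\<lambda>k. - mat_app A (t n) k))"
      unfolding v_eq by (intro X.X.op_norm_bound(4) X.acts Sinv Pn_lp)
    also have "\<dots> \<le> S * (op_norm p m A * lp_norm p m (t n))"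
      using Pn_norm[OF X.X.lp_uminus(1)[OF At], of n] X.X.lp_uminus(2)[OF At] X.X.op_norm_bound(4)[OF bddA t]
      by (intro mult_mono S S0 X.X.lp_norm_nonneg Pn_lp) (metis order_trans)
    finally have "lp_norm p m (\<lambda>k. t n k + v k) \<le> (1 + S * op_norm p m A) * lp_norm p m (t n)"
      using X.X.lp_add(2)[OF t v, of n] by (simp add: algebra_simps)
    then have "D * lp_norm p m (\<lambda>k. t n k + v k) \<le> C * lp_norm p m (t n)"
      unfolding C_def mult.assoc by (rule mult_left_mono[OF _ D0])
    then show ?thesis
      using I.inclusion_norm[OF X.X.lp_add(1)[OF t v], of n] by (simp add: fun_diff_def z_eq D_def)
  qed
  have "(\<lambda>n. lp_norm p m (t n)) \<longlonglongrightarrow> 0"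
    unfolding t_def by (rule X.X.lp_tail_tendsto_0[OF x_lp p Cn_exhausts])
  from tendsto_mult_left[OF this, of C]
  have lim: "(\<lambda>n. C * lp_norm p m (t n)) \<longlonglongrightarrow> 0" by simp
  show ?thesis
    by (rule tendsto_sandwich[OF _ _ tendsto_const lim]) (simp_all add: error_nonneg le)
qed

text \<open>If \<open>p = \<infinity>\<close> and \<open>q < \<infinity>\<close>, then
  \<open>q < p\<close> and \<open>phi\<close> tends to 0 by itself; for finite \<open>p\<close>
  truncation suffices.\<close>

lemma convergence:
  assumes "p < \<infinity> \<or> q < \<infinity> \<or> phi p m q w \<longlonglongrightarrow> 0"
  shows "(\<lambda>n. lp_norm q w (sol - xn A b n)) \<longlonglongrightarrow> 0"
proof (cases "p = \<infinity>")
  case True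
  then have "q < p \<or> phi p m q w \<longlonglongrightarrow> 0" using assms by auto
  then show ?thesis using convergence_of_phi I.phi_tendsto_0 by blast
qed (rule convergence_of_finite_p)

end

theorem theorem14:
  fixes f :: "real ^ 'd \<Rightarrow> real"
    and N :: "'d mat \<Rightarrow> ennreal"
    and p q :: ereal
    and m w :: "int ^ 'd \<Rightarrow> real"
    and A :: "'d mat"
    and b :: "'d sqn"
  assumes "is_norm f"
    and "weighted_algebra_norm f N"
    and "inverse_closed (carrier_alg N)"
    and "1 \<le> p" and "1 \<le> q"
    and "\<And>k. 0 < m k" and "\<And>k. 0 < w k"
    and "lp p m \<subseteq> lp q w"
    and "\<And>B. B \<in> carrier_alg N \<Longrightarrow> bounded_on_lp p m B"
    and "\<And>B. B \<in> carrier_alg N \<Longrightarrow> bounded_on_lp q w B"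
    and "A \<in> carrier_alg N" and "l2_positive A" and "l2_invertible A"
    and "b \<in> lp p m"
  shows "let x = mat_app (l2_inv A) b in
      x \<in> lp q w \<and> mat_app A x = b \<and>
      (\<forall>n. \<exists>!y. section_solution A b n y) \<and>
      (p < \<infinity> \<or> q < \<infinity> \<or> phi p m q w \<longlonglongrightarrow> 0 \<longrightarrow>
         (\<lambda>n. lp_norm q w (x - xn A b n)) \<longlonglongrightarrow> 0) \<and>
      (\<exists>K. embedding_bound N p m K) \<and>
      (\<forall>K. embedding_bound N p m K \<longrightarrow>
         (\<forall>n. lp_norm q w (x - xn A b n)
                \<le> error_const N p m q w K A n * lp_norm p m b * phi p m q w n))"
proof -
  interpret solid_matrix_norm N by (rule weighted_algebra_norm_solid[OF assms(1,2)])
  interpret finite_section_method N p m q w A b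
    by unfold_locales (fact assms)+
  have "sol \<in> lp q w" using x_lp assms(8) by blast
  then show ?thesis
    unfolding Let_def
    by (intro conjI allI impI A_x ex1_section_solution convergence X.embedding_bound_exists error_estimate)
qed

end
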